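(* Let $\mathcal{N}$ be a heteroclinic network without homoclinic connections and let $B$ be a book embedding of $\mathcal{N}$ with $k$ pages. Then $\mathcal{N}$ can be robustly realized in a coupled cell system with $k+1$ cells; that is, there exist a coupled cell network $N$ with $k+1$ cells and a smooth function $f$ such that the coupled cell system $\dot{x}=f^{N}(x)$ on $\mathbb{R}^{k+1}$ is a robust realization of $\mathcal{N}$. In particular, any heteroclinic network with book thickness $b$ and no homoclinic connections can be robustly realized in a coupled cell system with $b+1$ cells.
   Context: **Coupled cell networks.** A coupled cell network $N=(C,E_1,\dots,E_m)$ consists of a finite set $C$ of cells and subsets $E_i\subset C\times C$, $i=1,\dots,m$ (the couplings of type $i$; self-loops are allowed), such that for each $1\le i\le m$ and each cell $c\in C$ there is a unique cell $c_i\in C$ with $(c_i,c)\in E_i$ (the source of the unique type-$i$ coupling received by $c$). Given a function $f:\mathbb{R}^{m+1}\to\mathbb{R}$, the associated admissible vector field $f^N:\mathbb{R}^{|C|}\to\mathbb{R}^{|C|}$ has components $f^N_c(x)=f(x_c,x_{c_1},\dots,x_{c_m})$ for $c\in C$, and the coupled cell system is the ODE $\dot x=f^N(x)$. It is said to have $|C|$ cells. A perturbation of a coupled cell system means a perturbation of the function $f$ (with the network $N$ fixed). **Heteroclinic networks.** For an equilibrium $\xi$ of a smooth ODE with flow $\phi_t$, $W^s(\xi)$ and $W^u(\xi)$ are the sets of $x$ with $\phi_t(x)\to\xi$ as $t\to+\infty$ and $t\to-\infty$, respectively. A heteroclinic connection from equilibrium $\xi$ to equilibrium $\xi'$ is the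 image of a trajectory $\phi_t(x)$ with $\phi_t(x)\to\xi$ as $t\to-\infty$ and $\phi_t(x)\to\xi'$ as $t\to+\infty$; it is called homoclinic if $\xi=\xi'$. A heteroclinic network is represented by a finite directed graph $\mathcal{N}$ which is a union of directed cycles and strongly connected (there is a directed path between any pair of nodes; in particular every node has at least one outgoing edge). Nodes represent equilibria and directed edges represent heteroclinic connections. "Without homoclinic connections" means that the graph has no self-loops. A dynamical system realizes $\mathcal{N}$ if its phase portrait contains distinct equilibria corresponding to the nodes and, for each edge of $\mathcal{N}$, a corresponding heteroclinic connection (distinct for distinct edges) from the equilibrium of the source node to the equilibrium of the target node. A realization by a coupled cell system $\dot x=f^N(x)$ is robust if it persists under small ($C^1$-small) perturbations within the class of coupled cell systems of the fixed network $N$, i.e. the system $\dot x=g^N(x)$ still realizes $\mathcal{N}$ for every $g$ sufficiently close to $f$. **Book embeddings.** Let $G=(V,E)$ be a directed graph. A book embedding of $G$ with $k$ pages consists of a straight line $l\subset\mathbb{R}^3$, planes (pages) $H_1,\dots,H_k\subset\mathbb{R}^3$, and an embedding $\phi$ of the graph in $\mathbb{R}^3$ such that: - the vertices are mapped to distinct points $\phi(v)\in l$; - each edge $e=v_1\to v_2$ is mapped to a smooth curve $\phi(e)$ from $\phi(v_1)$ to $\phi(v_2)$ contained in one of the planes $H_i$; - $H_i\cap H_j=l$ for $i\ne j$ (all planes contain $l$); - $\phi(e)\cap l=\{\phi(v_1),\phi(v_2)\}$ for each edge $e=v_1\to v_2$; - $[\phi(e_1)\cap\phi(e_2)]\setminus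 l=\emptyset$ for any two distinct edges $e_1,e_2$; - in each plane, each vertex has exclusively incoming edges or exclusively outgoing edges (among the edges embedded in that plane); - in each plane, each vertex has at most two outgoing edges, at most one in each of the two half-planes into which $l$ divides the plane. The book thickness of a graph is the minimal number of pages of any book embedding of that graph. *)

theory Defs
  imports
    "HOL-Analysis.Analysis"
    "HOL-Library.Extended_Nat"
    "Graph_Theory.Digraph_Component"
begin

section \<open>Smooth functions on $R^n$ with $n$ a natural number\<close>

text \<open>
  The number \<open>m\<close> of coupling types is existentially quantified, so the domain of the response
  function \<open>f\<close> cannot be \<open>real ^ 'n\<close>.  We use the points of the library space
  \<^const>\<open>Euclidean_space\<close> \<open>n\<close> (sequences vanishing from index \<open>n\<close> on) as $R^n$; the values of
  \<open>f\<close> at other sequences are irrelevant.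
\<close>

definition partial_deriv :: "nat \<Rightarrow> ((nat \<Rightarrow> real) \<Rightarrow> real) \<Rightarrow> (nat \<Rightarrow> real) \<Rightarrow> real" where
  "partial_deriv i f x = deriv (\<lambda>t. f (x(i := t))) (x i)"

primrec Ck_fun :: "nat \<Rightarrow> nat \<Rightarrow> ((nat \<Rightarrow> real) \<Rightarrow> real) \<Rightarrow> bool" where
  "Ck_fun n 0 f \<longleftrightarrow> continuous_map (Euclidean_space n) euclideanreal f"
| "Ck_fun n (Suc r) f \<longleftrightarrow>
     continuous_map (Euclidean_space n) euclideanreal f \<and>
     (\<forall>i<n. (\<forall>x\<in>topspace (Euclidean_space n).
               (\<lambda>t. f (x(i := t))) field_differentiable at (x i)) \<and>
            Ck_fun n r (partial_deriv i f))"

definition smooth_fun :: "nat \<Rightarrow> ((nat \<Rightarrow> real) \<Rightarrow> real) \<Rightarrow> bool" where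
  "smooth_fun n f \<longleftrightarrow> (\<forall>r. Ck_fun n r f)"

definition C1_close :: "nat \<Rightarrow> real \<Rightarrow> ((nat \<Rightarrow> real) \<Rightarrow> real) \<Rightarrow> ((nat \<Rightarrow> real) \<Rightarrow> real) \<Rightarrow> bool" where
  "C1_close n \<epsilon> f g \<longleftrightarrow>
     (\<forall>x\<in>topspace (Euclidean_space n).
        \<bar>g x - f x\<bar> < \<epsilon> \<and> (\<forall>i<n. \<bar>partial_deriv i g x - partial_deriv i f x\<bar> < \<epsilon>))"


section \<open>Coupled cell systems\<close>

text \<open>
  The finite cell set is the universe of the type \<open>'c\<close>.  The coupling types are \<open>1, \<dots>, m\<close> with
  \<open>m = coupling_types N\<close>, and \<open>(d, c) \<in> couplings N i\<close> is a coupling from \<open>d\<close> to \<open>c\<close>.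
\<close>

record 'c cell_network =
  coupling_types :: nat
  couplings :: "nat \<Rightarrow> ('c \<times> 'c) set"

definition coupled_cell_network :: "'c::finite cell_network \<Rightarrow> bool" where
  "coupled_cell_network N \<longleftrightarrow>
     (\<forall>i\<in>{1..coupling_types N}. \<forall>c. \<exists>!d. (d, c) \<in> couplings N i)"

definition coupling_source :: "'c cell_network \<Rightarrow> nat \<Rightarrow> 'c \<Rightarrow> 'c" where
  "coupling_source N i c = (THE d. (d, c) \<in> couplings N i)"

text \<open>Argument \<open>0\<close> of \<open>f\<close> is the state of the cell itself, argument \<open>i\<close> the input of type \<open>i\<close>.\<close>

definition admissible_field ::
    "'c::finite cell_network \<Rightarrow> ((nat \<Rightarrow> real) \<Rightarrow> real) \<Rightarrow> real ^ 'c \<Rightarrow> real ^ 'c" where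
  "admissible_field N f x =
     (\<chi> c. f (\<lambda>i. if i = 0 then x $ c
                  else if i \<le> coupling_types N then x $ coupling_source N i c
                  else 0))"


section \<open>Heteroclinic networks and their realizations\<close>

definition heteroclinic_network :: "('v, 'e) pre_digraph \<Rightarrow> bool" where
  "heteroclinic_network G \<longleftrightarrow>
     fin_digraph G \<and> strongly_connected G \<and>
     arcs G = \<Union>{set p | p. pre_digraph.cycle G p} \<and>
     verts G = \<Union>{tail G ` set p | p. pre_digraph.cycle G p}"

definition trajectory :: "('a::real_normed_vector \<Rightarrow> 'a) \<Rightarrow> (real \<Rightarrow> 'a) \<Rightarrow> bool" where
  "trajectory F x \<longleftrightarrow> (\<forall>t. (x has_vector_derivative F (x t)) (at t))"

definition heteroclinic_connection ::
    "('a::real_normed_vector \<Rightarrow> 'a) \<Rightarrow> 'a \<Rightarrow> 'a \<Rightarrow> 'a set \<Rightarrow> bool" where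
  "heteroclinic_connection F p q \<Gamma> \<longleftrightarrow>
     (\<exists>x. trajectory F x \<and> \<Gamma> = range x \<and> (x \<longlongrightarrow> p) at_bot \<and> (x \<longlongrightarrow> q) at_top)"

definition realizes :: "('a::real_normed_vector \<Rightarrow> 'a) \<Rightarrow> ('v, 'e) pre_digraph \<Rightarrow> bool" where
  "realizes F G \<longleftrightarrow>
     (\<exists>\<xi> \<Gamma>. inj_on \<xi> (verts G) \<and> (\<forall>v\<in>verts G. F (\<xi> v) = 0) \<and>
            inj_on \<Gamma> (arcs G) \<and>
            (\<forall>e\<in>arcs G. heteroclinic_connection F (\<xi> (tail G e)) (\<xi> (head G e)) (\<Gamma> e)))"

text \<open>
  The perturbations are all \<open>C\<^sup>1\<close> functions that are uniformly \<open>C\<^sup>1\<close>-close to \<open>f\<close> on $R^{m+1}$;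
  they need not be smooth.
\<close>

definition robustly_realizes ::
    "'c::finite cell_network \<Rightarrow> ((nat \<Rightarrow> real) \<Rightarrow> real) \<Rightarrow> ('v, 'e) pre_digraph \<Rightarrow> bool" where
  "robustly_realizes N f G \<longleftrightarrow>
     realizes (admissible_field N f) G \<and>
     (\<exists>\<epsilon>>0. \<forall>g. Ck_fun (coupling_types N + 1) 1 g \<and> C1_close (coupling_types N + 1) \<epsilon> f g
               \<longrightarrow> realizes (admissible_field N g) G)"


section \<open>Book embeddings\<close>

text \<open>
  \<open>C\<^sup>\<infinity>\<close> on the closed interval, one-sided at the end points.  The velocity may vanish, which only
  admits more book embeddings.
\<close>

definition smooth_curve :: "(real \<Rightarrow> 'a::real_normed_vector) \<Rightarrow> bool" where
  "smooth_curve \<gamma> \<longleftrightarrow>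
     (\<exists>D. D 0 = \<gamma> \<and>
          (\<forall>r. \<forall>t\<in>{0..1}. (D r has_vector_derivative D (Suc r) t) (at t within {0..1})))"

text \<open>The pages of a book with \<open>k\<close> pages are \<open>page B i\<close> for \<open>i < k\<close>.\<close>

record ('v, 'e) book =
  spine :: "(real ^ 3) set"
  page :: "nat \<Rightarrow> (real ^ 3) set"
  vertex_point :: "'v \<Rightarrow> real ^ 3"
  edge_curve :: "'e \<Rightarrow> real \<Rightarrow> real ^ 3"

definition page_arcs :: "('v, 'e) pre_digraph \<Rightarrow> ('v, 'e) book \<Rightarrow> nat \<Rightarrow> 'e set" where
  "page_arcs G B i = {e \<in> arcs G. path_image (edge_curve B e) \<subseteq> page B i}"

text \<open>The open half-planes of page \<open>i\<close> are the two connected components of \<open>page B i - spine B\<close>.\<close>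

definition book_embedding :: "('v, 'e) pre_digraph \<Rightarrow> nat \<Rightarrow> ('v, 'e) book \<Rightarrow> bool" where
  "book_embedding G k B \<longleftrightarrow>
     affine (spine B) \<and> aff_dim (spine B) = 1 \<and>
     (\<forall>i<k. affine (page B i) \<and> aff_dim (page B i) = 2 \<and> spine B \<subseteq> page B i) \<and>
     (\<forall>i<k. \<forall>j<k. i \<noteq> j \<longrightarrow> page B i \<inter> page B j = spine B) \<and>
     vertex_point B ` verts G \<subseteq> spine B \<and> inj_on (vertex_point B) (verts G) \<and>
     (\<forall>e\<in>arcs G.
        arc (edge_curve B e) \<and> smooth_curve (edge_curve B e) \<and>
        pathstart (edge_curve B e) = vertex_point B (tail G e) \<and>
        pathfinish (edge_curve B e) = vertex_point B (head G e) \<and>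
        (\<exists>i<k. path_image (edge_curve B e) \<subseteq> page B i) \<and>
        path_image (edge_curve B e) \<inter> spine B =
          {vertex_point B (tail G e), vertex_point B (head G e)}) \<and>
     (\<forall>e1\<in>arcs G. \<forall>e2\<in>arcs G. e1 \<noteq> e2 \<longrightarrow>
        (path_image (edge_curve B e1) \<inter> path_image (edge_curve B e2)) - spine B = {}) \<and>
     (\<forall>i<k. \<forall>v\<in>verts G.
        (in_arcs G v \<inter> page_arcs G B i = {} \<or> out_arcs G v \<inter> page_arcs G B i = {}) \<and>
        finite (out_arcs G v \<inter> page_arcs G B i) \<and>
        card (out_arcs G v \<inter> page_arcs G B i) \<le> 2 \<and>
        (\<forall>S\<in>components (page B i - spine B).
           \<forall>e1\<in>out_arcs G v \<inter> page_arcs G B i. \<forall>e2\<in>out_arcs G v \<inter> page_arcs G B i.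
             path_image (edge_curve B e1) - spine B \<subseteq> S \<and>
             path_image (edge_curve B e2) - spine B \<subseteq> S \<longrightarrow> e1 = e2))"

text \<open>The infimum of the empty set is \<open>\<infinity>\<close>, the thickness of a graph without book embeddings.\<close>

definition book_thickness :: "('v, 'e) pre_digraph \<Rightarrow> enat" where
  "book_thickness G = Inf {enat k | k. \<exists>B. book_embedding G k B}"

end

theory Submission
  imports Defs
begin

text \<open>
  The cells are \<open>c\<^sub>0, \<dots>, c\<^sub>k\<close>; page \<open>i\<close> of the book becomes the plane on which all cells but
  \<open>c\<^sub>i\<close> are synchronous, and the spine becomes the diagonal.  The couplings can be chosen so that
  these planes are invariant for every response function while the fields on them can be
  prescribed independently, up to agreement on the diagonal.  In coordinates \<open>(x, y)\<close> of a
  page, with \<open>y = 0\<close> the diagonal, the field is \<open>x' = - sin (2 \<pi> x) + y\<^sup>2 \<alpha> (x, y)\<close>,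
  \<open>y' = y \<beta> (x, y)\<close>: the vertices sit at integers, where the diagonal is attracting, and
  \<open>\<beta>\<close> is positive above sources and negative above sinks of the page.  An edge \<open>p \<rightarrow> q\<close> is
  realized by an orbit which climbs above \<open>p\<close> to height \<open>\<bar>q - p\<bar>\<close>, crosses at that height to
  \<open>q\<close> and descends to it.  Edges in one half-plane do not interlace, by the theorem on crossing paths
  in a rectangle, so these routes impose compatible sign conditions on \<open>\<alpha>\<close> and \<open>\<beta>\<close> over
  disjoint compact sets, and polynomials satisfying them exist by Urysohn and Stone-Weierstrass.
  Strict sign conditions survive perturbation, and they force the connection: the unstable
  orbit of the saddle is a limit of orbits that start ever closer to the diagonal, and it cannot
  leave the route.
\<close>

section \<open>Ordinary differential equations\<close>

text \<open>The obstacle is that all edges of a page are driven by one pair \<alpha>, \<beta>, so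
  two routes must never ask for opposite motions at a common point. Integer positions and crossing
  heights \<open>\<bar>q - p\<bar>\<close> achieve this: edges that overlap without interlacing are
  nested, the inner one is shorter by at least 1, and the tolerances 1/8, 1/4, 1/2 fit into that
  unit. The two half-planes of a page share the diagonal, where one sign of \<beta> must serve both;
  hence a vertex is only a source or only a sink in a page. A saddle has one unstable branch in each
  half-plane, which can follow only one edge. The sine makes every integer attracting on the
  diagonal, so travel between vertices takes place at height at least 3/4, where
  \<open>y\<^sup>2 * \<alpha>\<close> beats the sine. The square gives \<alpha> the same meaning on
  both sides of the diagonal. Synchrony makes the perturbation of y' vanish on the diagonal for
  every response function, so it is bounded by a small multiple of \<open>\<bar>y\<bar>\<close>: the
  sign of \<beta> stays decisive however close an orbit comes to the diagonal.\<close>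

lemma antiderivative_UNIV:
  fixes h :: "real \<Rightarrow> 'a::euclidean_space"
  assumes "continuous_on UNIV h"
  shows "\<exists>H. H 0 = 0 \<and> (\<forall>t. (H has_vector_derivative h t) (at t))"
proof -
  let ?H = "\<lambda>u. LBINT y=ereal 0..ereal u. h y"
  have "?H 0 = 0 \<and> (\<forall>t. (?H has_vector_derivative h t) (at t))"
  proof (intro conjI allI)
    show "?H 0 = 0" by (simp add: interval_integral_endpoints_same)
    fix t :: real
    define a where "a = - \<bar>t\<bar> - 1"
    define b where "b = \<bar>t\<bar> + 1"
    have "(?H has_vector_derivative h t) (at t within {a..b})"
      by (rule interval_integral_FTC2)
         (use assms in \<open>auto simp: a_def b_def intro: continuous_on_subset\<close>)
    moreover have "at t within {a..b} = at t"
      by (rule at_within_interior) (auto simp: a_def b_def)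
    ultimately show "(?H has_vector_derivative h t) (at t)" by simp
  qed
  then show ?thesis by (rule exI[of _ ?H])
qed

text \<open>Integrating the exponential bound gives the estimate for positive times, and reflecting
  time gives the rest. It is used twice below: to see that the weighted Picard operator preserves
  bounded functions, and that it contracts.\<close>

lemma norm_le_exp_of_derivative_bound:
  fixes H :: "real \<Rightarrow> 'a::euclidean_space"
  assumes H: "\<And>t. (H has_vector_derivative h t) (at t)" and "H 0 = 0" and K: "K > 0"
    and bound: "\<And>t. norm (h t) \<le> C * exp (K * \<bar>t\<bar>)"
  shows "norm (H t) \<le> C / K * (exp (K * \<bar>t\<bar>) - 1)"
proof -
  have pos: "norm (H t) \<le> C / K * (exp (K * t) - 1)"
    if "0 \<le> t" and H: "\<And>t. (H has_vector_derivative h t) (at t)" and "H 0 = 0"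
      and bound: "\<And>t. norm (h t) \<le> C * exp (K * \<bar>t\<bar>)" for H h t
  proof (cases "t = 0")
    case False
    have "norm (H t - H 0) \<le> C / K * exp (K * t) - C / K * exp (K * 0)"
    proof (rule differentiable_bound_general[of 0 t H "\<lambda>t. C / K * exp (K * t)" h "\<lambda>t. C * exp (K * t)"])
      show "0 < t" using False that by simp
      show "continuous_on {0..t} H"
        by (meson H continuous_at_imp_continuous_on has_vector_derivative_continuous)
      show "continuous_on {0..t} (\<lambda>t. C / K * exp (K * t))" by (intro continuous_intros)
      show "((\<lambda>t. C / K * exp (K * t)) has_vector_derivative C * exp (K * x)) (at x)" for x
        using K by (auto intro!: derivative_eq_intros simp flip: has_real_derivative_iff_has_vector_derivative)
      show "(H has_vector_derivative h x) (at x)" for x by (rule H)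
      show "norm (h x) \<le> C * exp (K * x)" if "0 < x" for x using bound[of x] that by simp
    qed
    then show ?thesis using that by (simp add: algebra_simps)
  qed (use that in simp)
  show ?thesis
  proof (cases "0 \<le> t")
    case True
    then show ?thesis using pos[OF True H assms(2) bound] by simp
  next
    case False
    have "((\<lambda>t. H (- t)) has_vector_derivative - h (- t)) (at t)" for t
    proof -
      have "(uminus has_vector_derivative - 1) (at t)"
        by (auto intro!: derivative_eq_intros simp flip: has_real_derivative_iff_has_vector_derivative)
      then show ?thesis using vector_diff_chain_at[of uminus "-1" t H "h (- t)"] H[of "- t"]
        by (simp add: o_def)
    qed
    from pos[of "- t" "\<lambda>t. H (- t)" "\<lambda>t. - h (- t)", OF _ this] False assms(2) bound
    show ?thesis by (metis abs_minus_cancel abs_of_neg le_cases linorder_not_le minus_minus minus_zero neg_0_le_iff_le norm_minus_cancel)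
  qed
qed

text \<open>Picard iteration in a weighted supremum norm: the unknown is
  \<open>u t = exp (- (K * \<bar>t\<bar>)) *\<^sub>R x t\<close>, a bounded continuous function on
  the whole line. With \<open>K = 2 * M\<close> the operator contracts by
  \<open>M / K = 1/2\<close>, so the Banach fixed point is a global solution at once.\<close>

lemma lipschitz_global_solution:
  fixes F :: "'a::euclidean_space \<Rightarrow> 'a"
  assumes L: "L-lipschitz_on UNIV F"
  shows "\<exists>x. x 0 = x0 \<and> (\<forall>t. (x has_vector_derivative F (x t)) (at t))"
proof -
  \<comment> \<open>The summand 1 keeps the weight exponent positive when L is 0.\<close>
  define M where "M = L + 1"
  have "0 \<le> L" using L by (rule lipschitz_on_nonneg)
  then have M: "M > 0" and F: "dist (F x) (F y) \<le> M * dist x y" for x y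
    using lipschitz_onD[OF L, of x y] mult_right_mono[of L M "dist x y"] by (auto simp: M_def)
  define K where "K = 2 * M"
  have K: "K > 0" using M by (simp add: K_def)
  have contF: "continuous_on UNIV F" using L by (rule lipschitz_on_continuous_on)
  have contw: "continuous_on UNIV (\<lambda>t. exp (K * \<bar>t\<bar>) *\<^sub>R apply_bcontfun u t)" for u :: "real \<Rightarrow>\<^sub>C 'a"
    by (intro continuous_intros continuous_on_apply_bcontfun)
  define h where "h u t = F (exp (K * \<bar>t\<bar>) *\<^sub>R apply_bcontfun u t)" for u :: "real \<Rightarrow>\<^sub>C 'a" and t
  have "\<exists>H. H 0 = 0 \<and> (\<forall>t. (H has_vector_derivative h u t) (at t))" for u
    using continuous_on_compose2[OF contF contw] by (intro antiderivative_UNIV) (auto simp: h_def)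
  then obtain H where H0: "\<And>u. H u 0 = 0" and H: "\<And>u t. (H u has_vector_derivative h u t) (at t)"
    by metis
  define P where "P u t = exp (- (K * \<bar>t\<bar>)) *\<^sub>R (x0 + H u t)" for u t
  have contH: "continuous_on UNIV (H u)" for u
    by (meson H continuous_at_imp_continuous_on has_vector_derivative_continuous)
  have decay: "exp (- (K * \<bar>t\<bar>)) * (C / K * (exp (K * \<bar>t\<bar>) - 1)) \<le> C / K" if "C \<ge> 0" for C t
  proof -
    have "exp (- (K * \<bar>t\<bar>)) * (C / K * (exp (K * \<bar>t\<bar>) - 1)) = C / K * (1 - exp (- (K * \<bar>t\<bar>)))"
      by (simp add: algebra_simps exp_minus field_simps)
    also have "\<dots> \<le> C / K * 1" using K that by (intro mult_left_mono) auto
    finally show ?thesis by simp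
  qed
  have Pb: "P u \<in> bcontfun" for u
  proof (rule bcontfun_normI)
    show "continuous_on UNIV (P u)" unfolding P_def by (intro continuous_intros contH)
    fix t
    let ?C = "norm (F 0) + M * norm u"
    have "norm (h u t) \<le> ?C * exp (K * \<bar>t\<bar>)" for t
    proof -
      have "norm (h u t) \<le> norm (F 0) + dist (h u t) (F 0)"
        by (metis add.commute dist_0_norm dist_commute dist_triangle2)
      also have "dist (h u t) (F 0) \<le> M * (exp (K * \<bar>t\<bar>) * norm (apply_bcontfun u t))"
        using F[of "exp (K * \<bar>t\<bar>) *\<^sub>R apply_bcontfun u t" 0] by (simp add: h_def)
      also have "\<dots> \<le> M * (exp (K * \<bar>t\<bar>) * norm u)"
        using M by (intro mult_left_mono norm_bounded) auto
      also have "norm (F 0) \<le> norm (F 0) * exp (K * \<bar>t\<bar>)"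
        using K by (simp add: mult_le_cancel_left1)
      finally show ?thesis by (simp add: algebra_simps)
    qed
    from norm_le_exp_of_derivative_bound[OF H H0 K this]
    have "norm (H u t) \<le> ?C / K * (exp (K * \<bar>t\<bar>) - 1)" .
    then have "norm (P u t) \<le> exp (- (K * \<bar>t\<bar>)) * (norm x0 + ?C / K * (exp (K * \<bar>t\<bar>) - 1))"
      unfolding P_def norm_scaleR using norm_triangle_ineq[of x0 "H u t"]
      by (intro mult_mono) auto
    also have "\<dots> \<le> norm x0 + ?C / K"
      using decay[of ?C t] M K mult_right_mono[of "exp (- (K * \<bar>t\<bar>))" 1 "norm x0"] by (simp add: distrib_left)
    finally show "norm (P u t) \<le> norm x0 + ?C / K" .
  qed
  have "\<exists>!u. Bcontfun (P u) = u"
  proof (rule banach_fix_type)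
    show "\<forall>u v. dist (Bcontfun (P u)) (Bcontfun (P v)) \<le> (1/2) * dist u v"
    proof (intro allI dist_bound)
      fix u v :: "real \<Rightarrow>\<^sub>C 'a" and t
      have der: "((\<lambda>t. H u t - H v t) has_vector_derivative h u t - h v t) (at t)" for t
        by (intro has_vector_derivative_diff H)
      have "norm (h u t - h v t) \<le> (M * dist u v) * exp (K * \<bar>t\<bar>)" for t
      proof -
        have "norm (h u t - h v t) \<le> M * (exp (K * \<bar>t\<bar>) * dist (apply_bcontfun u t) (apply_bcontfun v t))"
          using F[of "exp (K * \<bar>t\<bar>) *\<^sub>R apply_bcontfun u t" "exp (K * \<bar>t\<bar>) *\<^sub>R apply_bcontfun v t"]
          by (simp add: h_def dist_norm flip: scaleR_diff_right)
        also have "\<dots> \<le> M * (exp (K * \<bar>t\<bar>) * dist u v)"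
          using M by (intro mult_left_mono dist_bounded) auto
        finally show ?thesis by (simp add: algebra_simps)
      qed
      from norm_le_exp_of_derivative_bound[OF der _ K this]
      have "norm (H u t - H v t) \<le> M * dist u v / K * (exp (K * \<bar>t\<bar>) - 1)" by (simp add: H0)
      then have "exp (- (K * \<bar>t\<bar>)) * norm (H u t - H v t) \<le> M * dist u v / K"
        using decay[of "M * dist u v" t] M
        by (meson exp_ge_zero mult_left_mono order_trans mult_nonneg_nonneg zero_le_dist less_imp_le)
      also have "M * dist u v / K = (1/2) * dist u v" using M by (simp add: K_def)
      finally show "dist (apply_bcontfun (Bcontfun (P u)) t) (apply_bcontfun (Bcontfun (P v)) t) \<le> (1/2) * dist u v"
        by (simp add: Bcontfun_inverse Pb dist_norm P_def flip: scaleR_diff_right)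
    qed
  qed auto
  then obtain u where u: "Bcontfun (P u) = u" by auto
  define x where "x t = x0 + H u t" for t
  have "apply_bcontfun u t = P u t" for t using u Bcontfun_inverse[OF Pb] by metis
  then have "h u t = F (x t)" for t
    by (simp add: h_def P_def x_def flip: exp_add)
  then have "(x has_vector_derivative F (x t)) (at t)" for t
    unfolding x_def using has_vector_derivative_add[OF has_vector_derivative_const H, of x0 u t] by simp
  moreover have "x 0 = x0" by (simp add: x_def H0)
  ultimately show ?thesis by auto
qed

text \<open>The derivative bound says that \<open>exp (k * t) * S t\<close> is nonincreasing. As k
  may have either sign, the lemma also bounds growth, and applied to a negated function it gives
  lower bounds.\<close>

lemma exp_decay_bound:
  fixes S :: "real \<Rightarrow> real"
  assumes "a \<le> b" and "\<And>t. a \<le> t \<Longrightarrow> t \<le> b \<Longrightarrow> (S has_real_derivative S' t) (at t)"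
    and "\<And>t. a \<le> t \<Longrightarrow> t \<le> b \<Longrightarrow> S' t \<le> - k * S t"
  shows "S b \<le> S a * exp (- k * (b - a))"
proof -
  have "exp (k * b) * S b \<le> exp (k * a) * S a"
  proof (rule DERIV_nonpos_imp_nonincreasing[OF assms(1)], intro exI conjI)
    fix t assume t: "a \<le> t" "t \<le> b"
    show "((\<lambda>t. exp (k * t) * S t) has_real_derivative exp (k * t) * (k * S t + S' t)) (at t)"
      using assms(2)[OF t] by (auto intro!: derivative_eq_intros simp: algebra_simps)
    show "exp (k * t) * (k * S t + S' t) \<le> 0" using assms(3)[OF t] by (simp add: mult_le_0_iff)
  qed
  then show ?thesis by (simp add: exp_diff exp_minus field_simps)
qed

text \<open>Gronwall's inequality for the squared distance, which stays differentiable where the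
  distance vanishes. Backward times follow by reflection.\<close>

lemma lipschitz_solutions_close:
  fixes F :: "'a::euclidean_space \<Rightarrow> 'a"
  assumes L: "L-lipschitz_on UNIV F"
    and x: "\<And>t. (x has_vector_derivative F (x t)) (at t)"
    and y: "\<And>t. (y has_vector_derivative F (y t)) (at t)"
  shows "norm (x t - y t) \<le> exp (L * \<bar>t\<bar>) * norm (x 0 - y 0)"
proof -
  define d where "d t = (x t - y t) \<bullet> (x t - y t)" for t
  define d' where "d' t = 2 * ((x t - y t) \<bullet> (F (x t) - F (y t)))" for t
  have d: "(d has_real_derivative d' t) (at t)" for t
    using bounded_bilinear.has_vector_derivative[OF bounded_bilinear_inner
        has_vector_derivative_diff[OF x y] has_vector_derivative_diff[OF x y], of t]
    unfolding d_def d'_def has_real_derivative_iff_has_vector_derivative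
    by (simp add: inner_commute)
  have d'_le: "\<bar>d' t\<bar> \<le> 2 * L * d t" for t
  proof -
    have "\<bar>d' t\<bar> \<le> 2 * (norm (x t - y t) * norm (F (x t) - F (y t)))"
      unfolding d'_def abs_mult using Cauchy_Schwarz_ineq2 by auto
    also have "\<dots> \<le> 2 * (norm (x t - y t) * (L * norm (x t - y t)))"
      using lipschitz_onD[OF L, of "x t" "y t"] by (intro mult_left_mono) (auto simp: dist_norm)
    finally show ?thesis by (simp add: d_def dot_square_norm power2_eq_square algebra_simps)
  qed
  have "d t \<le> d 0 * exp (2 * L * \<bar>t\<bar>)"
  proof (cases "0 \<le> t")
    case True
    have "d' s \<le> - (- 2 * L) * d s" for s using d'_le[of s] by simp
    from exp_decay_bound[OF True d this] True show ?thesis by simp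
  next
    case False
    define e where "e t = d (- t)" for t
    have e: "(e has_real_derivative - d' (- s)) (at s)" for s
    proof -
      have "(uminus has_real_derivative - 1) (at s)" by (auto intro!: derivative_eq_intros)
      then show ?thesis unfolding e_def using DERIV_chain2[of d "d' (- s)" uminus s "-1" UNIV] d[of "- s"]
        by simp
    qed
    have "- d' (- s) \<le> - (- 2 * L) * e s" for s using d'_le[of "- s"] by (simp add: e_def)
    from exp_decay_bound[OF _ e this, of 0 "- t"] False show ?thesis by (simp add: e_def)
  qed
  also have "\<dots> = (exp (L * \<bar>t\<bar>) * norm (x 0 - y 0))\<^sup>2"
    by (simp add: d_def dot_square_norm power_mult_distrib power2_eq_square flip: exp_add)
  finally show ?thesis
    unfolding d_def dot_square_norm by (rule power2_le_imp_le) simp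
qed

section \<open>A planar connection from a saddle to a sink\<close>

text \<open>Forward invariance of a region cut out by finitely many inequalities; a member of U is a
  function with its derivative along the orbit. Inwardness at a wall is asked only at times when the
  other inequalities hold, so every wall may be checked within the region itself.\<close>

lemma barrier:
  fixes U :: "((real \<Rightarrow> real) \<times> (real \<Rightarrow> real)) set"
  assumes "finite U"
    and der: "\<And>u u' t. (u, u') \<in> U \<Longrightarrow> (u has_real_derivative u' t) (at t)"
    and init: "\<And>u u'. (u, u') \<in> U \<Longrightarrow> u a \<ge> 0"
    and inward: "\<And>u u' t. \<lbrakk>a \<le> t; t < b; (u, u') \<in> U; u t = 0; \<forall>(v, v')\<in>U. v t \<ge> 0\<rbrakk> \<Longrightarrow> u' t > 0"
    and t: "a \<le> t" "t \<le> b" and "(u, u') \<in> U"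
  shows "u t \<ge> 0"
proof (rule ccontr)
  assume neg: "\<not> u t \<ge> 0"
  define S where "S = {s \<in> {a..t}. \<forall>r\<in>{a..s}. \<forall>(v, v')\<in>U. v r \<ge> 0}"
  have aS: "a \<in> S" using init t by (auto simp: S_def)
  have bdd: "bdd_above S" by (auto simp: S_def bdd_above_def)
  define c where "c = Sup S"
  have "a \<le> c" unfolding c_def by (rule cSup_upper[OF aS bdd])
  have "s \<le> t" if "s \<in> S" for s using that unfolding S_def by simp
  then have "c \<le> t" unfolding c_def using aS by (intro cSup_least) auto
  note c = \<open>a \<le> c\<close> \<open>c \<le> t\<close>
  have less: "v r \<ge> 0" if "a \<le> r" "r < c" "(v, v') \<in> U" for r v v'
  proof -
    obtain s where s: "s \<in> S" "r < s"
      using \<open>r < c\<close> less_cSup_iff[of S r] aS bdd unfolding c_def by blast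
    then have "r \<in> {a..s}" using that by simp
    then show ?thesis using s(1) that(3) unfolding S_def by blast
  qed
  have at_c: "v c \<ge> 0" if v: "(v, v') \<in> U" for v v'
  proof (cases "a = c")
    case False
    have "isCont v c" using der[OF v] by (rule DERIV_isCont)
    then have lim: "(v \<longlongrightarrow> v c) (at_left c)" by (simp add: isCont_def filterlim_at_split)
    have "eventually (\<lambda>r. v r \<ge> 0) (at_left c)"
      unfolding eventually_at_left_field using less v False c(1) by (intro exI[of _ a]) auto
    then show ?thesis by (intro tendsto_lowerbound[OF lim]) auto
  qed (use init v in auto)
  have "c \<noteq> t" using at_c assms(7) neg by auto
  then have "c < t" using c by simp
  \<comment> \<open>A function vanishing at c is pushed up by its positive derivative, the others
    stay positive by continuity. Finiteness of U gives a common interval, on which the supremum c is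
    exceeded.\<close>
  have "eventually (\<lambda>r. \<forall>p\<in>U. fst p r \<ge> 0) (at_right c)"
  proof (rule eventually_ball_finite[OF assms(1)], intro ballI, clarify)
    fix v v' assume v: "(v, v') \<in> U"
    show "eventually (\<lambda>r. fst (v, v') r \<ge> 0) (at_right c)"
    proof (cases "v c = 0")
      case True
      have "\<forall>(v, v')\<in>U. v c \<ge> 0" using at_c by auto
      then have "v' c > 0" using inward[of c v v'] c \<open>c < t\<close> t v True by auto
      then obtain d where "d > 0" "\<And>h. 0 < h \<Longrightarrow> h < d \<Longrightarrow> v c < v (c + h)"
        using DERIV_pos_inc_right[OF der[OF v]] by blast
      note d = this
      have "fst (v, v') r \<ge> 0" if "c < r" "r < c + d" for r
        using d(2)[of "r - c"] that True by simp
      then show ?thesis unfolding eventually_at_right_field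
        using d(1) by (intro exI[of _ "c + d"]) auto
    next
      case False
      then have "v c > 0" using at_c[OF v] by simp
      moreover have "(v \<longlongrightarrow> v c) (at_right c)"
        using DERIV_isCont[OF der[OF v]] by (simp add: isCont_def filterlim_at_split)
      ultimately have "eventually (\<lambda>r. v r > 0) (at_right c)" by (rule order_tendstoD(1)[rotated])
      then show ?thesis by (rule eventually_mono) simp
    qed
  qed
  then obtain d where d: "d > c" "\<And>r. c < r \<Longrightarrow> r < d \<Longrightarrow> \<forall>p\<in>U. fst p r \<ge> 0"
    unfolding eventually_at_right_field by blast
  define s where "s = min t ((c + d) / 2)"
  have s: "c < s" "s < d" "s \<le> t" using d \<open>c < t\<close> by (auto simp: s_def min_def)
  have "v r \<ge> 0" if r: "a \<le> r" "r \<le> s" and v: "(v, v') \<in> U" for r v v'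
  proof -
    consider "r < c" | "r = c" | "c < r" by linarith
    then show ?thesis
    proof cases
      case 1 then show ?thesis using less r v by blast
    next
      case 2 then show ?thesis using at_c v by blast
    next
      case 3
      have "\<forall>p\<in>U. fst p r \<ge> 0" using d(2)[OF 3] r s by simp
      then show ?thesis using v by force
    qed
  qed
  then have "s \<in> S" using s c by (auto simp: S_def)
  then have "s \<le> c" unfolding c_def by (rule cSup_upper[OF _ bdd])
  then show False using s by simp
qed

lemma first_hit_IVT:
  fixes u :: "real \<Rightarrow> real"
  assumes cont: "\<And>X. continuous_on X u" and "u a \<le> c" "a \<le> t1" "c \<le> u t1"
  obtains T where "a \<le> T" "u T = c" "\<And>t. a \<le> t \<Longrightarrow> t < T \<Longrightarrow> u t < c"
proof -
  define Z where "Z = {t \<in> {a..t1}. u t = c}"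
  have "Z \<noteq> {}" using IVT'[of u a c t1] assms(2-4) cont by (auto simp: Z_def)
  moreover have "compact Z"
    unfolding compact_eq_bounded_closed Z_def
  proof
    show "bounded {t \<in> {a..t1}. u t = c}" by (rule bounded_subset[OF bounded_closed_interval[of a t1]]) auto
    show "closed {t \<in> {a..t1}. u t = c}" by (intro continuous_closed_preimage_constant cont) auto
  qed
  ultimately have "\<exists>T\<in>Z. \<forall>t\<in>Z. T \<le> t" by (rule compact_attains_inf[rotated])
  then obtain T where T: "T \<in> Z" "\<And>t. t \<in> Z \<Longrightarrow> T \<le> t" by auto
  have "u t < c" if t: "a \<le> t" "t < T" for t
  proof (rule ccontr)
    assume "\<not> u t < c"
    then obtain s where "a \<le> s" "s \<le> t" "u s = c" using IVT'[of u a c t] t assms(2) cont by auto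
    then show False using T(2)[of s] T(1) t by (auto simp: Z_def)
  qed
  then show ?thesis using that T by (auto simp: Z_def)
qed

text \<open>Growth at a rate of at least m cannot go on forever below c. The rate may be derived
  from the assumption that the level has not been reached so far, since the field is controlled only
  there.\<close>

lemma first_hit:
  fixes u :: "real \<Rightarrow> real"
  assumes der: "\<And>t. (u has_real_derivative u' t) (at t)" and "u a \<le> c" and m: "m > 0"
    and grow: "\<And>t. a \<le> t \<Longrightarrow> (\<And>s. a \<le> s \<Longrightarrow> s \<le> t \<Longrightarrow> u s < c) \<Longrightarrow> u' t \<ge> m"
  obtains T where "a \<le> T" "u T = c" "\<And>t. a \<le> t \<Longrightarrow> t < T \<Longrightarrow> u t < c"
proof -
  have cont: "continuous_on X u" for X
    by (meson der DERIV_isCont continuous_at_imp_continuous_on)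
  have "\<exists>t1\<ge>a. c \<le> u t1"
  proof (rule ccontr)
    assume "\<not> ?thesis"
    then have below: "u t < c" if "a \<le> t" for t using that by force
    define t where "t = a + (c - u a) / m"
    have at: "a \<le> t" using assms(2) m by (simp add: t_def)
    have "u a - m * a \<le> u t - m * t"
    proof (rule DERIV_nonneg_imp_nondecreasing[OF at], intro exI conjI)
      fix s assume "a \<le> s" "s \<le> t"
      show "((\<lambda>s. u s - m * s) has_real_derivative u' s - m) (at s)"
        by (auto intro!: derivative_eq_intros der)
      show "0 \<le> u' s - m" using grow[of s] below \<open>a \<le> s\<close> by simp
    qed
    then have "c \<le> u t" using m by (simp add: t_def field_simps)
    then show False using below[OF at] by simp
  qed
  then obtain t1 where "a \<le> t1" "c \<le> u t1" by blast
  show ?thesis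
    by (rule first_hit_IVT[OF cont assms(2) \<open>a \<le> t1\<close> \<open>c \<le> u t1\<close>]) (rule that)
qed

text \<open>
  The field \<open>(A, G)\<close> has a saddle at \<open>(p, 0)\<close> and a sink at \<open>(q, 0)\<close>: orbits climb
  above the saddle, cross at height about \<open>n\<close> and descend above the sink.
\<close>

locale channel =
  fixes A G :: "real \<Rightarrow> real \<Rightarrow> real" and n L b p q :: real
  assumes lipA: "\<bar>A x y - A x' y'\<bar> \<le> L * (\<bar>x - x'\<bar> + \<bar>y - y'\<bar>)"
    and lipG: "\<bar>G x y - G x' y'\<bar> \<le> L * (\<bar>x - x'\<bar> + \<bar>y - y'\<bar>)"
    and G0: "G x 0 = 0"
    and L: "L > 0" and b: "b > 0" and n: "n \<ge> 1"
    and climb: "\<bar>x\<bar> \<le> 1/8 \<Longrightarrow> 0 \<le> y \<Longrightarrow> y \<le> n - 1/2 \<Longrightarrow> G x y \<ge> b * y"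
    and floor: "- 1/8 \<le> x \<Longrightarrow> x \<le> n - 1/4 \<Longrightarrow> n - 1/2 \<le> y \<Longrightarrow> y \<le> n - 1/4 \<Longrightarrow> G x y \<ge> b * y"
    and descend: "\<bar>x - n\<bar> \<le> 1/8 \<Longrightarrow> 0 \<le> y \<Longrightarrow> y \<le> n + 1/4 \<Longrightarrow> G x y \<le> - b * y"
    and ceiling: "- 1/8 \<le> x \<Longrightarrow> x \<le> n + 1/8 \<Longrightarrow> G x (n + 1/4) < 0"
    and left_wall: "0 \<le> y \<Longrightarrow> y \<le> n + 1/4 \<Longrightarrow> A (- 1/8) y > 0"
    and cross: "- 1/8 \<le> x \<Longrightarrow> x \<le> n - 1/4 \<Longrightarrow> n - 1/4 \<le> y \<Longrightarrow> y \<le> n + 1/4 \<Longrightarrow> A x y \<ge> b"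
    and arrive: "n - 1/4 \<le> x \<Longrightarrow> x \<le> n - 1/8 \<Longrightarrow> 0 \<le> y \<Longrightarrow> y \<le> n + 1/4 \<Longrightarrow> A x y \<ge> b"
    and saddle_wall: "0 \<le> y \<Longrightarrow> y \<le> n - 1/2 \<Longrightarrow> A (1/8) y < 0"
    and sink_wall: "0 \<le> y \<Longrightarrow> y \<le> n + 1/4 \<Longrightarrow> A (n + 1/8) y < 0"
    and p: "\<bar>p\<bar> \<le> 1/8" and q: "\<bar>q - n\<bar> \<le> 1/8"
    and contract_p: "\<bar>x\<bar> \<le> 1/8 \<Longrightarrow> A x 0 * (x - p) \<le> - b * (x - p)\<^sup>2"
    and contract_q: "\<bar>x - n\<bar> \<le> 1/8 \<Longrightarrow> A x 0 * (x - q) \<le> - b * (x - q)\<^sup>2"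
begin

section \<open>Orbits of the planar field\<close>

definition sol :: "(real \<Rightarrow> real) \<Rightarrow> (real \<Rightarrow> real) \<Rightarrow> bool" where
  "sol x y \<longleftrightarrow> (\<forall>t. (x has_real_derivative A (x t) (y t)) (at t) \<and>
                   (y has_real_derivative G (x t) (y t)) (at t))"

definition field where "field z = (A (fst z) (snd z), G (fst z) (snd z))"

lemma solD:
  assumes "sol x y"
  shows "(x has_real_derivative A (x t) (y t)) (at t)" "(y has_real_derivative G (x t) (y t)) (at t)"
  using assms by (auto simp: sol_def)

lemma lipschitz_field: "(4 * L)-lipschitz_on UNIV field"
proof (rule lipschitz_onI)
  fix z w :: "real \<times> real"
  let ?d = "\<bar>fst z - fst w\<bar> + \<bar>snd z - snd w\<bar>"
  have "dist (field z) (field w) \<le> \<bar>A (fst z) (snd z) - A (fst w) (snd w)\<bar> + \<bar>G (fst z) (snd z) - G (fst w) (snd w)\<bar>"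
    by (simp add: dist_prod_def field_def dist_real_def sqrt_sum_squares_le_sum_abs)
  also have "\<dots> \<le> L * ?d + L * ?d" by (intro add_mono lipA lipG)
  also have "\<dots> = 2 * L * ?d" by simp
  also have "\<dots> \<le> 2 * L * (2 * dist z w)"
    using dist_fst_le[of z w] dist_snd_le[of z w] L
    by (intro mult_left_mono) (auto simp: dist_real_def)
  finally show "dist (field z) (field w) \<le> 4 * L * dist z w" by simp
qed (use L in simp)

lemma has_vector_derivative_pair_iff:
  fixes x y :: "real \<Rightarrow> real"
  shows "((\<lambda>t. (x t, y t)) has_vector_derivative (a, c)) (at r within X) \<longleftrightarrow>
     (x has_vector_derivative a) (at r within X) \<and> (y has_vector_derivative c) (at r within X)"
proof
  assume h: "((\<lambda>t. (x t, y t)) has_vector_derivative (a, c)) (at r within X)"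
  show "(x has_vector_derivative a) (at r within X) \<and> (y has_vector_derivative c) (at r within X)"
    using bounded_linear.has_vector_derivative[OF bounded_linear_fst h]
      bounded_linear.has_vector_derivative[OF bounded_linear_snd h] by simp
qed (auto simp: has_vector_derivative_def scaleR_prod_def intro: has_derivative_Pair)

lemma sol_iff: "sol x y \<longleftrightarrow> (\<forall>t. ((\<lambda>t. (x t, y t)) has_vector_derivative field (x t, y t)) (at t))"
  by (simp add: sol_def field_def has_vector_derivative_pair_iff has_real_derivative_iff_has_vector_derivative)

lemma sol_exists: obtains x y where "sol x y" "x 0 = a" "y 0 = c"
proof -
  obtain z where z: "z 0 = (a, c)" "\<And>t. (z has_vector_derivative field (z t)) (at t)"
    using lipschitz_global_solution[OF lipschitz_field, of "(a, c)"] by blast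
  have "sol (\<lambda>t. fst (z t)) (\<lambda>t. snd (z t))" unfolding sol_iff using z by simp
  then show ?thesis using that z(1) by simp
qed

lemma sol_shift: "sol x y \<Longrightarrow> sol (\<lambda>t. x (t + s)) (\<lambda>t. y (t + s))"
  unfolding sol_def using DERIV_shift[THEN iffD1] by blast

lemma sol_close:
  assumes "sol x y" "sol x' y'"
  shows "norm ((x t, y t) - (x' t, y' t)) \<le> exp (4 * L * \<bar>t\<bar>) * norm ((x 0, y 0) - (x' 0, y' 0))"
  using lipschitz_solutions_close[OF lipschitz_field, of "\<lambda>t. (x t, y t)" "\<lambda>t. (x' t, y' t)"] assms
  by (simp add: sol_iff)

lemma abs_G_le: "\<bar>G x y\<bar> \<le> L * \<bar>y\<bar>"
  using lipG[of x y x 0] G0 by simp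

text \<open>As G vanishes on the axis, \<open>\<bar>G x y\<bar> \<le> L * \<bar>y\<bar>\<close>, so
  \<open>y\<^sup>2\<close> decays at most exponentially in either time direction and never reaches
  0; by continuity y keeps its sign.\<close>

lemma sol_pos:
  assumes s: "sol x y" and "y 0 > 0"
  shows "y t > 0"
proof -
  have yG: "\<bar>2 * (y t * G (x t) (y t))\<bar> \<le> 2 * L * (y t)\<^sup>2" for t
  proof -
    have "\<bar>2 * (y t * G (x t) (y t))\<bar> = 2 * (\<bar>y t\<bar> * \<bar>G (x t) (y t)\<bar>)" by (simp add: abs_mult)
    also have "\<dots> \<le> 2 * (\<bar>y t\<bar> * (L * \<bar>y t\<bar>))" by (intro mult_left_mono abs_G_le) auto
    also have "\<dots> = 2 * L * \<bar>y t\<bar>\<^sup>2" by (simp only: power2_eq_square mult_ac)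
    finally show ?thesis by simp
  qed
  have d: "((\<lambda>t. (y t)\<^sup>2) has_real_derivative 2 * (y t * G (x t) (y t))) (at t)" for t
    by (auto intro!: derivative_eq_intros solD[OF s])
  have nz: "y t \<noteq> 0" for t
  proof (cases "0 \<le> t")
    case True
    have "- (y t)\<^sup>2 \<le> - (y 0)\<^sup>2 * exp (- (2 * L) * (t - 0))"
    proof (rule exp_decay_bound[OF True])
      fix t
      show "((\<lambda>t. - (y t)\<^sup>2) has_real_derivative - (2 * (y t * G (x t) (y t)))) (at t)"
        by (rule DERIV_minus[OF d])
      show "- (2 * (y t * G (x t) (y t))) \<le> - (2 * L) * - (y t)\<^sup>2" using yG[of t] by linarith
    qed
    moreover have "(y 0)\<^sup>2 * exp (- (2 * L) * (t - 0)) > 0" using assms by simp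
    ultimately show ?thesis by force
  next
    case False
    have "(y 0)\<^sup>2 \<le> (y t)\<^sup>2 * exp (- (- 2 * L) * (0 - t))"
    proof (rule exp_decay_bound[OF _ d])
      fix s show "2 * (y s * G (x s) (y s)) \<le> - (- 2 * L) * (y s)\<^sup>2" using yG[of s] by linarith
    qed (use False in simp)
    then show ?thesis using assms by force
  qed
  have cont: "continuous_on X y" for X
    by (meson solD[OF s] DERIV_isCont continuous_at_imp_continuous_on)
  show ?thesis
  proof (rule ccontr)
    assume "\<not> ?thesis"
    then obtain r where "y r = 0"
      using IVT'[of y t 0 0] IVT2'[of y t 0 0] assms(2) cont by (cases "0 \<le> t") auto
    then show False using nz by blast
  qed
qed

section \<open>The unstable orbit of the saddle\<close>

text \<open>An orbit started above the saddle at height \<open>(n - 1/2) * exp (- L * k)\<close>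
  climbs at a rate of at most L, so it needs at least time k to reach \<open>n - 1/2\<close>.
  Shifting that arrival to time 0 yields a past of length k near the saddle.\<close>

lemma orbit_through_saddle_neighbourhood:
  fixes k :: nat
  shows "\<exists>x y. sol x y \<and> y 0 = n - 1/2 \<and> (\<forall>t. - real k \<le> t \<longrightarrow> t \<le> 0 \<longrightarrow> \<bar>x t\<bar> \<le> 1/8 \<and> y t \<le> n - 1/2)"
proof -
  define c where "c = (n - 1/2) * exp (- L * k)"
  have c: "0 < c" "c \<le> n - 1/2" using n L by (auto simp: c_def mult_le_cancel_left1)
  obtain x y where s: "sol x y" and x0: "x 0 = 0" and y0: "y 0 = c" by (rule sol_exists)
  have pos: "y t > 0" for t using sol_pos[OF s] y0 c by simp
  \<comment> \<open>Only the two sides of the strip are walls. Its top is the hypothesis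
    \<open>low\<close>, because the orbit is meant to leave there.\<close>
  have strip: "\<bar>x t\<bar> \<le> 1/8" if "0 \<le> t" "t \<le> T" and low: "\<And>t. 0 \<le> t \<Longrightarrow> t < T \<Longrightarrow> y t \<le> n - 1/2" for t T
  proof -
    let ?U = "{(\<lambda>t. x t + 1/8, \<lambda>t. A (x t) (y t)), (\<lambda>t. 1/8 - x t, \<lambda>t. - A (x t) (y t))}"
    have "u t \<ge> 0" if "(u, u') \<in> ?U" for u u'
    proof (rule barrier[of ?U 0 T t u u'])
      show "(u has_real_derivative u' t) (at t)" if "(u, u') \<in> ?U" for u u' t
        using that by (auto intro!: derivative_eq_intros solD[OF s])
      show "u' t > 0"
        if "0 \<le> t" "t < T" "(u, u') \<in> ?U" "u t = 0" "\<forall>(v, v')\<in>?U. v t \<ge> 0" for u u' t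
      proof -
        have "y t \<le> n + 1/4" "y t \<le> n - 1/2" using low[of t] that by auto
        moreover have "x t = - 1/8 \<and> u' t = A (x t) (y t) \<or> x t = 1/8 \<and> u' t = - A (x t) (y t)"
          using that by auto
        ultimately show ?thesis
          using left_wall[of "y t"] saddle_wall[of "y t"] pos[of t] by (smt (verit))
      qed
    qed (use that x0 \<open>0 \<le> t\<close> \<open>t \<le> T\<close> in auto)
    from this[of "\<lambda>t. x t + 1/8" "\<lambda>t. A (x t) (y t)"] this[of "\<lambda>t. 1/8 - x t" "\<lambda>t. - A (x t) (y t)"]
    show ?thesis by auto
  qed
  have grow: "G (x t) (y t) \<ge> b * y t" if "0 \<le> t" "\<And>s. 0 \<le> s \<Longrightarrow> s \<le> t \<Longrightarrow> y s < n - 1/2" for t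
    using climb[of "x t" "y t"] strip[of t t] that pos[of t] by (auto simp: less_imp_le)
  obtain T where T: "0 \<le> T" "y T = n - 1/2" "\<And>t. 0 \<le> t \<Longrightarrow> t < T \<Longrightarrow> y t < n - 1/2"
  proof (rule first_hit[of y "\<lambda>t. G (x t) (y t)" 0 "n - 1/2" "b * c"])
    fix t assume t: "0 \<le> t" and below: "\<And>s. 0 \<le> s \<Longrightarrow> s \<le> t \<Longrightarrow> y s < n - 1/2"
    have "y 0 \<le> y t"
    proof (rule DERIV_nonneg_imp_nondecreasing[OF t], intro exI conjI)
      fix r assume "0 \<le> r" "r \<le> t"
      show "(y has_real_derivative G (x r) (y r)) (at r)" by (rule solD[OF s])
      show "0 \<le> G (x r) (y r)"
        using grow[of r] below \<open>0 \<le> r\<close> \<open>r \<le> t\<close> pos[of r] b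
        by (smt (verit) mult_pos_pos)
    qed
    then have "b * c \<le> b * y t" using y0 b by simp
    also have "\<dots> \<le> G (x t) (y t)" by (rule grow[OF t below])
    finally show "b * c \<le> G (x t) (y t)" .
  qed (use b c y0 solD[OF s] in auto)
  have "y T \<le> y 0 * exp (- (- L) * (T - 0))"
  proof (rule exp_decay_bound[OF T(1) solD(2)[OF s]])
    fix t show "G (x t) (y t) \<le> - (- L) * y t" using abs_G_le[of "x t" "y t"] pos[of t] by simp
  qed
  then have "n - 1/2 \<le> (n - 1/2) * (exp (- L * k) * exp (L * T))" using T y0 by (simp add: c_def)
  moreover have "exp (- L * k) * exp (L * T) = exp (L * T - L * k)" by (simp add: exp_diff exp_minus field_simps)
  ultimately have "1 \<le> exp (L * T - L * k)"
    using mult_le_cancel_left_pos[of "n - 1/2" 1 "exp (L * T - L * k)"] n by simp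
  then have kT: "real k \<le> T" using L by simp
  have "\<bar>x (t + T)\<bar> \<le> 1/8 \<and> y (t + T) \<le> n - 1/2" if "- real k \<le> t" "t \<le> 0" for t
    using strip[of "t + T" T] T that kT by (cases "t = 0") (auto simp: less_imp_le)
  then show ?thesis
    using sol_shift[OF s, of T] T(2) by (intro exI[of _ "\<lambda>t. x (t + T)"] exI[of _ "\<lambda>t. y (t + T)"]) simp
qed

text \<open>The orbits with pasts of length k all pass height \<open>n - 1/2\<close> at time 0, at
  abscissas in a compact interval. The orbit through a limit point of these inherits the bounds at
  each fixed past time by continuous dependence, hence for the whole past.\<close>

lemma unstable_orbit:
  "\<exists>x y. sol x y \<and> y 0 = n - 1/2 \<and> (\<forall>t\<le>0. \<bar>x t\<bar> \<le> 1/8 \<and> y t \<le> n - 1/2)"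
proof -
  define P where "P k x y \<longleftrightarrow> sol x y \<and> y 0 = n - 1/2 \<and>
      (\<forall>t. - real k \<le> t \<longrightarrow> t \<le> 0 \<longrightarrow> \<bar>x t\<bar> \<le> 1/8 \<and> y t \<le> n - 1/2)" for k x y
  have "\<exists>x y. P k x y" for k unfolding P_def by (rule orbit_through_saddle_neighbourhood)
  then obtain X Y where P: "\<And>k. P k (X k) (Y k)" by metis
  have XY: "sol (X k) (Y k)" "Y k 0 = n - 1/2"
      "- real k \<le> t \<Longrightarrow> t \<le> 0 \<Longrightarrow> \<bar>X k t\<bar> \<le> 1/8 \<and> Y k t \<le> n - 1/2" for k t
    using P[of k] unfolding P_def by simp_all
  have "X k 0 \<in> {- 1/8..1/8}" for k 
  proof -
    have "\<bar>X k 0\<bar> \<le> 1/8" using XY(3)[of k 0] by simp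
    then show ?thesis by (simp only: atLeastAtMost_iff) linarith
  qed
  then obtain a r where r: "strict_mono r" "((\<lambda>k. X k 0) \<circ> r) \<longlonglongrightarrow> a"
    using seq_compactE[OF compact_imp_seq_compact[OF compact_Icc], of "\<lambda>k. X k 0" "- 1/8" "1/8"] by blast
  then have lim_a: "(\<lambda>k. X (r k) 0) \<longlonglongrightarrow> a" by (simp add: o_def)
  obtain x y where s: "sol x y" and x0: "x 0 = a" and y0: "y 0 = n - 1/2" by (rule sol_exists)
  have "\<bar>x t\<bar> \<le> 1/8 \<and> y t \<le> n - 1/2" if "t \<le> 0" for t
  proof -
    have "(\<lambda>k. (X (r k) t, Y (r k) t)) \<longlonglongrightarrow> (x t, y t)"
    proof (rule LIM_zero_cancel, rule tendsto_norm_zero_cancel, rule tendsto_sandwich[OF _ _ tendsto_const])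
      show "\<forall>\<^sub>F k in sequentially. norm ((X (r k) t, Y (r k) t) - (x t, y t))
           \<le> exp (4 * L * \<bar>t\<bar>) * \<bar>X (r k) 0 - a\<bar>"
        using sol_close[OF XY(1) s, of _ t] XY(2) x0 y0 by (auto simp: norm_Pair)
      have "(\<lambda>k. \<bar>X (r k) 0 - a\<bar>) \<longlonglongrightarrow> 0" using lim_a by (simp add: LIM_zero tendsto_rabs_zero)
      then show "(\<lambda>k. exp (4 * L * \<bar>t\<bar>) * \<bar>X (r k) 0 - a\<bar>) \<longlonglongrightarrow> 0" by (rule tendsto_mult_right_zero)
    qed auto
    then have lim: "(\<lambda>k. \<bar>X (r k) t\<bar>) \<longlonglongrightarrow> \<bar>x t\<bar>" "(\<lambda>k. Y (r k) t) \<longlonglongrightarrow> y t"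
      using tendsto_fst tendsto_snd tendsto_rabs by fastforce+
    obtain m :: nat where "- t \<le> real m" using real_arch_simple by blast
    then have "- real (r k) \<le> t" if "k \<ge> m" for k
      using that seq_suble[OF r(1), of k] by (smt (verit) of_nat_le_iff order_trans)
    then have ev: "eventually (\<lambda>k. \<bar>X (r k) t\<bar> \<le> 1/8 \<and> Y (r k) t \<le> n - 1/2) sequentially"
      unfolding eventually_sequentially using XY(3) that by blast
    show ?thesis
      using tendsto_upperbound[OF lim(1), of "1/8"] tendsto_upperbound[OF lim(2), of "n - 1/2"]
        eventually_conj_iff ev by fastforce
  qed
  then show ?thesis using s y0 by blast
qed

section \<open>Crossing and capture\<close>

text \<open>The box over the crossing has inward walls on the left, below and above, so the orbit
  can leave it only through \<open>x = n - 1/4\<close>. The fact \<open>box\<close> assumes that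
  this side has not been passed yet.\<close>

lemma escape_saddle:
  assumes s: "sol x y" and y0: "y 0 = n - 1/2" and x0: "\<bar>x 0\<bar> \<le> 1/8"
  obtains T where "0 \<le> T" "x T = n - 1/4"
    "\<And>t. 0 \<le> t \<Longrightarrow> t \<le> T \<Longrightarrow> - 1/8 \<le> x t \<and> x t \<le> n - 1/4 \<and> n - 1/2 \<le> y t \<and> y t \<le> n + 1/4"
proof -
  note [derivative_intros] = solD[OF s]
  have cont: "continuous_on X x" for X
    by (meson solD[OF s] DERIV_isCont continuous_at_imp_continuous_on)
  have x0': "x 0 < n - 1/4" using x0 n by simp
  have box: "- 1/8 \<le> x t \<and> n - 1/2 \<le> y t \<and> y t \<le> n + 1/4"
    if t: "0 \<le> t" "t \<le> T" and left: "\<And>t. 0 \<le> t \<Longrightarrow> t < T \<Longrightarrow> x t \<le> n - 1/4" for t T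
  proof -
    let ?U = "{(\<lambda>t. x t + 1/8, \<lambda>t. A (x t) (y t)), (\<lambda>t. y t - (n - 1/2), \<lambda>t. G (x t) (y t)),
               (\<lambda>t. n + 1/4 - y t, \<lambda>t. - G (x t) (y t))}"
    have "u t \<ge> 0" if "(u, u') \<in> ?U" for u u'
    proof (rule barrier[of ?U 0 T t u u'])
      show "(u has_real_derivative u' t) (at t)" if "(u, u') \<in> ?U" for u u' t
        using that by (auto intro!: derivative_eq_intros)
      show "u' t > 0"
        if "0 \<le> t" "t < T" "(u, u') \<in> ?U" "u t = 0" "\<forall>(v, v')\<in>?U. v t \<ge> 0" for u u' t
      proof -
        have "x t \<le> n - 1/4" "- 1/8 \<le> x t" "n - 1/2 \<le> y t" "y t \<le> n + 1/4"
          using left[of t] that by auto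
        moreover have "x t = - 1/8 \<and> u' t = A (x t) (y t) \<or> y t = n - 1/2 \<and> u' t = G (x t) (y t)
            \<or> y t = n + 1/4 \<and> u' t = - G (x t) (y t)"
          using that(3,4) by auto
        ultimately show ?thesis
        proof (elim disjE conjE)
          assume "y t = n - 1/2" "u' t = G (x t) (y t)"
          moreover have "b * y t > 0" using b n \<open>y t = n - 1/2\<close> by simp
          ultimately show ?thesis
            using floor[of "x t" "y t"] \<open>- 1/8 \<le> x t\<close> \<open>x t \<le> n - 1/4\<close> by linarith
        next
          assume "x t = - 1/8" "u' t = A (x t) (y t)"
          then show ?thesis using left_wall[of "y t"] \<open>n - 1/2 \<le> y t\<close> \<open>y t \<le> n + 1/4\<close> n by force
        next
          assume "y t = n + 1/4" "u' t = - G (x t) (y t)"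
          then show ?thesis using ceiling[of "x t"] \<open>- 1/8 \<le> x t\<close> \<open>x t \<le> n - 1/4\<close> by force
        qed
      qed
    qed (use that t x0 y0 in auto)
    from this[of "\<lambda>t. x t + 1/8" "\<lambda>t. A (x t) (y t)"] this[of "\<lambda>t. y t - (n - 1/2)" "\<lambda>t. G (x t) (y t)"]
      this[of "\<lambda>t. n + 1/4 - y t" "\<lambda>t. - G (x t) (y t)"]
    show ?thesis by auto
  qed
  \<comment> \<open>An orbit that never left would rise from the floor to \<open>n - 1/4\<close>,
    remain above that height, and there move to the right with speed at least b, a
    contradiction.\<close>
  have "\<exists>t\<ge>0. x t \<ge> n - 1/4"
  proof (rule ccontr)
    assume "\<not> ?thesis"
    then have left: "x t < n - 1/4" if "0 \<le> t" for t using that by force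
    then have box': "- 1/8 \<le> x t \<and> n - 1/2 \<le> y t \<and> y t \<le> n + 1/4" if "0 \<le> t" for t
      using box[of t t] that by (simp add: less_imp_le)
    obtain T where T: "0 \<le> T" "y T = n - 1/4"
    proof (rule first_hit[of y "\<lambda>t. G (x t) (y t)" 0 "n - 1/4" "b * (n - 1/2)"])
      fix t assume t: "0 \<le> t" and "\<And>s. 0 \<le> s \<Longrightarrow> s \<le> t \<Longrightarrow> y s < n - 1/4"
      then have "y t < n - 1/4" by simp
      then have "b * y t \<le> G (x t) (y t)" using floor[of "x t" "y t"] box'[OF t] left[OF t] by simp
      moreover have "b * (n - 1/2) \<le> b * y t" using box'[OF t] b by simp
      ultimately show "b * (n - 1/2) \<le> G (x t) (y t)" by simp
    qed (use b n y0 solD[OF s] in auto)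
    have high: "n - 1/4 \<le> y t" if "T \<le> t" for t
    proof -
      let ?U = "{(\<lambda>t. y t - (n - 1/4), \<lambda>t. G (x t) (y t))}"
      have "y t - (n - 1/4) \<ge> 0"
      proof (rule barrier[of ?U T t t "\<lambda>t. y t - (n - 1/4)" "\<lambda>t. G (x t) (y t)"])
        show "(u has_real_derivative u' t) (at t)" if "(u, u') \<in> ?U" for u u' t
          using that by (auto intro!: derivative_eq_intros)
        show "u' r > 0" if "T \<le> r" "r < t" "(u, u') \<in> ?U" "u r = 0" "\<forall>(v, v')\<in>?U. v r \<ge> 0" for u u' r
        proof -
          have "y r = n - 1/4" "u' r = G (x r) (y r)" "0 \<le> r" using that T by auto
          moreover have "b * (n - 1/4) > 0" using b n by simp
          ultimately show ?thesis using floor[of "x r" "y r"] box'[of r] left[of r] by simp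
        qed
      qed (use that T in auto)
      then show ?thesis by simp
    qed
    obtain T' where "T \<le> T'" "x T' = n - 1/4"
    proof (rule first_hit[of x "\<lambda>t. A (x t) (y t)" T "n - 1/4" b])
      fix t assume "T \<le> t"
      then show "b \<le> A (x t) (y t)" using cross[of "x t" "y t"] box'[of t] left[of t] high[of t] T by simp
    qed (use b left[of T] T solD[OF s] in auto)
    then show False using left[of T'] T by simp
  qed
  then obtain t1 where t1: "0 \<le> t1" "n - 1/4 \<le> x t1" by blast
  obtain T where T: "0 \<le> T" "x T = n - 1/4" "\<And>t. 0 \<le> t \<Longrightarrow> t < T \<Longrightarrow> x t < n - 1/4"
    using first_hit_IVT[of x 0 "n - 1/4" t1] cont x0' t1 by auto
  show ?thesis
  proof (rule that[OF T(1,2)])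
    fix t assume "0 \<le> t" "t \<le> T"
    then show "- 1/8 \<le> x t \<and> x t \<le> n - 1/4 \<and> n - 1/2 \<le> y t \<and> y t \<le> n + 1/4"
      using box[of t T] T by (cases "t = T") (auto simp: less_imp_le)
  qed
qed

text \<open>The box around the column over the sink has inward walls on three sides, and positivity
  of y closes the fourth. Inside it x increases up to \<open>n - 1/8\<close>, a line which then
  serves as a new left wall.\<close>

lemma capture_by_sink:
  assumes s: "sol x y" and pos: "\<And>t. y t > 0" and xT: "x T = n - 1/4" and yT: "y T \<le> n + 1/4"
  shows "\<And>t. T \<le> t \<Longrightarrow> n - 1/4 \<le> x t \<and> x t \<le> n + 1/8 \<and> y t \<le> n + 1/4"
    and "\<exists>T'\<ge>T. \<forall>t\<ge>T'. \<bar>x t - n\<bar> \<le> 1/8"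
proof -
  note [derivative_intros] = solD[OF s]
  show box: "n - 1/4 \<le> x t \<and> x t \<le> n + 1/8 \<and> y t \<le> n + 1/4" if "T \<le> t" for t
  proof -
    let ?U = "{(\<lambda>t. x t - (n - 1/4), \<lambda>t. A (x t) (y t)), (\<lambda>t. n + 1/8 - x t, \<lambda>t. - A (x t) (y t)),
               (\<lambda>t. n + 1/4 - y t, \<lambda>t. - G (x t) (y t))}"
    have "u t \<ge> 0" if "(u, u') \<in> ?U" for u u'
    proof (rule barrier[of ?U T t t u u'])
      show "(u has_real_derivative u' t) (at t)" if "(u, u') \<in> ?U" for u u' t
        using that by (auto intro!: derivative_eq_intros)
      show "u' t > 0"
        if "(u, u') \<in> ?U" "u t = 0" "\<forall>(v, v')\<in>?U. v t \<ge> 0" for u u' t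
      proof -
        have "n - 1/4 \<le> x t" "x t \<le> n + 1/8" "y t \<le> n + 1/4" "- 1/8 \<le> x t"
          using that n by auto
        moreover have "x t = n - 1/4 \<and> u' t = A (x t) (y t) \<or> x t = n + 1/8 \<and> u' t = - A (x t) (y t)
            \<or> y t = n + 1/4 \<and> u' t = - G (x t) (y t)"
          using that(1,2) by auto
        ultimately show ?thesis
        proof (elim disjE conjE)
          assume "x t = n - 1/4" "u' t = A (x t) (y t)"
          then show ?thesis using arrive[of "x t" "y t"] b \<open>y t \<le> n + 1/4\<close> pos[of t] by linarith
        next
          assume "x t = n + 1/8" "u' t = - A (x t) (y t)"
          then show ?thesis using sink_wall[of "y t"] \<open>y t \<le> n + 1/4\<close> pos[of t] by force
        next
          assume "y t = n + 1/4" "u' t = - G (x t) (y t)"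
          then show ?thesis using ceiling[of "x t"] \<open>- 1/8 \<le> x t\<close> \<open>x t \<le> n + 1/8\<close> by force
        qed
      qed
    qed (use that \<open>T \<le> t\<close> xT yT in auto)
    from this[of "\<lambda>t. x t - (n - 1/4)" "\<lambda>t. A (x t) (y t)"] this[of "\<lambda>t. n + 1/8 - x t" "\<lambda>t. - A (x t) (y t)"]
      this[of "\<lambda>t. n + 1/4 - y t" "\<lambda>t. - G (x t) (y t)"]
    show ?thesis by auto
  qed
  obtain T' where T': "T \<le> T'" "x T' = n - 1/8"
  proof (rule first_hit[of x "\<lambda>t. A (x t) (y t)" T "n - 1/8" b])
    fix t assume t: "T \<le> t" and "\<And>s. T \<le> s \<Longrightarrow> s \<le> t \<Longrightarrow> x s < n - 1/8"
    then have "x t < n - 1/8" by simp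
    then show "b \<le> A (x t) (y t)" using arrive[of "x t" "y t"] box[OF t] pos[of t] by simp
  qed (use b xT solD[OF s] in auto)
  have "\<bar>x t - n\<bar> \<le> 1/8" if "T' \<le> t" for t
  proof -
    let ?U = "{(\<lambda>t. x t - (n - 1/8), \<lambda>t. A (x t) (y t))}"
    have "x t - (n - 1/8) \<ge> 0"
    proof (rule barrier[of ?U T' t t "\<lambda>t. x t - (n - 1/8)" "\<lambda>t. A (x t) (y t)"])
      show "(u has_real_derivative u' t) (at t)" if "(u, u') \<in> ?U" for u u' t
        using that by (auto intro!: derivative_eq_intros)
      show "u' r > 0" if "T' \<le> r" "r < t" "(u, u') \<in> ?U" "u r = 0" "\<forall>(v, v')\<in>?U. v r \<ge> 0" for u u' r
        using arrive[of "x r" "y r"] box[of r] pos[of r] that T' b by auto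
    qed (use that T' in auto)
    then show ?thesis using box[of t] that T' by linarith
  qed
  then show "\<exists>T'\<ge>T. \<forall>t\<ge>T'. \<bar>x t - n\<bar> \<le> 1/8" using T' by blast
qed

section \<open>Convergence at both ends\<close>

text \<open>Contraction towards r on the axis survives at height y up to the error
  \<open>L * y\<close>. The functions S in the two convergence proofs contain a multiple of y in
  order to absorb this error.\<close>

lemma contract_estimate:
  assumes "A x 0 * (x - r) \<le> - b * (x - r)\<^sup>2" and "\<bar>x - r\<bar> \<le> 1/2" and "y \<ge> 0"
  shows "2 * (x - r) * A x y \<le> - 2 * b * (x - r)\<^sup>2 + L * y"
proof -
  have "(x - r) * (A x y - A x 0) \<le> \<bar>x - r\<bar> * \<bar>A x y - A x 0\<bar>"
    by (metis abs_ge_self abs_mult)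
  also have "\<dots> \<le> (1/2) * (L * y)"
    using lipA[of x y x 0] assms(2,3) L by (intro mult_mono) auto
  finally show ?thesis using assms(1) by (simp add: algebra_simps)
qed

lemma tendsto_of_square_le:
  fixes x :: "real \<Rightarrow> real" and r :: real
  assumes "eventually (\<lambda>t. (x t - r)\<^sup>2 \<le> e t) F" and "(e \<longlongrightarrow> 0) F"
  shows "(x \<longlongrightarrow> r) F"
proof -
  have "((\<lambda>t. (x t - r)\<^sup>2) \<longlongrightarrow> 0) F"
    by (rule tendsto_sandwich[OF _ assms(1) tendsto_const assms(2)]) auto
  then have "((\<lambda>t. sqrt ((x t - r)\<^sup>2)) \<longlongrightarrow> sqrt 0) F" by (rule tendsto_real_sqrt)
  then have "((\<lambda>t. \<bar>x t - r\<bar>) \<longlongrightarrow> 0) F" by simp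
  then show ?thesis using LIM_zero_cancel tendsto_rabs_zero_iff by blast
qed

lemma converge_to_sink:
  assumes s: "sol x y" and pos: "\<And>t. y t > 0"
    and near: "\<And>t. T \<le> t \<Longrightarrow> \<bar>x t - n\<bar> \<le> 1/8 \<and> y t \<le> n + 1/4"
  shows "(x \<longlongrightarrow> q) at_top" "(y \<longlongrightarrow> 0) at_top"
proof -
  note [derivative_intros] = solD[OF s]
  \<comment> \<open>With this K the decay of \<open>K * y\<close> contributes
    \<open>- L * y - b * y\<close>: the first term cancels the error of
    \<open>contract_estimate\<close>, the second leaves S decaying at rate
    \<open>b / K\<close>.\<close>
  define K where "K = L / b + 1"
  have K: "K \<ge> 1" using L b by (simp add: K_def)
  define S where "S t = (x t - q)\<^sup>2 + K * y t" for t
  have S_le: "S t \<le> S T * exp (- (b / K) * (t - T))" if "T \<le> t" for t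
  proof (rule exp_decay_bound[OF that])
    fix t assume "T \<le> t"
    show "(S has_real_derivative 2 * (x t - q) * A (x t) (y t) + K * G (x t) (y t)) (at t)"
      unfolding S_def[abs_def] by (auto intro!: derivative_eq_intros)
    have "\<bar>x t - q\<bar> \<le> 1/2" using near[OF \<open>T \<le> t\<close>] q by linarith
    from contract_estimate[OF contract_q this] near[OF \<open>T \<le> t\<close>] pos[of t]
    have "2 * (x t - q) * A (x t) (y t) \<le> - 2 * b * (x t - q)\<^sup>2 + L * y t" by simp
    moreover have "K * G (x t) (y t) \<le> K * (- b * y t)"
      using descend[of "x t" "y t"] near[OF \<open>T \<le> t\<close>] pos[of t] K by (intro mult_left_mono) auto
    moreover have "K * (- b * y t) = - L * y t - b * y t" using b by (simp add: K_def field_simps)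
    moreover have "(b / K) * (x t - q)\<^sup>2 \<le> 2 * b * (x t - q)\<^sup>2"
      using K b by (intro mult_right_mono) (auto simp: field_simps)
    moreover have "(b / K) * S t = (b / K) * (x t - q)\<^sup>2 + b * y t" using K by (simp add: S_def distrib_left)
    ultimately show "2 * (x t - q) * A (x t) (y t) + K * G (x t) (y t) \<le> - (b / K) * S t" by simp
  qed
  have lim: "((\<lambda>t. S T * exp (- (b / K) * (t - T))) \<longlongrightarrow> 0) at_top"
  proof -
    have "b / K > 0" using b K by simp
    moreover have "filterlim (\<lambda>t. - T + t) at_top at_top"
      by (rule filterlim_tendsto_add_at_top[OF tendsto_const filterlim_ident])
    ultimately have "filterlim (\<lambda>t. - (b / K) * (t - T)) at_bot at_top"
      by (intro filterlim_tendsto_neg_mult_at_bot[OF tendsto_const]) auto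
    then show ?thesis
      by (intro tendsto_mult_right_zero filterlim_compose[OF exp_at_bot])
  qed
  have "eventually (\<lambda>t. (x t - q)\<^sup>2 \<le> S T * exp (- (b / K) * (t - T))) at_top"
    using eventually_ge_at_top[of T]
  proof eventually_elim
    case (elim t)
    have "K * y t \<ge> 0" using K pos[of t] by (intro mult_nonneg_nonneg) auto
    then have "(x t - q)\<^sup>2 \<le> S t" by (simp add: S_def)
    then show ?case using S_le[OF elim] by simp
  qed
  then show "(x \<longlongrightarrow> q) at_top" by (rule tendsto_of_square_le[OF _ lim])
  have "eventually (\<lambda>t. y t \<le> S T * exp (- (b / K) * (t - T))) at_top"
    using eventually_ge_at_top[of T]
  proof eventually_elim
    case (elim t)
    have "y t \<le> K * y t" using K pos[of t] by simp
    also have "\<dots> \<le> S t" by (simp add: S_def)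
    finally show ?case using S_le[OF elim] by simp
  qed
  then show "(y \<longlongrightarrow> 0) at_top"
    using pos by (intro tendsto_sandwich[OF _ _ tendsto_const lim]) (auto simp: less_imp_le)
qed

text \<open>Backwards in time y decays, but the x-direction expands, so an orbit with bounded past
  must lie close to the unstable direction. Precisely, \<open>S = (x - p)\<^sup>2 - K * y\<close>
  satisfies \<open>S' \<le> - 2 * b * S\<close> and is bounded above; comparing with ever earlier
  times forces \<open>S \<le> 0\<close>, that is \<open>(x - p)\<^sup>2 \<le> K * y\<close>, and y
  tends to 0.\<close>

lemma converge_to_saddle:
  assumes s: "sol x y" and pos: "\<And>t. y t > 0"
    and near: "\<And>t. t \<le> 0 \<Longrightarrow> \<bar>x t\<bar> \<le> 1/8 \<and> y t \<le> n - 1/2"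
  shows "(x \<longlongrightarrow> p) at_bot" "(y \<longlongrightarrow> 0) at_bot"
proof -
  note [derivative_intros] = solD[OF s]
  have bot: "filterlim (\<lambda>t::real. c * t) at_bot at_bot" if "c > 0" for c
    using that by (intro filterlim_tendsto_pos_mult_at_bot[OF tendsto_const _ filterlim_ident])
  have y_le: "y t \<le> y 0 * exp (b * t)" if "t \<le> 0" for t
  proof -
    have "- y 0 \<le> - y t * exp (- (- b) * (0 - t))"
    proof (rule exp_decay_bound[OF that])
      fix r :: real assume "r \<le> 0"
      show "((\<lambda>t. - y t) has_real_derivative - G (x r) (y r)) (at r)"
        by (auto intro!: derivative_eq_intros)
      show "- G (x r) (y r) \<le> - (- b) * - y r"
        using climb[of "x r" "y r"] near[OF \<open>r \<le> 0\<close>] pos[of r] by simp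
    qed
    then show ?thesis by (simp add: exp_minus field_simps)
  qed
  have ylim: "((\<lambda>t. y 0 * exp (b * t)) \<longlongrightarrow> 0) at_bot"
    by (intro tendsto_mult_right_zero filterlim_compose[OF exp_at_bot] bot b)
  have "eventually (\<lambda>t. y t \<le> y 0 * exp (b * t)) at_bot"
    using eventually_le_at_bot[of 0] by (rule eventually_mono) (rule y_le)
  then show lim0: "(y \<longlongrightarrow> 0) at_bot"
    using pos by (intro tendsto_sandwich[OF _ _ tendsto_const ylim]) (auto simp: less_imp_le)
  define K where "K = L / b + 1"
  have K: "K \<ge> 1" using L b by (simp add: K_def)
  define S where "S t = (x t - p)\<^sup>2 - K * y t" for t
  have small: "\<bar>x t - p\<bar> \<le> 1/2" if "t \<le> 0" for t using near[OF that] p by linarith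
  have S_le: "S r \<le> exp (- (2 * b) * r) * exp (2 * b * t)" if "t \<le> r" "r \<le> 0" for t r
  proof -
    have "S r \<le> S t * exp (- (2 * b) * (r - t))"
    proof (rule exp_decay_bound[OF that(1)])
      fix t assume "t \<le> r"
      then have t: "t \<le> 0" using that by simp
      show "(S has_real_derivative 2 * (x t - p) * A (x t) (y t) - K * G (x t) (y t)) (at t)"
        unfolding S_def[abs_def] by (auto intro!: derivative_eq_intros)
      from contract_estimate[OF contract_p small[OF t]] near[OF t] pos[of t]
      have "2 * (x t - p) * A (x t) (y t) \<le> - 2 * b * (x t - p)\<^sup>2 + L * y t" by simp
      moreover have "K * G (x t) (y t) \<ge> K * (b * y t)"
        using climb[of "x t" "y t"] near[OF t] pos[of t] K by (intro mult_left_mono) auto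
      moreover have "K * (b * y t) = L * y t + b * y t" using b by (simp add: K_def field_simps)
      moreover have "b * y t \<ge> 0" "2 * b * (K * y t) \<ge> 0" using b K pos[of t] by simp_all
      moreover have "- (2 * b) * S t = - 2 * b * (x t - p)\<^sup>2 + 2 * b * (K * y t)" by (simp add: S_def algebra_simps)
      ultimately show "2 * (x t - p) * A (x t) (y t) - K * G (x t) (y t) \<le> - (2 * b) * S t" by linarith
    qed
    also have "\<dots> \<le> 1 * exp (- (2 * b) * (r - t))"
    proof (rule mult_right_mono)
      have "(x t - p)\<^sup>2 \<le> 1"
        using small[of t] that power_le_one[of "\<bar>x t - p\<bar>" 2] by simp
      moreover have "K * y t \<ge> 0" using K pos[of t] by (intro mult_nonneg_nonneg) auto
      ultimately show "S t \<le> 1" unfolding S_def by linarith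
    qed simp
    finally show ?thesis by (simp add: algebra_simps flip: exp_add)
  qed
  have "S r \<le> 0" if "r \<le> 0" for r
  proof (rule tendsto_lowerbound)
    show "((\<lambda>t. exp (- (2 * b) * r) * exp (2 * b * t)) \<longlongrightarrow> 0) at_bot"
      using b by (intro tendsto_mult_right_zero filterlim_compose[OF exp_at_bot] bot) simp
    show "\<forall>\<^sub>F t in at_bot. S r \<le> exp (- (2 * b) * r) * exp (2 * b * t)"
      using eventually_le_at_bot[of r] by (rule eventually_mono) (rule S_le[OF _ that])
  qed simp
  then have "(x t - p)\<^sup>2 \<le> K * y t" if "t \<le> 0" for t using that by (simp add: S_def)
  then have "eventually (\<lambda>t. (x t - p)\<^sup>2 \<le> K * y t) at_bot"
    using eventually_le_at_bot[of 0] by (rule eventually_mono[rotated])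
  then show "(x \<longlongrightarrow> p) at_bot"
    by (rule tendsto_of_square_le) (rule tendsto_mult_right_zero[OF lim0])
qed

text \<open>The low parts of the orbit lie near the two equilibria because the crossing takes place
  above height \<open>n - 1/2 \<ge> 1/2\<close>. This is recorded in order to tell the connections
  of different edges apart.\<close>

lemma connection:
  obtains x y where "sol x y"
    "\<And>t. - 1/8 \<le> x t \<and> x t \<le> n + 1/8 \<and> 0 < y t \<and> y t \<le> n + 1/4"
    "\<And>t. y t < 1/2 \<Longrightarrow> \<bar>x t\<bar> \<le> 1/8 \<or> n - 1/4 \<le> x t"
    "(x \<longlongrightarrow> p) at_bot" "(y \<longlongrightarrow> 0) at_bot" "(x \<longlongrightarrow> q) at_top" "(y \<longlongrightarrow> 0) at_top"
proof -
  obtain x y where s: "sol x y" and y0: "y 0 = n - 1/2"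
    and past: "\<And>t. t \<le> 0 \<Longrightarrow> \<bar>x t\<bar> \<le> 1/8 \<and> y t \<le> n - 1/2"
    using unstable_orbit by blast
  have pos: "y t > 0" for t using sol_pos[OF s] y0 n by simp
  obtain T where T: "0 \<le> T" "x T = n - 1/4"
    "\<And>t. 0 \<le> t \<Longrightarrow> t \<le> T \<Longrightarrow> - 1/8 \<le> x t \<and> x t \<le> n - 1/4 \<and> n - 1/2 \<le> y t \<and> y t \<le> n + 1/4"
    using escape_saddle[OF s y0] past by blast
  have yT: "y T \<le> n + 1/4" using T by simp
  note future = capture_by_sink[OF s pos T(2) yT]
  obtain T' where T': "T \<le> T'" "\<And>t. T' \<le> t \<Longrightarrow> \<bar>x t - n\<bar> \<le> 1/8" using future(2) by blast
  have near: "\<bar>x t - n\<bar> \<le> 1/8 \<and> y t \<le> n + 1/4" if "T' \<le> t" for t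
    using T' future(1)[of t] that by auto
  show ?thesis
  proof (rule that[OF s _ _ converge_to_saddle[OF s pos past] converge_to_sink[OF s pos near]])
    fix t
    consider "t \<le> 0" | "0 \<le> t" "t \<le> T" | "T \<le> t" by linarith
    then have "- 1/8 \<le> x t \<and> x t \<le> n + 1/8 \<and> y t \<le> n + 1/4 \<and> (y t < 1/2 \<longrightarrow> \<bar>x t\<bar> \<le> 1/8 \<or> n - 1/4 \<le> x t)"
    proof cases
      case 1 then show ?thesis using past[of t] n by (auto simp: abs_le_iff)
    next
      case 2 then show ?thesis using T(3)[of t] n by auto
    next
      case 3 then show ?thesis using future(1)[of t] n by auto
    qed
    then show "- 1/8 \<le> x t \<and> x t \<le> n + 1/8 \<and> 0 < y t \<and> y t \<le> n + 1/4"
      and "y t < 1/2 \<Longrightarrow> \<bar>x t\<bar> \<le> 1/8 \<or> n - 1/4 \<le> x t" using pos by auto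
  qed auto
qed

end

section \<open>Combinatorics of book embeddings\<close>

text \<open>The map (U, W) sends both paths into a rectangle with the four end points interlaced on
  its bottom side, so the images meet by \<open>fashoda_interlace\<close>. Only coordinates are
  compared; on a page they will determine the point.\<close>

lemma half_plane_paths_meet:
  fixes f g :: "real \<Rightarrow> 'a::metric_space" and U W :: "'a \<Rightarrow> real"
  assumes f: "path f" and g: "path g"
    and U: "continuous_on UNIV U" and W: "continuous_on UNIV W"
    and Wf: "\<And>z. z \<in> path_image f \<Longrightarrow> W z \<ge> 0" and Wg: "\<And>z. z \<in> path_image g \<Longrightarrow> W z \<ge> 0"
    and ends: "W (pathstart f) = 0" "W (pathfinish f) = 0" "W (pathstart g) = 0" "W (pathfinish g) = 0"
    and interlaced: "U (pathstart f) < U (pathstart g)" "U (pathstart g) < U (pathfinish f)"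
      "U (pathfinish f) < U (pathfinish g)"
  obtains z z' where "z \<in> path_image f" "z' \<in> path_image g" "U z = U z'" "W z = W z'"
proof -
  define \<Phi> where "\<Phi> z = ((\<chi> i. if i = 1 then U z else W z) :: real^2)" for z
  have \<Phi>: "\<Phi> z $ 1 = U z" "\<Phi> z $ 2 = W z" for z by (simp_all add: \<Phi>_def)
  have cont: "continuous_on X \<Phi>" for X
    unfolding \<Phi>_def 
  proof (intro continuous_on_vec_lambda)
    show "continuous_on X (\<lambda>z. if i = 1 then U z else W z)" for i :: 2
      by (cases "i = 1") (use U W in \<open>auto intro: continuous_on_subset\<close>)
  qed
  have paths: "path (\<Phi> \<circ> f)" "path (\<Phi> \<circ> g)"
    using f g by (auto intro!: path_continuous_image cont)
  have "compact (U ` (path_image f \<union> path_image g))" "compact (W ` (path_image f \<union> path_image g))"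
    using f g U W by (auto intro!: compact_continuous_image compact_Un compact_path_image intro: continuous_on_subset)
  then obtain M N where M: "\<And>z. z \<in> path_image f \<union> path_image g \<Longrightarrow> \<bar>U z\<bar> \<le> M"
    and N: "\<And>z. z \<in> path_image f \<union> path_image g \<Longrightarrow> \<bar>W z\<bar> \<le> N"
    unfolding compact_eq_bounded_closed bounded_iff by (metis imageI real_norm_def)
  define a b where "a = (vector [- M, 0] :: real^2)" and "b = (vector [M, N] :: real^2)"
  have box: "path_image (\<Phi> \<circ> f) \<subseteq> cbox a b" "path_image (\<Phi> \<circ> g) \<subseteq> cbox a b"
    using M N Wf Wg
    by (auto simp: path_image_compose mem_box_cart forall_2 \<Phi> a_def b_def abs_le_iff) (fastforce simp: abs_le_iff)+
  obtain y where y: "y \<in> path_image (\<Phi> \<circ> f)" "y \<in> path_image (\<Phi> \<circ> g)"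
    by (rule fashoda_interlace[OF paths box])
       (use ends interlaced in \<open>simp_all add: pathstart_compose pathfinish_compose \<Phi> a_def\<close>)
  then obtain z z' where "z \<in> path_image f" "z' \<in> path_image g" "y = \<Phi> z" "y = \<Phi> z'"
    by (auto simp: path_image_compose)
  then show ?thesis using that \<Phi> by metis
qed

lemma half_plane_paths_meet_unoriented:
  fixes f g :: "real \<Rightarrow> 'a::metric_space" and U W :: "'a \<Rightarrow> real"
  assumes f: "path f" and g: "path g"
    and U: "continuous_on UNIV U" and W: "continuous_on UNIV W"
    and Wf: "\<And>z. z \<in> path_image f \<Longrightarrow> W z \<ge> 0" and Wg: "\<And>z. z \<in> path_image g \<Longrightarrow> W z \<ge> 0"
    and ends: "W (pathstart f) = 0" "W (pathfinish f) = 0" "W (pathstart g) = 0" "W (pathfinish g) = 0"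
    and interlaced: "min (U (pathstart f)) (U (pathfinish f)) < min (U (pathstart g)) (U (pathfinish g))"
      "min (U (pathstart g)) (U (pathfinish g)) < max (U (pathstart f)) (U (pathfinish f))"
      "max (U (pathstart f)) (U (pathfinish f)) < max (U (pathstart g)) (U (pathfinish g))"
  obtains z z' where "z \<in> path_image f" "z' \<in> path_image g" "U z = U z'" "W z = W z'"
proof -
  define orient where "orient h = (if U (pathstart h) \<le> U (pathfinish h) then h else reversepath h)" for h
  have orient: "path_image (orient h) = path_image h" "path h \<Longrightarrow> path (orient h)"
    "U (pathstart (orient h)) = min (U (pathstart h)) (U (pathfinish h))"
    "U (pathfinish (orient h)) = max (U (pathstart h)) (U (pathfinish h))"
    "W (pathstart h) = 0 \<Longrightarrow> W (pathfinish h) = 0 \<Longrightarrow> W (pathstart (orient h)) = 0 \<and> W (pathfinish (orient h)) = 0" for h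
    by (auto simp: orient_def)
  show ?thesis
    by (rule half_plane_paths_meet[of "orient f" "orient g" U W])
       (use assms orient that in auto)
qed

lemma spine_direction:
  fixes S :: "'a::euclidean_space set"
  assumes "affine S" "aff_dim S = 1" "p \<in> S"
  obtains u where "u \<noteq> 0" "(\<lambda>z. z - p) ` S = span {u}"
proof -
  let ?L = "(\<lambda>z. z - p) ` S"
  have sub: "subspace ?L" by (rule affine_diffs_subspace_subtract[OF assms(1,3)])
  have "dim ?L = 1" using aff_dim_eq_dim_subtract[of p S] assms hull_inc by (metis of_nat_eq_1_iff)
  then obtain B where B: "B \<subseteq> ?L" "independent B" "?L \<subseteq> span B" "card B = 1"
    using basis_exists[of ?L] by metis
  then obtain u where u: "B = {u}" by (auto simp: card_1_singleton_iff)
  have "u \<noteq> 0" using B(2) u by (auto simp: dependent_zero)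
  moreover have "?L = span {u}" using B u sub span_minimal[of B ?L] by blast
  ultimately show ?thesis using that by blast
qed

text \<open>w spans the orthogonal complement of u in the direction space of the page, obtained by
  one Gram-Schmidt step. Inner products with u and w are thus coordinates on the page, and the spine
  is where the second one equals its value at p.\<close>

lemma page_normal:
  fixes S P :: "'a::euclidean_space set"
  assumes P: "affine P" "aff_dim P = 2" and SP: "S \<subseteq> P" and p: "p \<in> S"
    and u: "u \<noteq> 0" "(\<lambda>z. z - p) ` S = span {u}"
  obtains w where "\<And>z z'. z \<in> P \<Longrightarrow> z' \<in> P \<Longrightarrow> z \<bullet> u = z' \<bullet> u \<Longrightarrow> z \<bullet> w = z' \<bullet> w \<Longrightarrow> z = z'"
    and "\<And>z. z \<in> P \<Longrightarrow> (z - p) \<bullet> w = 0 \<longleftrightarrow> z \<in> S"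
proof -
  let ?H = "(\<lambda>z. z - p) ` P"
  have pP: "p \<in> P" using SP p by blast
  have sub: "subspace ?H" by (rule affine_diffs_subspace_subtract[OF P(1) pP])
  have dimH: "dim ?H = 2" using aff_dim_eq_dim_subtract[of p P] P hull_inc[OF pP, of affine] by simp
  have uH: "u \<in> ?H" using u(2) SP span_base[of u "{u}"] by blast
  have "\<not> ?H \<subseteq> span {u}"
  proof
    assume "?H \<subseteq> span {u}"
    then have "dim ?H \<le> dim (span {u})" by (rule dim_subset)
    also have "\<dots> \<le> 1" using dim_le_card'[of "{u}"] by simp
    finally show False using dimH by simp
  qed
  then obtain v where v: "v \<in> ?H" "v \<notin> span {u}" by blast
  define w where "w = v - ((v \<bullet> u) / (u \<bullet> u)) *\<^sub>R u"
  have uw: "u \<bullet> w = 0" using u(1) by (simp add: w_def inner_diff_right inner_commute)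
  have wH: "w \<in> ?H" unfolding w_def by (intro subspace_diff[OF sub] subspace_scale[OF sub] v uH)
  have w0: "w \<noteq> 0" using v(2) span_mul[OF span_base[of u "{u}"], of "(v \<bullet> u) / (u \<bullet> u)"] by (auto simp: w_def)
  have "u \<noteq> w" using uw u(1) by auto
  have "independent {u, w}"
    by (rule pairwise_orthogonal_independent) (use uw u w0 in \<open>auto simp: pairwise_def orthogonal_def inner_commute\<close>)
  then have "dim (span {u, w}) = 2" using \<open>u \<noteq> w\<close> dim_span_eq_card_independent[of "{u, w}"] by simp
  moreover have "span {u, w} \<subseteq> ?H" using uH wH sub by (intro span_minimal) auto
  ultimately have H: "span {u, w} = ?H" using dimH sub by (intro subspace_dim_equal) auto
  have span_uw: "\<exists>\<alpha> \<beta>. z = \<alpha> *\<^sub>R u + \<beta> *\<^sub>R w" if "z \<in> ?H" for z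
  proof -
    have "z \<in> span {u, w}" using that H by simp
    then obtain \<alpha> where "z - \<alpha> *\<^sub>R u \<in> span {w}" by (auto simp: span_insert)
    then obtain \<beta> where "z - \<alpha> *\<^sub>R u = \<beta> *\<^sub>R w" by (auto simp: span_singleton)
    then show ?thesis by (metis add.commute diff_add_cancel)
  qed
  show ?thesis
  proof (rule that)
    fix z z' assume z: "z \<in> P" "z' \<in> P" "z \<bullet> u = z' \<bullet> u" "z \<bullet> w = z' \<bullet> w"
    have "(z - p) - (z' - p) \<in> ?H" by (rule subspace_diff[OF sub]) (use z in auto)
    then obtain \<alpha> \<beta> where "(z - p) - (z' - p) = \<alpha> *\<^sub>R u + \<beta> *\<^sub>R w" using span_uw by blast
    then have d: "z - z' = \<alpha> *\<^sub>R u + \<beta> *\<^sub>R w" by simp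
    have "(z - z') \<bullet> u = 0" "(z - z') \<bullet> w = 0" using z by (auto simp: inner_diff_left)
    then have "(z - z') \<bullet> (z - z') = 0" by (subst (2) d) (simp add: inner_add_right)
    then show "z = z'" by simp
  next
    fix z assume z: "z \<in> P"
    have S_iff: "z \<in> S \<longleftrightarrow> z - p \<in> span {u}" unfolding u(2)[symmetric] by force
    show "(z - p) \<bullet> w = 0 \<longleftrightarrow> z \<in> S"
    proof
      assume 0: "(z - p) \<bullet> w = 0"
      obtain \<alpha> \<beta> where d: "z - p = \<alpha> *\<^sub>R u + \<beta> *\<^sub>R w" using span_uw z by blast
      have "\<beta> = 0" using 0 uw w0 by (simp add: d inner_add_left)
      then show "z \<in> S" unfolding S_iff d by (simp add: span_mul span_base)
    next
      assume "z \<in> S"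
      then obtain c where "z - p = c *\<^sub>R u" unfolding S_iff by (auto simp: span_singleton)
      then show "(z - p) \<bullet> w = 0" using uw by simp
    qed
  qed
qed


locale book_setting =
  fixes G :: "('v, 'e) pre_digraph" and k :: nat and B :: "('v, 'e) book"
  assumes fin: "fin_digraph G" and embedding: "book_embedding G k B"
begin

lemma arcD:
  assumes "e \<in> arcs G"
  shows "arc (edge_curve B e)" "pathstart (edge_curve B e) = vertex_point B (tail G e)"
    "pathfinish (edge_curve B e) = vertex_point B (head G e)"
    "path_image (edge_curve B e) \<inter> spine B = {vertex_point B (tail G e), vertex_point B (head G e)}"
    "\<exists>i<k. path_image (edge_curve B e) \<subseteq> page B i"
  using embedding assms by (auto simp: book_embedding_def)

lemma pageD:
  assumes "i < k"
  shows "affine (page B i)" "aff_dim (page B i) = 2" "spine B \<subseteq> page B i"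
  using embedding assms by (auto simp: book_embedding_def)

lemma half_plane_out:
  "\<forall>i<k. \<forall>v\<in>verts G. \<forall>S\<in>components (page B i - spine B).
     \<forall>e1\<in>out_arcs G v \<inter> page_arcs G B i. \<forall>e2\<in>out_arcs G v \<inter> page_arcs G B i.
       path_image (edge_curve B e1) - spine B \<subseteq> S \<and>
       path_image (edge_curve B e2) - spine B \<subseteq> S \<longrightarrow> e1 = e2"
  using embedding unfolding book_embedding_def by simp

lemma ends_in_verts: "e \<in> arcs G \<Longrightarrow> tail G e \<in> verts G \<and> head G e \<in> verts G"
  using fin by (simp add: fin_digraph_def wf_digraph_def)

text \<open>Keeps of the geometry only what the dynamics will use: the order of the vertices, and
  for each edge a page and a half-plane. The last conclusion forbids interlacing within a
  half-plane.\<close>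

lemma combinatorial_book:
  obtains pos :: "'v \<Rightarrow> int" and pg :: "'e \<Rightarrow> nat" and side :: "'e \<Rightarrow> real"
  where "inj_on pos (verts G)"
    "\<And>e. e \<in> arcs G \<Longrightarrow> pg e < k \<and> (side e = 1 \<or> side e = -1)"
    "\<And>e e'. e \<in> arcs G \<Longrightarrow> e' \<in> arcs G \<Longrightarrow> pg e = pg e' \<Longrightarrow> tail G e \<noteq> head G e'"
    "\<And>e e'. e \<in> arcs G \<Longrightarrow> e' \<in> arcs G \<Longrightarrow> pg e = pg e' \<Longrightarrow> side e = side e' \<Longrightarrow>
       tail G e = tail G e' \<Longrightarrow> e = e'"
    "\<And>e e'. e \<in> arcs G \<Longrightarrow> e' \<in> arcs G \<Longrightarrow> pg e = pg e' \<Longrightarrow> side e = side e' \<Longrightarrow>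
       min (pos (tail G e)) (pos (head G e)) < min (pos (tail G e')) (pos (head G e')) \<Longrightarrow>
       min (pos (tail G e')) (pos (head G e')) < max (pos (tail G e)) (pos (head G e)) \<Longrightarrow>
       max (pos (tail G e)) (pos (head G e)) < max (pos (tail G e')) (pos (head G e')) \<Longrightarrow> False"
proof -
  let ?S = "spine B" and ?\<phi> = "vertex_point B" and ?\<gamma> = "edge_curve B"
  have S: "affine ?S" "aff_dim ?S = 1" and vS: "\<And>v. v \<in> verts G \<Longrightarrow> ?\<phi> v \<in> ?S" and injv: "inj_on ?\<phi> (verts G)"
    using embedding by (auto simp: book_embedding_def)
  have disjoint: "path_image (?\<gamma> e) \<inter> path_image (?\<gamma> e') - ?S = {}" if "e \<in> arcs G" "e' \<in> arcs G" "e \<noteq> e'" for e e'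
    using embedding that unfolding book_embedding_def by blast
  have "?S \<noteq> {}" using S by auto
  then obtain p where p: "p \<in> ?S" by blast
  obtain u where u: "u \<noteq> 0" "(\<lambda>z. z - p) ` ?S = span {u}" by (rule spine_direction[OF S p])
  have "\<exists>w. (\<forall>z\<in>page B i. \<forall>z'\<in>page B i. z \<bullet> u = z' \<bullet> u \<longrightarrow> z \<bullet> w = z' \<bullet> w \<longrightarrow> z = z') \<and>
            (\<forall>z\<in>page B i. (z - p) \<bullet> w = 0 \<longleftrightarrow> z \<in> ?S)" if "i < k" for i
    using page_normal[OF pageD[OF that] p u] by metis
  then obtain w where w_inj: "\<And>i z z'. i < k \<Longrightarrow> z \<in> page B i \<Longrightarrow> z' \<in> page B i \<Longrightarrow> z \<bullet> u = z' \<bullet> u \<Longrightarrow>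
      z \<bullet> w i = z' \<bullet> w i \<Longrightarrow> z = z'"
    and w_spine: "\<And>i z. i < k \<Longrightarrow> z \<in> page B i \<Longrightarrow> (z - p) \<bullet> w i = 0 \<longleftrightarrow> z \<in> ?S"
    by metis
  define X where "X v = (?\<phi> v - p) \<bullet> u" for v
  have X_inj: "v = v'" if v: "v \<in> verts G" "v' \<in> verts G" "X v = X v'" for v v'
  proof -
    obtain c c' where c: "?\<phi> v - p = c *\<^sub>R u" "?\<phi> v' - p = c' *\<^sub>R u"
      using vS v(1,2) u(2) by (metis (no_types, lifting) imageI span_singleton rangeE)
    then have "c = c'" using that(3) u(1) by (simp add: X_def)
    then have "?\<phi> v = ?\<phi> v'" using c by (metis diff_add_cancel)
    then show ?thesis using injv that by (auto dest: inj_onD)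
  qed
  \<comment> \<open>The rank along the spine replaces the real coordinate, so distinct vertices are
    at distance at least 1.\<close>
  define pos where "pos v = int (card {a \<in> verts G. X a < X v})" for v
  have finV: "finite (verts G)" using fin by (simp add: fin_digraph_def fin_digraph_axioms_def)
  have pos_less: "pos v < pos v' \<longleftrightarrow> X v < X v'" if "v \<in> verts G" "v' \<in> verts G" for v v'
  proof -
    have mono: "pos v < pos v'" if "X v < X v'" "v \<in> verts G" for v v'
      unfolding pos_def of_nat_less_iff using finV that by (intro psubset_card_mono) auto
    have eq: "pos v = pos v'" if "X v = X v'" using that by (simp add: pos_def)
    show ?thesis using mono[of v v'] mono[of v' v] eq that by linarith
  qed
  have pos_min: "min (pos a) (pos b) < min (pos c) (pos d) \<longleftrightarrow> min (X a) (X b) < min (X c) (X d)"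
    and pos_min_max: "min (pos a) (pos b) < max (pos c) (pos d) \<longleftrightarrow> min (X a) (X b) < max (X c) (X d)"
    and pos_max: "max (pos a) (pos b) < max (pos c) (pos d) \<longleftrightarrow> max (X a) (X b) < max (X c) (X d)"
    if "a \<in> verts G" "b \<in> verts G" "c \<in> verts G" "d \<in> verts G" for a b c d
    using that by (simp_all add: min_less_iff_disj less_max_iff_disj pos_less)
  have "\<exists>pg. \<forall>e\<in>arcs G. pg e < k \<and> path_image (?\<gamma> e) \<subseteq> page B (pg e)"
    using arcD(5) by metis
  then obtain pg where pg: "\<And>e. e \<in> arcs G \<Longrightarrow> pg e < k \<and> path_image (?\<gamma> e) \<subseteq> page B (pg e)" by blast
  define h where "h e z = (z - p) \<bullet> w (pg e)" for e z
  have h_zero: "h e z = 0 \<longleftrightarrow> z \<in> ?S" if "e \<in> arcs G" "z \<in> path_image (?\<gamma> e)" for e z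
    using w_spine[of "pg e" z] pg[OF that(1)] that(2) by (auto simp: h_def)
  \<comment> \<open>The midpoint decides: the curve meets the spine only at its ends, so h has
    constant sign in between.\<close>
  define side where "side e = sgn (h e (?\<gamma> e (1/2)))" for e
  have inner: "h e (?\<gamma> e t) \<noteq> 0" if e: "e \<in> arcs G" and t: "0 < t" "t < 1" for e t
  proof
    assume "h e (?\<gamma> e t) = 0"
    moreover have "?\<gamma> e t \<in> path_image (?\<gamma> e)" using t by (auto simp: path_image_def)
    ultimately have "?\<gamma> e t \<in> {?\<gamma> e 0, ?\<gamma> e 1}"
      using h_zero[OF e] arcD[OF e] by (auto simp: pathstart_def pathfinish_def)
    moreover have "inj_on (?\<gamma> e) {0..1}" using arcD(1)[OF e] by (simp add: arc_def)
    ultimately show False using t by (auto dest: inj_onD)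
  qed
  have side_pos: "side e * h e (?\<gamma> e t) > 0" if e: "e \<in> arcs G" and t: "0 < t" "t < 1" for e t
  proof -
    have cont: "continuous_on {0<..<1} (\<lambda>t. h e (?\<gamma> e t))"
      using arc_imp_path[OF arcD(1)[OF e]] unfolding h_def path_def
      by (intro continuous_intros) (auto intro: continuous_on_subset)
    have "Topological_Spaces.connected ((\<lambda>t. h e (?\<gamma> e t)) ` {0<..<1})" by (rule connected_continuous_image[OF cont]) simp
    then have "0 \<in> (\<lambda>t. h e (?\<gamma> e t)) ` {0<..<1}" if "a \<in> (\<lambda>t. h e (?\<gamma> e t)) ` {0<..<1}" "a \<le> 0"
      "b \<in> (\<lambda>t. h e (?\<gamma> e t)) ` {0<..<1}" "0 \<le> b" for a b
      using that connectedD_interval[of _ a b 0] by blast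
    then have "\<not> (h e (?\<gamma> e s) < 0 \<and> h e (?\<gamma> e r) > 0)" if "s \<in> {0<..<1}" "r \<in> {0<..<1}" for r s
      using inner[OF e] that by (smt (verit, ccfv_threshold) greaterThanLessThan_iff imageE image_eqI)
    from this[of t "1/2"] this[of "1/2" t] show ?thesis
      using inner[OF e, of t] inner[OF e, of "1/2"] t by (auto simp: side_def sgn_if mult_less_0_iff zero_less_mult_iff)
  qed
  have side_nonneg: "side e * h e z \<ge> 0" if e: "e \<in> arcs G" and z: "z \<in> path_image (?\<gamma> e)" for e z
  proof -
    obtain t where t: "z = ?\<gamma> e t" "0 \<le> t" "t \<le> 1" using z by (auto simp: path_image_def)
    show ?thesis
    proof (cases "t = 0 \<or> t = 1")
      case True
      then have "z \<in> ?S" using t arcD[OF e] by (auto simp: pathstart_def pathfinish_def)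
      then show ?thesis using h_zero[OF e z] by simp
    next
      case False then show ?thesis using side_pos[OF e, of t] t by (simp add: less_imp_le)
    qed
  qed
  have side: "side e = 1 \<or> side e = -1" if "e \<in> arcs G" for e
    using inner[OF that, of "1/2"] by (auto simp: side_def sgn_if)
  have in_page: "e \<in> page_arcs G B (pg e)" if "e \<in> arcs G" for e
    using pg[OF that] that by (simp add: page_arcs_def)
  show ?thesis
  proof (rule that[of pos pg side])
    show "inj_on pos (verts G)"
    proof (rule inj_onI)
      fix v v' assume v: "v \<in> verts G" "v' \<in> verts G" "pos v = pos v'"
      then have "X v = X v'" using pos_less[OF v(1,2)] pos_less[OF v(2,1)] by linarith
      then show "v = v'" using X_inj v by blast
    qed
  next
    fix e assume "e \<in> arcs G"
    then show "pg e < k \<and> (side e = 1 \<or> side e = -1)" using pg side by blast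
  next
    fix e e' assume e: "e \<in> arcs G" "e' \<in> arcs G" "pg e = pg e'"
    have "in_arcs G (tail G e) \<inter> page_arcs G B (pg e) = {} \<or> out_arcs G (tail G e) \<inter> page_arcs G B (pg e) = {}"
      using embedding pg[OF e(1)] ends_in_verts[OF e(1)] by (auto simp: book_embedding_def)
    then show "tail G e \<noteq> head G e'" using in_page[OF e(1)] in_page[OF e(2)] e by (auto simp: in_arcs_def out_arcs_def)
  next
    fix e e' assume e: "e \<in> arcs G" "e' \<in> arcs G" "pg e = pg e'" "side e = side e'" "tail G e = tail G e'"
    let ?i = "pg e"
    \<comment> \<open>The book embedding speaks of components of the page minus the spine. The open
      half-plane Q is convex, hence connected, so it lies in one such component together with both
      curves.\<close>
    define Q where "Q = {z \<in> page B ?i. side e * ((z - p) \<bullet> w ?i) > 0}"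
    have "convex Q"
    proof -
      have "Q = page B ?i \<inter> {z. (side e *\<^sub>R w ?i) \<bullet> z > side e * (p \<bullet> w ?i)}"
        by (auto simp: Q_def inner_diff_left algebra_simps inner_commute)
      moreover have "convex (page B ?i)" using pageD(1) pg[OF e(1)] affine_imp_convex by blast
      ultimately show ?thesis using convex_Int[OF _ convex_halfspace_gt] by metis
    qed
    moreover have "Q \<subseteq> page B ?i - ?S" using w_spine pg[OF e(1)] by (force simp: Q_def)
    moreover have Q: "path_image (?\<gamma> d) - ?S \<subseteq> Q" if "d \<in> {e, e'}" for d
    proof
      fix z assume z: "z \<in> path_image (?\<gamma> d) - ?S"
      then have "h d z \<noteq> 0" using h_zero that e by blast
      moreover have "side d * h d z \<ge> 0" using side_nonneg z that e by blast
      moreover have "side d \<noteq> 0" using side[of d] that e by auto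
      ultimately have "side d * h d z > 0" by (simp add: less_le)
      then show "z \<in> Q" using pg[of d] z that e by (auto simp: Q_def h_def)
    qed
    moreover have "Q \<noteq> {}"
    proof -
      have "?\<gamma> e (1/2) \<in> path_image (?\<gamma> e)" by (auto simp: path_image_def)
      moreover have "?\<gamma> e (1/2) \<notin> ?S" using h_zero[OF e(1) calculation] inner[OF e(1), of "1/2"] by simp
      ultimately show ?thesis using Q[of e] by blast
    qed
    ultimately obtain C where C: "C \<in> components (page B ?i - ?S)" "Q \<subseteq> C"
      using exists_component_superset[of Q "page B ?i - ?S"] convex_connected by blast
    have "\<forall>S\<in>components (page B ?i - ?S).
           \<forall>e1\<in>out_arcs G (tail G e) \<inter> page_arcs G B ?i. \<forall>e2\<in>out_arcs G (tail G e) \<inter> page_arcs G B ?i.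
             path_image (?\<gamma> e1) - ?S \<subseteq> S \<and> path_image (?\<gamma> e2) - ?S \<subseteq> S \<longrightarrow> e1 = e2"
      using half_plane_out pg[OF e(1)] ends_in_verts[OF e(1)] by blast
    moreover have "e \<in> out_arcs G (tail G e) \<inter> page_arcs G B ?i" "e' \<in> out_arcs G (tail G e) \<inter> page_arcs G B ?i"
      using e in_page[OF e(1)] in_page[OF e(2)] by (auto simp: out_arcs_def)
    ultimately show "e = e'" using C Q[of e] Q[of e'] by (meson insertCI order_trans)
  next
    fix e e' assume e: "e \<in> arcs G" "e' \<in> arcs G" "pg e = pg e'" "side e = side e'"
      and "min (pos (tail G e)) (pos (head G e)) < min (pos (tail G e')) (pos (head G e'))"
       "min (pos (tail G e')) (pos (head G e')) < max (pos (tail G e)) (pos (head G e))"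
       "max (pos (tail G e)) (pos (head G e)) < max (pos (tail G e')) (pos (head G e'))"
    then have less: "min (X (tail G e)) (X (head G e)) < min (X (tail G e')) (X (head G e'))"
       "min (X (tail G e')) (X (head G e')) < max (X (tail G e)) (X (head G e))"
       "max (X (tail G e)) (X (head G e)) < max (X (tail G e')) (X (head G e'))"
      using ends_in_verts[OF e(1)] ends_in_verts[OF e(2)] by (simp_all only: pos_min pos_min_max pos_max)
    let ?U = "\<lambda>z. (z - p) \<bullet> u" and ?W = "\<lambda>z. side e * h e z"
    have h_eq: "h e' = h e" using e by (simp add: h_def fun_eq_iff)
    have end_zero: "?W (pathstart (?\<gamma> d)) = 0 \<and> ?W (pathfinish (?\<gamma> d)) = 0" if "d \<in> {e, e'}" for d
    proof -
      have d: "d \<in> arcs G" "h d = h e" using that e h_eq by auto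
      have "pathstart (?\<gamma> d) \<in> ?S" "pathfinish (?\<gamma> d) \<in> ?S"
        using arcD(2,3)[OF d(1)] ends_in_verts[OF d(1)] vS by auto
      then have "h d (pathstart (?\<gamma> d)) = 0" "h d (pathfinish (?\<gamma> d)) = 0"
        using h_zero[OF d(1)] by auto
      then show ?thesis using d by simp
    qed
    have cont: "continuous_on UNIV ?U" "continuous_on UNIV ?W" unfolding h_def by (intro continuous_intros)+
    obtain z z' where z: "z \<in> path_image (?\<gamma> e)" "z' \<in> path_image (?\<gamma> e')" "?U z = ?U z'" "?W z = ?W z'"
    proof (rule half_plane_paths_meet_unoriented[of "?\<gamma> e" "?\<gamma> e'" ?U ?W])
      show "path (?\<gamma> e)" "path (?\<gamma> e')" using arcD(1) e arc_imp_path by blast+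
      show "continuous_on UNIV ?U" "continuous_on UNIV ?W" by (rule cont)+
      show "?W z \<ge> 0" if "z \<in> path_image (?\<gamma> e)" for z using side_nonneg[OF e(1) that] .
      show "?W z \<ge> 0" if "z \<in> path_image (?\<gamma> e')" for z using side_nonneg[OF e(2) that] e(4) h_eq by simp
    qed (use less end_zero[of e] end_zero[of e'] arcD(2,3)[OF e(1)] arcD(2,3)[OF e(2)] in \<open>simp_all add: X_def\<close>)
    have "side e \<noteq> 0" using side[OF e(1)] by auto
    then have "z = z'"
      using z e pg[OF e(1)] pg[OF e(2)] by (intro w_inj[of "pg e"]) (auto simp: h_def inner_diff_left)
    have "e \<noteq> e'" using less by auto
    then have "z \<in> ?S" using disjoint[OF e(1,2)] z \<open>z = z'\<close> by blast
    \<comment> \<open>A common point on the spine would be an end point of both curves, but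
      interlaced pairs have no common member.\<close>
    then have "z \<in> {?\<phi> (tail G e), ?\<phi> (head G e)}" "z \<in> {?\<phi> (tail G e'), ?\<phi> (head G e')}"
      using z \<open>z = z'\<close> arcD(4)[OF e(1)] arcD(4)[OF e(2)] by blast+
    then have "?U z \<in> {X (tail G e), X (head G e)}" "?U z \<in> {X (tail G e'), X (head G e')}"
      by (auto simp: X_def)
    then show False using less by (auto simp: min_def max_def split: if_splits)
  qed
qed

end

section \<open>Smooth response functions and their perturbations\<close>

text \<open>A class containing the response function and closed under partial derivatives:
  smoothness then reduces to continuity by induction on the order.\<close>

inductive elementary :: "((nat \<Rightarrow> real) \<Rightarrow> real) \<Rightarrow> bool" where
  const: "elementary (\<lambda>z. c)"
| proj: "elementary (\<lambda>z. z i)"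
| add: "elementary f \<Longrightarrow> elementary g \<Longrightarrow> elementary (\<lambda>z. f z + g z)"
| mult: "elementary f \<Longrightarrow> elementary g \<Longrightarrow> elementary (\<lambda>z. f z * g z)"
| sin: "elementary f \<Longrightarrow> elementary (\<lambda>z. sin (f z))"
| cos: "elementary f \<Longrightarrow> elementary (\<lambda>z. cos (f z))"

lemma elementary_diff:
  assumes "elementary f" "elementary g"
  shows "elementary (\<lambda>z. f z - g z)"
  using elementary.add[OF assms(1) elementary.mult[OF elementary.const[of "-1"] assms(2)]] by simp

lemma elementary_sum:
  "finite I \<Longrightarrow> (\<And>i. i \<in> I \<Longrightarrow> elementary (f i)) \<Longrightarrow> elementary (\<lambda>z. \<Sum>i\<in>I. f i z)"
  by (induction rule: finite_induct) (auto intro: elementary.intros)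

lemma elementary_polynomial:
  assumes "real_polynomial_function p" "elementary f" "elementary g"
  shows "elementary (\<lambda>z. p (f z, g z))"
  using assms(1)
proof induction
  case (linear p)
  interpret bounded_linear p by fact
  have "p (f z, g z) = f z * p (1, 0) + g z * p (0, 1)" for z
  proof -
    have "(f z, g z) = f z *\<^sub>R (1, 0) + g z *\<^sub>R (0, 1)" by simp
    then show ?thesis by (simp only: add scaleR) simp
  qed
  then show ?case by simp (intro elementary.intros assms)
qed (auto intro: elementary.intros)

lemma elementary_continuous:
  assumes "elementary f"
  shows "continuous_map (Euclidean_space n) euclideanreal f"
  unfolding continuous_map_Euclidean_space_iff using assms
  by induction (auto intro!: continuous_intros intro: continuous_on_subset[OF continuous_on_product_coordinates])

lemma elementary_partial_derivative:
  assumes "elementary f"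
  shows "\<exists>g. elementary g \<and> (\<forall>z. ((\<lambda>t. f (z(i := t))) has_real_derivative g z) (at (z i)))"
  using assms
proof induction
  case (const c)
  show ?case by (intro exI[of _ "\<lambda>z. 0"]) (auto intro: elementary.intros)
next
  case (proj j)
  show ?case
    by (intro exI[of _ "\<lambda>z. if j = i then 1 else 0"]) (cases "j = i"; auto intro: elementary.intros)
next
  case (add f g)
  then obtain f' g' where fg: "elementary f'" "elementary g'"
    "\<And>z. ((\<lambda>t. f (z(i := t))) has_real_derivative f' z) (at (z i))"
    "\<And>z. ((\<lambda>t. g (z(i := t))) has_real_derivative g' z) (at (z i))" by blast
  show ?case
    by (intro exI[of _ "\<lambda>z. f' z + g' z"] conjI allI elementary.intros DERIV_add fg)
next
  case (mult f g)
  then obtain f' g' where fg: "elementary f'" "elementary g'"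
    "\<And>z. ((\<lambda>t. f (z(i := t))) has_real_derivative f' z) (at (z i))"
    "\<And>z. ((\<lambda>t. g (z(i := t))) has_real_derivative g' z) (at (z i))" by blast
  have "((\<lambda>t. f (z(i := t)) * g (z(i := t))) has_real_derivative f' z * g z + g' z * f z) (at (z i))" for z
    using DERIV_mult[OF fg(3)[of z] fg(4)[of z]] by (simp only: fun_upd_triv)
  then show ?case
    by (intro exI[of _ "\<lambda>z. f' z * g z + g' z * f z"] conjI allI elementary.intros fg(1,2) mult.hyps)
next
  case (sin f)
  then obtain f' where f': "elementary f'"
    "\<And>z. ((\<lambda>t. f (z(i := t))) has_real_derivative f' z) (at (z i))" by blast
  have "((\<lambda>t. sin (f (z(i := t)))) has_real_derivative cos (f z) * f' z) (at (z i))" for z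
    using DERIV_fun_sin[OF f'(2)[of z]] by (simp only: fun_upd_triv)
  then show ?case
    by (intro exI[of _ "\<lambda>z. cos (f z) * f' z"] conjI allI elementary.intros f'(1) sin.hyps)
next
  case (cos f)
  then obtain f' where f': "elementary f'"
    "\<And>z. ((\<lambda>t. f (z(i := t))) has_real_derivative f' z) (at (z i))" by blast
  have "((\<lambda>t. cos (f (z(i := t)))) has_real_derivative (- 1) * (sin (f z) * f' z)) (at (z i))" for z
    using DERIV_fun_cos[OF f'(2)[of z]] by simp
  then show ?case
    by (intro exI[of _ "\<lambda>z. (- 1) * (sin (f z) * f' z)"] conjI allI elementary.intros f'(1) cos.hyps)
qed

lemma elementary_Ck_fun: "elementary f \<Longrightarrow> Ck_fun n r f"
proof (induction r arbitrary: f)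
  case 0
  then show ?case by (simp add: elementary_continuous)
next
  case (Suc r)
  have "(\<forall>x. (\<lambda>t. f (x(i := t))) field_differentiable at (x i)) \<and> Ck_fun n r (partial_deriv i f)" for i
  proof -
    obtain g where g: "elementary g" "\<And>z. ((\<lambda>t. f (z(i := t))) has_real_derivative g z) (at (z i))"
      using elementary_partial_derivative[OF Suc.prems] by blast
    have "partial_deriv i f = g"
      unfolding partial_deriv_def by (intro ext DERIV_imp_deriv g(2))
    then show ?thesis using g Suc.IH[OF g(1)] unfolding field_differentiable_def by blast
  qed
  then show ?case using elementary_continuous[OF Suc.prems] by simp
qed

lemma smooth_fun_elementary: "elementary f \<Longrightarrow> smooth_fun n f"
  by (simp add: smooth_fun_def elementary_Ck_fun)

text \<open>The difference of f and g has partial derivatives smaller than \<epsilon>. Changing one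
  coordinate at a time and applying the mean value inequality each time gives the Lipschitz constant
  \<epsilon> for the sum norm.\<close>

lemma C1_close_lipschitz:
  assumes f: "Ck_fun n 1 f" and g: "Ck_fun n 1 g" and close: "C1_close n \<epsilon> f g"
    and x: "x \<in> topspace (Euclidean_space n)" and y: "y \<in> topspace (Euclidean_space n)"
  shows "\<bar>(g x - f x) - (g y - f y)\<bar> \<le> \<epsilon> * (\<Sum>i<n. \<bar>x i - y i\<bar>)"
proof -
  define h where "h z = g z - f z" for z
  have diff: "(\<lambda>t. f (z(i := t))) field_differentiable at (z i)" "(\<lambda>t. g (z(i := t))) field_differentiable at (z i)"
    if "z \<in> topspace (Euclidean_space n)" "i < n" for z i
    using f g that by simp_all
  have step: "\<bar>h (z(i := a)) - h (z(i := b))\<bar> \<le> \<epsilon> * \<bar>a - b\<bar>"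
    if z: "z \<in> topspace (Euclidean_space n)" and i: "i < n" for z i a b
  proof -
    have "norm (h (z(i := a)) - h (z(i := b))) \<le> \<epsilon> * norm (a - b)"
    proof (rule field_differentiable_bound[of UNIV "\<lambda>t. h (z(i := t))"
            "\<lambda>t. partial_deriv i g (z(i := t)) - partial_deriv i f (z(i := t))"])
      fix t :: real
      let ?z = "z(i := t)"
      have z': "?z \<in> topspace (Euclidean_space n)" using z i by (auto simp: topspace_Euclidean_space)
      have "((\<lambda>s. f (?z(i := s))) has_field_derivative partial_deriv i f ?z) (at (?z i))"
        "((\<lambda>s. g (?z(i := s))) has_field_derivative partial_deriv i g ?z) (at (?z i))"
        using diff[OF z' i] by (simp_all add: partial_deriv_def DERIV_deriv_iff_field_differentiable)
      then show "((\<lambda>t. h (z(i := t))) has_field_derivative partial_deriv i g ?z - partial_deriv i f ?z) (at t within UNIV)"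
        unfolding h_def by (auto intro: DERIV_diff)
      show "norm (partial_deriv i g ?z - partial_deriv i f ?z) \<le> \<epsilon>"
        using close z' i by (force simp: C1_close_def)
    qed auto
    then show ?thesis by simp
  qed
  \<comment> \<open>The path from y to x along coordinate directions stays in the Euclidean space,
    as both ends vanish from index n on.\<close>
  define w where "w k = (\<lambda>i. if i < k then x i else y i)" for k :: nat
  have w_top: "w k \<in> topspace (Euclidean_space n)" for k
    using x y by (auto simp: w_def topspace_Euclidean_space)
  have "\<bar>h (w k) - h y\<bar> \<le> \<epsilon> * (\<Sum>i<k. \<bar>x i - y i\<bar>)" if "k \<le> n" for k
    using that
  proof (induction k)
    case 0
    then show ?case by (simp add: w_def)
  next
    case (Suc k)
    have "w (Suc k) = (w k)(k := x k)" "w k = (w k)(k := y k)" by (auto simp: w_def fun_eq_iff)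
    then have "\<bar>h (w (Suc k)) - h (w k)\<bar> \<le> \<epsilon> * \<bar>x k - y k\<bar>"
      using step[OF w_top[of k], of k "x k" "y k"] Suc.prems by simp
    then show ?case using Suc by (simp add: distrib_left)
  qed
  from this[of n] have "\<bar>h (w n) - h y\<bar> \<le> \<epsilon> * (\<Sum>i<n. \<bar>x i - y i\<bar>)" by simp
  moreover have "w n = x" using x y by (auto simp: w_def fun_eq_iff topspace_Euclidean_space)
  ultimately show ?thesis by (simp add: h_def)
qed

text \<open>Induction over the construction of polynomials. For products the factors must also be
  bounded, which follows from their Lipschitz bounds and their values at the origin of the
  box.\<close>

lemma real_polynomial_lipschitz_on_box:
  fixes f :: "real \<times> real \<Rightarrow> real"
  assumes "real_polynomial_function f" and "M \<ge> 0"
  shows "\<exists>L\<ge>0. \<forall>x y x' y'. \<bar>x\<bar> \<le> M \<longrightarrow> \<bar>y\<bar> \<le> M \<longrightarrow> \<bar>x'\<bar> \<le> M \<longrightarrow> \<bar>y'\<bar> \<le> M \<longrightarrow>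
      \<bar>f (x, y) - f (x', y')\<bar> \<le> L * (\<bar>x - x'\<bar> + \<bar>y - y'\<bar>)"
  using assms(1)
proof induction
  case (linear f)
  interpret bounded_linear f by fact
  obtain K where K: "K > 0" "\<And>z. norm (f z) \<le> norm z * K" using pos_bounded by blast
  have "\<bar>f (x, y) - f (x', y')\<bar> \<le> K * (\<bar>x - x'\<bar> + \<bar>y - y'\<bar>)" for x y x' y'
  proof -
    have "\<bar>f (x, y) - f (x', y')\<bar> \<le> norm (x - x', y - y') * K"
      using K(2)[of "(x - x', y - y')"] by (simp flip: diff)
    also have "\<dots> \<le> (\<bar>x - x'\<bar> + \<bar>y - y'\<bar>) * K"
      using K(1) norm_Pair_le[of "x - x'" "y - y'"] by (intro mult_right_mono) auto
    finally show ?thesis by (simp add: mult.commute)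
  qed
  then show ?case using K(1) by (intro exI[of _ K]) auto
next
  case (const c)
  then show ?case by (intro exI[of _ 0]) auto
next
  case (add f g)
  then obtain L L' where L: "L \<ge> 0" "L' \<ge> 0"
    "\<And>x y x' y'. \<bar>x\<bar> \<le> M \<Longrightarrow> \<bar>y\<bar> \<le> M \<Longrightarrow> \<bar>x'\<bar> \<le> M \<Longrightarrow> \<bar>y'\<bar> \<le> M \<Longrightarrow>
      \<bar>f (x, y) - f (x', y')\<bar> \<le> L * (\<bar>x - x'\<bar> + \<bar>y - y'\<bar>)"
    "\<And>x y x' y'. \<bar>x\<bar> \<le> M \<Longrightarrow> \<bar>y\<bar> \<le> M \<Longrightarrow> \<bar>x'\<bar> \<le> M \<Longrightarrow> \<bar>y'\<bar> \<le> M \<Longrightarrow>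
      \<bar>g (x, y) - g (x', y')\<bar> \<le> L' * (\<bar>x - x'\<bar> + \<bar>y - y'\<bar>)" by blast
  show ?case
  proof (intro exI[of _ "L + L'"] conjI allI impI)
    fix x y x' y' :: real assume b: "\<bar>x\<bar> \<le> M" "\<bar>y\<bar> \<le> M" "\<bar>x'\<bar> \<le> M" "\<bar>y'\<bar> \<le> M"
    show "\<bar>f (x, y) + g (x, y) - (f (x', y') + g (x', y'))\<bar> \<le> (L + L') * (\<bar>x - x'\<bar> + \<bar>y - y'\<bar>)"
      using L(3)[OF b] L(4)[OF b] unfolding distrib_right by linarith
  qed (use L in simp)
next
  case (mult f g)
  then obtain L L' where L: "L \<ge> 0" "L' \<ge> 0"
    and f: "\<And>x y x' y'. \<bar>x\<bar> \<le> M \<Longrightarrow> \<bar>y\<bar> \<le> M \<Longrightarrow> \<bar>x'\<bar> \<le> M \<Longrightarrow> \<bar>y'\<bar> \<le> M \<Longrightarrow>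
      \<bar>f (x, y) - f (x', y')\<bar> \<le> L * (\<bar>x - x'\<bar> + \<bar>y - y'\<bar>)"
    and g: "\<And>x y x' y'. \<bar>x\<bar> \<le> M \<Longrightarrow> \<bar>y\<bar> \<le> M \<Longrightarrow> \<bar>x'\<bar> \<le> M \<Longrightarrow> \<bar>y'\<bar> \<le> M \<Longrightarrow>
      \<bar>g (x, y) - g (x', y')\<bar> \<le> L' * (\<bar>x - x'\<bar> + \<bar>y - y'\<bar>)" by blast
  define F where "F = \<bar>f (0, 0)\<bar> + L * (2 * M)"
  define H where "H = \<bar>g (0, 0)\<bar> + L' * (2 * M)"
  have F: "\<bar>f (x, y)\<bar> \<le> F" and H: "\<bar>g (x, y)\<bar> \<le> H" if "\<bar>x\<bar> \<le> M" "\<bar>y\<bar> \<le> M" for x y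
  proof -
    have "L * (\<bar>x\<bar> + \<bar>y\<bar>) \<le> L * (2 * M)" "L' * (\<bar>x\<bar> + \<bar>y\<bar>) \<le> L' * (2 * M)"
      using that L by (auto intro!: mult_left_mono)
    moreover have "\<bar>f (x, y) - f (0, 0)\<bar> \<le> L * (\<bar>x\<bar> + \<bar>y\<bar>)" "\<bar>g (x, y) - g (0, 0)\<bar> \<le> L' * (\<bar>x\<bar> + \<bar>y\<bar>)"
      using f[of x y 0 0] g[of x y 0 0] that assms(2) by simp_all
    ultimately show "\<bar>f (x, y)\<bar> \<le> F" "\<bar>g (x, y)\<bar> \<le> H" unfolding F_def H_def by linarith+
  qed
  have FH: "F \<ge> 0" "H \<ge> 0" using L assms(2) by (auto simp: F_def H_def)
  show ?case
  proof (intro exI[of _ "F * L' + H * L"] conjI allI impI)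
    fix x y x' y' :: real assume b: "\<bar>x\<bar> \<le> M" "\<bar>y\<bar> \<le> M" "\<bar>x'\<bar> \<le> M" "\<bar>y'\<bar> \<le> M"
    let ?d = "\<bar>x - x'\<bar> + \<bar>y - y'\<bar>"
    have "f (x, y) * g (x, y) - f (x', y') * g (x', y') =
        f (x, y) * (g (x, y) - g (x', y')) + g (x', y') * (f (x, y) - f (x', y'))" by (simp add: algebra_simps)
    then have "\<bar>f (x, y) * g (x, y) - f (x', y') * g (x', y')\<bar> \<le>
        \<bar>f (x, y)\<bar> * \<bar>g (x, y) - g (x', y')\<bar> + \<bar>g (x', y')\<bar> * \<bar>f (x, y) - f (x', y')\<bar>"
      by (metis abs_mult abs_triangle_ineq)
    also have "\<dots> \<le> F * (L' * ?d) + H * (L * ?d)"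
      using FH by (intro add_mono mult_mono f g F H b) auto
    finally show "\<bar>f (x, y) * g (x, y) - f (x', y') * g (x', y')\<bar> \<le> (F * L' + H * L) * ?d"
      by (simp add: algebra_simps)
  qed (use FH L in simp)
qed

section \<open>Routes of the edges of a page\<close>

text \<open>The four regions group the sign conditions of \<open>channel\<close>, for an edge from 0
  to n: y grows on this one (\<open>climb\<close>, \<open>floor\<close>) and shrinks on the next
  (\<open>descend\<close>, \<open>ceiling\<close>); x grows on \<open>forward_region\<close>
  (\<open>left_wall\<close>, \<open>cross\<close>, \<open>arrive\<close>) and shrinks on
  \<open>backward_region\<close> (\<open>saddle_wall\<close>, \<open>sink_wall\<close>).\<close>

definition climb_region :: "real \<Rightarrow> (real \<times> real) set" where
  "climb_region n = {(x, y). \<bar>x\<bar> \<le> 1/8 \<and> 0 \<le> y \<and> y \<le> n - 1/2} \<union>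
     {(x, y). - 1/8 \<le> x \<and> x \<le> n - 1/4 \<and> n - 1/2 \<le> y \<and> y \<le> n - 1/4}"

definition descend_region :: "real \<Rightarrow> (real \<times> real) set" where
  "descend_region n = {(x, y). \<bar>x - n\<bar> \<le> 1/8 \<and> 0 \<le> y \<and> y \<le> n + 1/4} \<union>
     {(x, y). - 1/8 \<le> x \<and> x \<le> n + 1/8 \<and> y = n + 1/4}"

definition forward_region :: "real \<Rightarrow> (real \<times> real) set" where
  "forward_region n = {(x, y). x = - 1/8 \<and> 0 \<le> y \<and> y \<le> n + 1/4} \<union>
     {(x, y). - 1/8 \<le> x \<and> x \<le> n - 1/4 \<and> n - 1/4 \<le> y \<and> y \<le> n + 1/4} \<union>
     {(x, y). n - 1/4 \<le> x \<and> x \<le> n - 1/8 \<and> 0 \<le> y \<and> y \<le> n + 1/4}"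

definition backward_region :: "real \<Rightarrow> (real \<times> real) set" where
  "backward_region n = {(x, y). x = 1/8 \<and> 0 \<le> y \<and> y \<le> n - 1/2} \<union>
     {(x, y). x = n + 1/8 \<and> 0 \<le> y \<and> y \<le> n + 1/4}"

lemmas region_defs = climb_region_def descend_region_def forward_region_def backward_region_def

lemma closed_regions:
  "closed (climb_region n)" "closed (descend_region n)" "closed (forward_region n)" "closed (backward_region n)"
  unfolding region_defs case_prod_unfold
  by (intro closed_Un closed_Collect_conj closed_Collect_le closed_Collect_eq continuous_intros)+

text \<open>Whether the edges \<open>p \<rightarrow> q\<close> and \<open>p' \<rightarrow> q'\<close> can share a page; \<open>s\<close>: they lie in the same half-plane.\<close>

definition compatible :: "bool \<Rightarrow> int \<Rightarrow> int \<Rightarrow> int \<Rightarrow> int \<Rightarrow> bool" where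
  "compatible s p q p' q' \<longleftrightarrow> p \<noteq> q \<and> p' \<noteq> q' \<and> p \<noteq> q' \<and> p' \<noteq> q \<and>
     (s \<longrightarrow> p = p' \<and> q = q' \<or> p \<noteq> p' \<and>
        (max p q \<le> min p' q' \<or> max p' q' \<le> min p q \<or>
         min p q \<le> min p' q' \<and> max p' q' \<le> max p q \<or> min p' q' \<le> min p q \<and> max p q \<le> max p' q'))"

lemma compatible_commute: "compatible s p q p' q' \<longleftrightarrow> compatible s p' q' p q"
  by (auto simp: compatible_def)

text \<open>An end point strictly inside the span of the first edge rules out disjointness and the
  reverse nesting, so the second edge lies inside; for integers its span is then shorter by at least
  1. This unit separates the crossing heights.\<close>

lemma inner_vertex_span:
  assumes "compatible True p q p' q'" "v = p' \<or> v = q'" "min p q < v" "v < max p q"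
  shows "\<bar>q' - p'\<bar> \<le> \<bar>q - p\<bar> - 1"
  using assms unfolding compatible_def by (auto simp: min_def max_def split: if_splits)

definition dirn :: "int \<Rightarrow> int \<Rightarrow> real" where "dirn p q = real_of_int (sgn (q - p))"

abbreviation gap :: "int \<Rightarrow> int \<Rightarrow> real" where "gap p q \<equiv> real_of_int \<bar>q - p\<bar>"

lemma dirn_cases:
  assumes "p \<noteq> q"
  obtains "dirn p q = 1" "p < q" "\<bar>q - p\<bar> = q - p" | "dirn p q = - 1" "q < p" "\<bar>q - p\<bar> = p - q"
  using assms by (cases p q rule: linorder_cases) (auto simp: dirn_def)

definition up_set :: "int \<Rightarrow> int \<Rightarrow> (real \<times> real) set" where
  "up_set p q = {(x, y). (dirn p q * (x - p), y) \<in> climb_region (gap p q)}"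

definition down_set :: "int \<Rightarrow> int \<Rightarrow> (real \<times> real) set" where
  "down_set p q = {(x, y). (dirn p q * (x - p), y) \<in> descend_region (gap p q)}"

text \<open>An edge pointing left is normalized by a reflection, which exchanges growth and decay of
  x. Hence forward and backward regions swap, so that this set demands motion to the right in the
  coordinates of the page.\<close>

definition right_set :: "int \<Rightarrow> int \<Rightarrow> (real \<times> real) set" where
  "right_set p q = {(x, y). (dirn p q * (x - p), y) \<in> (if p < q then forward_region else backward_region) (gap p q)}"

definition left_set :: "int \<Rightarrow> int \<Rightarrow> (real \<times> real) set" where
  "left_set p q = {(x, y). (dirn p q * (x - p), y) \<in> (if p < q then backward_region else forward_region) (gap p q)}"

text \<open>Like the three rules that follow, this trades the set for linear inequalities that cover
  both directions of the edge, weakened to what the disjointness proofs use.\<close>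

lemma up_setE:
  assumes "(x, y) \<in> up_set p q" "p \<noteq> q"
  obtains "\<bar>x - p\<bar> \<le> 1/8" "0 \<le> y" "y \<le> gap p q - 1/2"
  | "min p q - 1/8 \<le> x" "x \<le> max p q + 1/8" "\<bar>x - q\<bar> \<ge> 1/4" "gap p q - 1/2 \<le> y" "y \<le> gap p q - 1/4"
  using assms(2)
proof (cases rule: dirn_cases)
  case 1
  then show ?thesis using assms(1) that unfolding up_set_def climb_region_def by auto
next
  case 2
  then show ?thesis using assms(1) that unfolding up_set_def climb_region_def
    by (auto simp: abs_minus_commute)
qed

lemma down_setE:
  assumes "(x, y) \<in> down_set p q" "p \<noteq> q"
  obtains "\<bar>x - q\<bar> \<le> 1/8" "0 \<le> y" "y \<le> gap p q + 1/4"
  | "min p q - 1/8 \<le> x" "x \<le> max p q + 1/8" "y = gap p q + 1/4"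
  using assms(2)
proof (cases rule: dirn_cases)
  case 1
  then show ?thesis using assms(1) that unfolding down_set_def descend_region_def by auto
next
  case 2
  then show ?thesis using assms(1) that unfolding down_set_def descend_region_def
    by (auto simp: abs_minus_commute)
qed

text \<open>The first case is a strip to the left of an end point v. Its last fact records that the
  wall beside the tail, on the side of the head, ends at height \<open>gap p q - 1/2\<close>: the
  orbit crosses above it.\<close>

lemma right_setE:
  assumes "(x, y) \<in> right_set p q" "p \<noteq> q"
  obtains v where "v = p \<or> v = q" "v - 1/4 \<le> x" "x \<le> v - 1/8" "0 \<le> y" "y \<le> gap p q + 1/4"
      "v = p \<Longrightarrow> q < p \<Longrightarrow> y \<le> gap p q - 1/2"
  | "p < q" "p - 1/8 \<le> x" "x \<le> q - 1/4" "gap p q - 1/4 \<le> y" "y \<le> gap p q + 1/4"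
  using assms(2)
proof (cases rule: dirn_cases)
  case 1
  then show ?thesis using assms(1) that(1)[of p] that(1)[of q] that(2)
    unfolding right_set_def forward_region_def by auto
next
  case 2
  then show ?thesis using assms(1) that(1)[of p] that(1)[of q]
    unfolding right_set_def backward_region_def by auto
qed

lemma left_setE:
  assumes "(x, y) \<in> left_set p q" "p \<noteq> q"
  obtains v where "v = p \<or> v = q" "v + 1/8 \<le> x" "x \<le> v + 1/4" "0 \<le> y" "y \<le> gap p q + 1/4"
      "v = p \<Longrightarrow> p < q \<Longrightarrow> y \<le> gap p q - 1/2"
  | "q < p" "q + 1/4 \<le> x" "x \<le> p + 1/8" "gap p q - 1/4 \<le> y" "y \<le> gap p q + 1/4"
  using assms(2)
proof (cases rule: dirn_cases)
  case 1
  then show ?thesis using assms(1) that(1)[of p] that(1)[of q]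
    unfolding left_set_def backward_region_def by auto
next
  case 2
  then show ?thesis using assms(1) that(1)[of p] that(1)[of q] that(2)
    unfolding left_set_def forward_region_def by auto
qed

text \<open>
  In the next two lemmas \<open>(x, y)\<close> and \<open>(x, y')\<close> are the coordinates of one point relative to the
  half-planes of two edges; \<open>y = y' = 0\<close> if these half-planes differ.
\<close>

lemma up_down_disjoint:
  fixes x y y' :: real
  assumes c: "compatible s p q p' q'" and s: "s \<and> y = y' \<or> y = 0 \<and> y' = 0"
    and up: "(x, y) \<in> up_set p q" and down: "(x, y') \<in> down_set p' q'"
  shows False
proof -
  have ne: "p \<noteq> q" "p' \<noteq> q'" "p \<noteq> q'" and n: "gap p q \<ge> 1" "gap p' q' \<ge> 1"
    using c by (auto simp: compatible_def)
  show False using up ne(1)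
  proof (cases rule: up_setE)
    case a: 1
    show False using down ne(2)
    proof (cases rule: down_setE)
      case 1
      then show False using a ne(3) by linarith
    next
      \<comment> \<open>A ceiling of the second edge over the tail p: then p is interior to that
        edge, whose ceiling is higher than the column over p by more than 1.\<close>
      case d: 2
      then have "s" "y = y'" using s n by auto
      then have "p \<noteq> p'" using c a d by (auto simp: compatible_def)
      moreover have "min p' q' \<le> p" "p \<le> max p' q'" using a d by linarith+
      ultimately have "min p' q' < p" "p < max p' q'" using ne by linarith+
      then have "\<bar>q - p\<bar> \<le> \<bar>q' - p'\<bar> - 1"
        using inner_vertex_span[of p' q' p q p] c \<open>s\<close> compatible_commute by auto
      then show False using a d \<open>y = y'\<close> by linarith
    qed
  next
    \<comment> \<open>The floor of the first edge. A sink column below it belongs to a shorter inner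
      edge and ends at \<open>gap p q - 3/4\<close> or lower; the sink q itself is at distance at
      least 1/4 from the floor.\<close>
    case b: 2
    have "s" "y = y'" using s n b by auto
    show False using down ne(2)
    proof (cases rule: down_setE)
      case c: 1
      then have "q' \<noteq> q" using b by auto
      moreover have "min p q \<le> q'" "q' \<le> max p q" using b c by linarith+
      ultimately have "min p q < q'" "q' < max p q" using ne by linarith+
      then have "\<bar>q' - p'\<bar> \<le> \<bar>q - p\<bar> - 1"
        using inner_vertex_span[of p q p' q' q'] assms(1) \<open>s\<close> by auto
      then show False using b c \<open>y = y'\<close> by linarith
    next
      \<comment> \<open>A floor strip and a ceiling could only meet if two integer spans differed by
        an amount between 1/2 and 3/4.\<close>
      case 2
      then have "\<bar>q' - p'\<bar> < \<bar>q - p\<bar>" "\<bar>q - p\<bar> < \<bar>q' - p'\<bar> + 1" using b \<open>y = y'\<close> by linarith+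
      then show False by simp
    qed
  qed
qed

lemma right_left_disjoint:
  fixes x y y' :: real
  assumes c: "compatible s p q p' q'" and s: "s \<and> y = y' \<or> y = 0 \<and> y' = 0"
    and right: "(x, y) \<in> right_set p q" and left: "(x, y') \<in> left_set p' q'"
  shows False
proof -
  have ne: "p \<noteq> q" "p' \<noteq> q'" "p \<noteq> q'" "p' \<noteq> q" and n: "gap p q \<ge> 1" "gap p' q' \<ge> 1"
    using c by (auto simp: compatible_def)
  show False using right ne(1)
  proof (cases rule: right_setE)
    case r: (1 v)
    show False using left ne(2)
    proof (cases rule: left_setE)
      case (1 w)
      then have "w < v" "v < w + 1" using r by linarith+
      then show False by simp
    next
      case l: 2
      have "s" "y = y'" using s n l by auto
      have "q' < v" "v \<le> p'" using r l by linarith+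
      show False
      proof (cases "v = p'")
        case True
        \<comment> \<open>Both edges leave the same vertex in the same half-plane, so their ends
          agree, and the wall beside the tail stays below the crossing.\<close>
        then have "v = p" using r(1) ne by auto
        then have "p = p'" "q = q'" using True c \<open>s\<close> by (auto simp: compatible_def)
        then show False using r(6) \<open>v = p\<close> l \<open>y = y'\<close> by auto
      next
        case False
        then have "\<bar>q - p\<bar> \<le> \<bar>q' - p'\<bar> - 1"
          using inner_vertex_span[of p' q' p q v] c \<open>s\<close> compatible_commute \<open>q' < v\<close> \<open>v \<le> p'\<close> r(1) by auto
        then show False using r l \<open>y = y'\<close> by linarith
      qed
    qed
  next
    case r: 2
    have "s" "y = y'" using s n r by auto
    show False using left ne(2)
    proof (cases rule: left_setE)
      case l: (1 v)
      have "p \<le> v" "v < q" using r l by linarith+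
      show False
      proof (cases "v = p")
        case True
        then have "v = p'" using l(1) ne by auto
        then have "p = p'" "q = q'" using True c \<open>s\<close> by (auto simp: compatible_def)
        then show False using l(6) \<open>v = p'\<close> r \<open>y = y'\<close> by auto
      next
        case False
        then have "\<bar>q' - p'\<bar> \<le> \<bar>q - p\<bar> - 1"
          using inner_vertex_span[of p q p' q' v] c \<open>s\<close> \<open>p \<le> v\<close> \<open>v < q\<close> l(1) by auto
        then show False using r l \<open>y = y'\<close> by linarith
      qed
    next
      \<comment> \<open>Opposite crossings with a common point have equal integer heights, hence
        equal spans. Being nested they would coincide with reversed ends, and otherwise they would
        abut at a common tail; \<open>compatible\<close> excludes both.\<close>
      case l: 2
      have "\<bar>q - p\<bar> = \<bar>q' - p'\<bar>" using r l \<open>y = y'\<close> by linarith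
      moreover have "p \<le> p'" "q' < q" using r l by linarith+
      ultimately show False using c \<open>s\<close> r(1) l(1) unfolding compatible_def by (auto simp: min_def max_def)
    qed
  qed
qed

section \<open>The field of a page\<close>

lemma closed_pull:
  fixes S :: "(real \<times> real) set" and a b c :: real
  assumes "closed S"
  shows "closed {z. (a * (fst z - b), c * snd z) \<in> S}"
proof -
  have "closed ((\<lambda>z. (a * (fst z - b), c * snd z)) -` S)"
    by (intro closed_vimage assms continuous_intros)
  then show ?thesis by (simp add: vimage_def)
qed

text \<open>A continuous separating function has the right values but need not be smooth; a
  polynomial uniformly close to it on a compact set keeps the inequalities up to \<epsilon>.\<close>

lemma Urysohn_polynomial:
  fixes S T K :: "(real \<times> real) set"
  assumes "closed S" "closed T" "S \<inter> T = {}" "compact K" "S \<subseteq> K" "T \<subseteq> K" "0 < \<epsilon>"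
  obtains f where "real_polynomial_function f" "\<And>z. z \<in> S \<Longrightarrow> f z > a - \<epsilon>" "\<And>z. z \<in> T \<Longrightarrow> f z < b + \<epsilon>"
proof -
  obtain u :: "real \<times> real \<Rightarrow> real" where u: "continuous_on UNIV u" "\<And>z. z \<in> S \<Longrightarrow> u z = a" "\<And>z. z \<in> T \<Longrightarrow> u z = b"
    using Urysohn[OF assms(1-3), of a b] by metis
  obtain f where f: "real_polynomial_function f" "\<And>z. z \<in> K \<Longrightarrow> \<bar>u z - f z\<bar> < \<epsilon>"
    using Stone_Weierstrass_real_polynomial_function[OF assms(4) continuous_on_subset[OF u(1)] assms(7)] by auto
  show ?thesis
  proof (rule that[OF f(1)])
    fix z assume "z \<in> S"
    then show "f z > a - \<epsilon>" using f(2)[of z] u(2)[of z] assms(5) by (auto simp: abs_less_iff)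
  next
    fix z assume "z \<in> T"
    then show "f z < b + \<epsilon>" using f(2)[of z] u(3)[of z] assms(6) by (auto simp: abs_less_iff)
  qed
qed

text \<open>Serves two purposes: the first bound supplies the compact set for the polynomial
  approximation, and nonnegativity of y confines each route to its closed half-plane.\<close>

lemma sets_bounded:
  assumes "p \<noteq> q" "(x, y) \<in> up_set p q \<union> down_set p q \<union> (right_set p q \<union> left_set p q)"
  shows "\<bar>x - p\<bar> + \<bar>y\<bar> \<le> 2 * gap p q + 1" "0 \<le> y"
proof -
  consider "(x, y) \<in> up_set p q" | "(x, y) \<in> down_set p q" | "(x, y) \<in> right_set p q" | "(x, y) \<in> left_set p q"
    using assms(2) by blast
  then have "\<bar>x - p\<bar> \<le> gap p q + 1/4 \<and> 0 \<le> y \<and> y \<le> gap p q + 1/4"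
  proof cases
    case 1
    then show ?thesis using assms(1) by (cases rule: up_setE; linarith)
  next
    case 2
    then show ?thesis using assms(1) by (cases rule: down_setE; linarith)
  next
    case 3
    then show ?thesis using assms(1) by (cases rule: right_setE; linarith)
  next
    case 4
    then show ?thesis using assms(1) by (cases rule: left_setE; linarith)
  qed
  then have "\<bar>x - p\<bar> \<le> gap p q + 1/4" "0 \<le> y" "y \<le> gap p q + 1/4" by blast+
  moreover have "a + \<bar>y\<bar> \<le> 2 * g + 1" if "a \<le> g + 1/4" "0 \<le> y" "y \<le> g + 1/4" for a g :: real
    using that by linarith
  ultimately show "\<bar>x - p\<bar> + \<bar>y\<bar> \<le> 2 * gap p q + 1" "0 \<le> y" by blast+
qed

lemma page_fields_exist:
  fixes E :: "'e set" and P Q :: "'e \<Rightarrow> int" and side :: "'e \<Rightarrow> real"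
  assumes "finite E"
    and compat: "\<And>e e'. e \<in> E \<Longrightarrow> e' \<in> E \<Longrightarrow> compatible (side e = side e') (P e) (Q e) (P e') (Q e')"
    and side: "\<And>e. e \<in> E \<Longrightarrow> side e = 1 \<or> side e = - 1"
  obtains \<alpha> \<beta> :: "real \<times> real \<Rightarrow> real"
  where "real_polynomial_function \<alpha>" "real_polynomial_function \<beta>"
    "\<And>e x y. e \<in> E \<Longrightarrow> (x, side e * y) \<in> up_set (P e) (Q e) \<Longrightarrow> \<beta> (x, y) \<ge> 1/2"
    "\<And>e x y. e \<in> E \<Longrightarrow> (x, side e * y) \<in> down_set (P e) (Q e) \<Longrightarrow> \<beta> (x, y) \<le> - 1/2"
    "\<And>e x y. e \<in> E \<Longrightarrow> (x, side e * y) \<in> right_set (P e) (Q e) \<Longrightarrow> \<alpha> (x, y) \<ge> 3"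
    "\<And>e x y. e \<in> E \<Longrightarrow> (x, side e * y) \<in> left_set (P e) (Q e) \<Longrightarrow> \<alpha> (x, y) \<le> - 3"
proof -
  define pull where "pull S = (\<Union>e\<in>E. {z. (fst z, side e * snd z) \<in> S (P e) (Q e)})"
    for S :: "int \<Rightarrow> int \<Rightarrow> (real \<times> real) set"
  have closed: "closed (pull up_set)" "closed (pull down_set)" "closed (pull right_set)" "closed (pull left_set)"
    unfolding pull_def up_set_def down_set_def right_set_def left_set_def case_prod_unfold
    by (intro closed_UN assms(1) ballI; simp add: closed_pull closed_regions)+
  have ne: "P e \<noteq> Q e" if "e \<in> E" for e using compat[OF that that] by (simp add: compatible_def)
  define K where "K = (\<Union>e\<in>E. cball (real_of_int (P e), 0 :: real) (2 * gap (P e) (Q e) + 1))"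
  have "compact K" unfolding K_def by (intro compact_UN assms(1)) auto
  have sub: "pull S \<subseteq> K" if "S \<in> {up_set, down_set, right_set, left_set}" for S
  proof
    fix z assume "z \<in> pull S"
    then obtain e where e: "e \<in> E" "(fst z, side e * snd z) \<in> S (P e) (Q e)" by (auto simp: pull_def)
    have "\<bar>fst z - P e\<bar> + \<bar>side e * snd z\<bar> \<le> 2 * gap (P e) (Q e) + 1"
      using e that by (intro sets_bounded(1)[OF ne[OF e(1)]]) auto
    moreover have "\<bar>side e * snd z\<bar> = \<bar>snd z\<bar>" using side[OF e(1)] by auto
    moreover have dist_le: "dist (real_of_int (P e), 0) z \<le> dist (real_of_int (P e)) (fst z) + dist 0 (snd z)"
      unfolding dist_prod_def fst_conv snd_conv by (rule sqrt_sum_squares_le_sum) auto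
    moreover have "dist (real_of_int (P e)) (fst z) + dist 0 (snd z) = \<bar>fst z - P e\<bar> + \<bar>snd z\<bar>"
      by (simp add: dist_real_def abs_minus_commute)
    ultimately show "z \<in> K" using e(1) unfolding K_def by force
  qed
  \<comment> \<open>Routes in different half-planes can only meet on the diagonal.\<close>
  have pull_eq: "side e = side e' \<and> side e * y = side e' * y \<or> side e * y = 0 \<and> side e' * y = 0"
    if "e \<in> E" "e' \<in> E" "0 \<le> side e * y" "0 \<le> side e' * y" for e e' y
    using side[OF that(1)] side[OF that(2)] that(3,4) by auto
  have disj1: "pull up_set \<inter> pull down_set = {}"
  proof (rule ccontr)
    assume "pull up_set \<inter> pull down_set \<noteq> {}"
    then obtain x y e e' where e: "e \<in> E" "e' \<in> E"
      and m: "(x, side e * y) \<in> up_set (P e) (Q e)" "(x, side e' * y) \<in> down_set (P e') (Q e')"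
      by (force simp: pull_def)
    show False
      by (rule up_down_disjoint[OF compat[OF e] pull_eq[OF e] m])
         (use m e sets_bounded(2)[OF ne, of e x "side e * y"] sets_bounded(2)[OF ne, of e' x "side e' * y"] in auto)
  qed
  have disj2: "pull right_set \<inter> pull left_set = {}"
  proof (rule ccontr)
    assume "pull right_set \<inter> pull left_set \<noteq> {}"
    then obtain x y e e' where e: "e \<in> E" "e' \<in> E"
      and m: "(x, side e * y) \<in> right_set (P e) (Q e)" "(x, side e' * y) \<in> left_set (P e') (Q e')"
      by (force simp: pull_def)
    show False
      by (rule right_left_disjoint[OF compat[OF e] pull_eq[OF e] m])
         (use m e sets_bounded(2)[OF ne, of e x "side e * y"] sets_bounded(2)[OF ne, of e' x "side e' * y"] in auto)
  qed
  \<comment> \<open>Target values 1 and -1 with error 1/2 leave rate 1/2 for \<beta>; below, 4 and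
    -4 with error 1 leave 3 for \<alpha>, enough to beat the sine at height 3/4.\<close>
  obtain \<beta> where \<beta>: "real_polynomial_function \<beta>" "\<And>z. z \<in> pull up_set \<Longrightarrow> \<beta> z > 1 - 1/2"
    "\<And>z. z \<in> pull down_set \<Longrightarrow> \<beta> z < - 1 + 1/2"
    by (rule Urysohn_polynomial[OF closed(1,2) disj1 \<open>compact K\<close>, of "1/2" 1 "- 1"]) (use sub in auto)
  obtain \<alpha> where \<alpha>: "real_polynomial_function \<alpha>" "\<And>z. z \<in> pull right_set \<Longrightarrow> \<alpha> z > 4 - 1"
    "\<And>z. z \<in> pull left_set \<Longrightarrow> \<alpha> z < - 4 + 1"
    by (rule Urysohn_polynomial[OF closed(3,4) disj2 \<open>compact K\<close>, of 1 4 "- 4"]) (use sub in auto)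
  have pull: "(x, y) \<in> pull S" if "e \<in> E" "(x, side e * y) \<in> S (P e) (Q e)" for e x y S
    using that by (auto simp: pull_def)
  show ?thesis
  proof (rule that[OF \<alpha>(1) \<beta>(1)])
    fix e x y assume e: "e \<in> E"
    show "(x, side e * y) \<in> up_set (P e) (Q e) \<Longrightarrow> \<beta> (x, y) \<ge> 1/2"
      using \<beta>(2)[OF pull[OF e, of x y up_set]] by simp
    show "(x, side e * y) \<in> down_set (P e) (Q e) \<Longrightarrow> \<beta> (x, y) \<le> - 1/2"
      using \<beta>(3)[OF pull[OF e, of x y down_set]] by simp
    show "(x, side e * y) \<in> right_set (P e) (Q e) \<Longrightarrow> \<alpha> (x, y) \<ge> 3"
      using \<alpha>(2)[OF pull[OF e, of x y right_set]] by simp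
    show "(x, side e * y) \<in> left_set (P e) (Q e) \<Longrightarrow> \<alpha> (x, y) \<le> - 3"
      using \<alpha>(3)[OF pull[OF e, of x y left_set]] by simp
  qed
qed

section \<open>Estimates for the sine and the perturbed page\<close>

lemma half_le_sin:
  assumes "1/8 \<le> t" "t \<le> 1/4"
  shows "1/2 \<le> sin (2 * pi * t)"
proof -
  have "pi / 6 \<le> 2 * pi * t" "2 * pi * t \<le> pi / 2" using assms by simp_all
  then show ?thesis using sin_monotone_2pi_le[of "pi/6" "2 * pi * t"] sin_30 by simp
qed

lemma sin_shift_int: "sin (2 * pi * (real_of_int v + t)) = sin (2 * pi * t)"
  by (simp add: distrib_left sin_add)

text \<open>The cosine is at least 1/2 on this interval, so the derivative is at least pi, which
  exceeds 3.\<close>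

lemma sin_increase:
  assumes "- 1/8 \<le> a" "a \<le> b" "b \<le> 1/8"
  shows "3 * (b - a) \<le> sin (2 * pi * b) - sin (2 * pi * a)"
proof -
  have "sin (2 * pi * a) - 3 * a \<le> sin (2 * pi * b) - 3 * b"
  proof (rule DERIV_nonneg_imp_nondecreasing[OF assms(2)], intro exI conjI)
    fix t assume t: "a \<le> t" "t \<le> b"
    show "((\<lambda>t. sin (2 * pi * t) - 3 * t) has_real_derivative 2 * pi * cos (2 * pi * t) - 3) (at t)"
      by (auto intro!: derivative_eq_intros)
    have "\<bar>t\<bar> \<le> 1/8" using t assms by linarith
    then have "\<bar>2 * pi * t\<bar> \<le> pi / 3" by (simp add: abs_mult)
    then have "cos (pi / 3) \<le> cos \<bar>2 * pi * t\<bar>" by (intro cos_monotone_0_pi_le) auto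
    then have "1/2 \<le> cos (2 * pi * t)" by (simp add: cos_60)
    then have "pi * 1 \<le> pi * (2 * cos (2 * pi * t))" by (intro mult_left_mono) auto
    moreover have "pi * (2 * cos (2 * pi * t)) = 2 * pi * cos (2 * pi * t)" by simp
    ultimately show "0 \<le> 2 * pi * cos (2 * pi * t) - 3" using pi_gt3 by linarith
  qed
  then show ?thesis by simp
qed

text \<open>Here \<open>(h, k)\<close> is a perturbation of the field of the page.\<close>

lemma page_connection:
  fixes \<alpha> \<beta> :: "real \<times> real \<Rightarrow> real" and h k :: "real \<Rightarrow> real \<Rightarrow> real" and \<sigma> \<xi> \<eta> :: real
  defines "F \<equiv> \<lambda>x y. - sin (2 * pi * x) + y\<^sup>2 * \<alpha> (x, y) + h x y"
    and "H \<equiv> \<lambda>x y. y * \<beta> (x, y) + k x y"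
  assumes ne: "p \<noteq> q" and \<sigma>: "\<sigma> = 1 \<or> \<sigma> = - 1"
    and \<alpha>: "real_polynomial_function \<alpha>" and \<beta>: "real_polynomial_function \<beta>"
    and up: "\<And>x y. (x, \<sigma> * y) \<in> up_set p q \<Longrightarrow> \<beta> (x, y) \<ge> 1/2"
    and down: "\<And>x y. (x, \<sigma> * y) \<in> down_set p q \<Longrightarrow> \<beta> (x, y) \<le> - 1/2"
    and right: "\<And>x y. (x, \<sigma> * y) \<in> right_set p q \<Longrightarrow> \<alpha> (x, y) \<ge> 3"
    and left: "\<And>x y. (x, \<sigma> * y) \<in> left_set p q \<Longrightarrow> \<alpha> (x, y) \<le> - 3"
    and h: "\<And>x y. \<bar>h x y\<bar> \<le> 1/8" and k: "\<And>x y. \<bar>k x y\<bar> \<le> \<bar>y\<bar> / 4"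
    and lip_h: "\<And>x y x' y'. \<bar>h x y - h x' y'\<bar> \<le> C * (\<bar>x - x'\<bar> + \<bar>y - y'\<bar>)"
    and lip_k: "\<And>x y x' y'. \<bar>k x y - k x' y'\<bar> \<le> C * (\<bar>x - x'\<bar> + \<bar>y - y'\<bar>)"
    and \<xi>: "\<bar>\<xi> - p\<bar> \<le> 1/8" "\<And>x. \<bar>x - p\<bar> \<le> 1/8 \<Longrightarrow> F x 0 * (x - \<xi>) \<le> - (x - \<xi>)\<^sup>2"
    and \<eta>: "\<bar>\<eta> - q\<bar> \<le> 1/8" "\<And>x. \<bar>x - q\<bar> \<le> 1/8 \<Longrightarrow> F x 0 * (x - \<eta>) \<le> - (x - \<eta>)\<^sup>2"
  obtains x y where "\<And>t. (x has_real_derivative F (x t) (y t)) (at t)"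
    "\<And>t. (y has_real_derivative H (x t) (y t)) (at t)" "\<And>t. \<sigma> * y t > 0"
    "\<And>t. \<bar>y t\<bar> < 1/2 \<Longrightarrow> \<bar>x t - p\<bar> \<le> 1/4 \<or> \<bar>x t - q\<bar> \<le> 1/4"
    "(x \<longlongrightarrow> \<xi>) at_bot" "(y \<longlongrightarrow> 0) at_bot" "(x \<longlongrightarrow> \<eta>) at_top" "(y \<longlongrightarrow> 0) at_top"
proof -
  define d n where "d = dirn p q" and "n = gap p q"
  have dir: "d = 1 \<and> p < q \<or> d = - 1 \<and> q < p"
    unfolding d_def by (rule dirn_cases[OF ne]) auto
  have d: "d = 1 \<or> d = - 1" and dn: "d * n = q - p"
    using dir by (auto simp: n_def)
  have dd: "d * d = 1" "\<sigma> * \<sigma> = 1" using d \<sigma> by auto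
  have n: "n \<ge> 1" using ne by (simp add: n_def)
  define M where "M = \<bar>real_of_int p\<bar> + n + 1"
  have M: "M \<ge> 0" using n by (simp add: M_def)
  have F_right: "F x y \<ge> 1/4" if r: "(x, \<sigma> * y) \<in> right_set p q" for x y
  proof -
    have sin_le: "sin (2 * pi * x) \<le> 1" by simp
    have al: "y\<^sup>2 * \<alpha> (x, y) \<ge> y\<^sup>2 * 3" using right[OF r] by (intro mult_left_mono) auto
    \<comment> \<open>Beside a vertex the sine alone contributes 1/2. On the crossing strip the
      height is at least 3/4, and 3 * 9/16 - 1 exceeds 1/2. The perturbation of size 1/8 then leaves
      at least 1/4.\<close>
    from r ne have "- sin (2 * pi * x) + y\<^sup>2 * 3 \<ge> 1/2"
    proof (cases rule: right_setE)
      case (1 v)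
      have "1/2 \<le> sin (2 * pi * (v - x))" using 1 by (intro half_le_sin) auto
      also have "\<dots> = sin (2 * pi * (real_of_int v + - x))" by simp
      also have "\<dots> = - sin (2 * pi * x)" unfolding sin_shift_int by simp
      finally show ?thesis using zero_le_power2[of y] by linarith
    next
      case 2
      then have "3/4 \<le> \<bar>y\<bar>" using n \<sigma> by (auto simp: n_def)
      then have "(3/4)\<^sup>2 \<le> \<bar>y\<bar>\<^sup>2" by (intro power_mono) auto
      then have "9/16 \<le> y\<^sup>2" by (simp add: power_divide)
      then show ?thesis using sin_le by linarith
    qed
    then show ?thesis using al h[of x y] unfolding F_def by linarith
  qed
  have F_left: "F x y \<le> - 1/4" if r: "(x, \<sigma> * y) \<in> left_set p q" for x y
  proof -
    have sin_ge: "sin (2 * pi * x) \<ge> - 1" by simp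
    have al: "y\<^sup>2 * \<alpha> (x, y) \<le> y\<^sup>2 * (- 3)" using left[OF r] by (intro mult_left_mono) auto
    from r ne have "- sin (2 * pi * x) + y\<^sup>2 * (- 3) \<le> - 1/2"
    proof (cases rule: left_setE)
      case (1 v)
      have "1/2 \<le> sin (2 * pi * (x - v))" using 1 by (intro half_le_sin) auto
      also have "\<dots> = sin (2 * pi * (real_of_int v + (x - v)))" unfolding sin_shift_int ..
      also have "\<dots> = sin (2 * pi * x)" by simp
      finally show ?thesis using zero_le_power2[of y] by linarith
    next
      case 2
      then have "3/4 \<le> \<bar>y\<bar>" using n \<sigma> by (auto simp: n_def)
      then have "(3/4)\<^sup>2 \<le> \<bar>y\<bar>\<^sup>2" by (intro power_mono) auto
      then have "9/16 \<le> y\<^sup>2" by (simp add: power_divide)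
      then show ?thesis using sin_ge by linarith
    qed
    then show ?thesis using al h[of x y] unfolding F_def by linarith
  qed
  have k': "\<bar>\<sigma> * k x (\<sigma> * Y)\<bar> \<le> \<bar>Y\<bar> / 4" for x Y using k[of x "\<sigma> * Y"] \<sigma> by auto
  \<comment> \<open>The rate 1/2 of \<beta> loses at most 1/4 to the perturbation; the remaining 1/4
    is the rate b of the channel.\<close>
  have H_up: "\<sigma> * H x (\<sigma> * Y) \<ge> Y / 4" if r: "(x, Y) \<in> up_set p q" and "Y \<ge> 0" for x Y
  proof -
    have "\<beta> (x, \<sigma> * Y) \<ge> 1/2" using up[of x "\<sigma> * Y"] r dd(2) by (simp flip: mult.assoc)
    then have "Y * \<beta> (x, \<sigma> * Y) \<ge> Y * (1/2)" using that by (intro mult_left_mono) auto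
    moreover have "\<sigma> * H x (\<sigma> * Y) = Y * \<beta> (x, \<sigma> * Y) + \<sigma> * k x (\<sigma> * Y)"
      using \<sigma> by (auto simp: H_def algebra_simps)
    ultimately show ?thesis using k'[of x Y] that(2) by linarith
  qed
  have H_down: "\<sigma> * H x (\<sigma> * Y) \<le> - (Y / 4)" if r: "(x, Y) \<in> down_set p q" and "Y \<ge> 0" for x Y
  proof -
    have "\<beta> (x, \<sigma> * Y) \<le> - 1/2" using down[of x "\<sigma> * Y"] r dd(2) by (simp flip: mult.assoc)
    then have "Y * \<beta> (x, \<sigma> * Y) \<le> Y * (- 1/2)" using that by (intro mult_left_mono) auto
    moreover have "\<sigma> * H x (\<sigma> * Y) = Y * \<beta> (x, \<sigma> * Y) + \<sigma> * k x (\<sigma> * Y)"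
      using \<sigma> by (auto simp: H_def algebra_simps)
    ultimately show ?thesis using k'[of x Y] that(2) by linarith
  qed
  text \<open>Clamping to a box makes the field globally Lipschitz; the connecting orbit stays in the box.\<close>
  define clamp where "clamp r = max (- 1) (min (n + 1) r)" for r
  have clamp: "\<bar>clamp r - clamp r'\<bar> \<le> \<bar>r - r'\<bar>" "\<bar>clamp r\<bar> \<le> n + 1"
    "- 1 \<le> r \<Longrightarrow> r \<le> n + 1 \<Longrightarrow> clamp r = r" for r r'
    using n by (auto simp: clamp_def min_def max_def)
  define A where "A X Y = d * F (p + d * clamp X) (\<sigma> * clamp Y)" for X Y
  define G where "G X Y = \<sigma> * H (p + d * clamp X) (\<sigma> * clamp Y)" for X Y
  have unclamped: "A X Y = d * F (p + d * X) (\<sigma> * Y)" "G X Y = \<sigma> * H (p + d * X) (\<sigma> * Y)"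
    if "- 1 \<le> X" "X \<le> n + 1" "- 1 \<le> Y" "Y \<le> n + 1" for X Y
    using that by (simp_all add: A_def G_def clamp)
  have in_box: "\<bar>p + d * clamp X\<bar> \<le> M" "\<bar>\<sigma> * clamp Y\<bar> \<le> M" for X Y
    using d \<sigma> clamp(2)[of X] clamp(2)[of Y] by (auto simp: M_def)
  have box_diff: "\<bar>(p + d * clamp X) - (p + d * clamp X')\<bar> \<le> \<bar>X - X'\<bar>"
    "\<bar>\<sigma> * clamp Y - \<sigma> * clamp Y'\<bar> \<le> \<bar>Y - Y'\<bar>" for X X' Y Y'
    using d \<sigma> clamp(1)[of X X'] clamp(1)[of Y Y'] by auto
  have sq: "real_polynomial_function (\<lambda>z. (snd z * snd z) * \<alpha> z)" "real_polynomial_function (\<lambda>z. snd z * \<beta> z)"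
    by (intro real_polynomial_function.intros \<alpha> \<beta> bounded_linear_snd)+
  obtain L1 L2 where L12: "L1 \<ge> 0" "L2 \<ge> 0"
    and L1: "\<And>x y x' y'. \<bar>x\<bar> \<le> M \<Longrightarrow> \<bar>y\<bar> \<le> M \<Longrightarrow> \<bar>x'\<bar> \<le> M \<Longrightarrow> \<bar>y'\<bar> \<le> M \<Longrightarrow>
      \<bar>(y * y) * \<alpha> (x, y) - (y' * y') * \<alpha> (x', y')\<bar> \<le> L1 * (\<bar>x - x'\<bar> + \<bar>y - y'\<bar>)"
    and L2: "\<And>x y x' y'. \<bar>x\<bar> \<le> M \<Longrightarrow> \<bar>y\<bar> \<le> M \<Longrightarrow> \<bar>x'\<bar> \<le> M \<Longrightarrow> \<bar>y'\<bar> \<le> M \<Longrightarrow>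
      \<bar>y * \<beta> (x, y) - y' * \<beta> (x', y')\<bar> \<le> L2 * (\<bar>x - x'\<bar> + \<bar>y - y'\<bar>)"
    using real_polynomial_lipschitz_on_box[OF sq(1) M] real_polynomial_lipschitz_on_box[OF sq(2) M]
    unfolding snd_conv by metis
  have sin_lip: "\<bar>sin (2 * pi * x) - sin (2 * pi * x')\<bar> \<le> 2 * pi * \<bar>x - x'\<bar>" for x x'
  proof -
    have "norm (sin (2 * pi * x) - sin (2 * pi * x')) \<le> 2 * pi * norm (x - x')"
    proof (rule field_differentiable_bound[of UNIV _ "\<lambda>t. 2 * pi * cos (2 * pi * t)"])
      show "((\<lambda>t. sin (2 * pi * t)) has_field_derivative 2 * pi * cos (2 * pi * t)) (at t within UNIV)" for t
        by (auto intro!: derivative_eq_intros)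
      show "norm (2 * pi * cos (2 * pi * t)) \<le> 2 * pi" for t
        using abs_cos_le_one[of "2 * pi * t"] by (simp add: abs_mult mult_le_cancel_left1)
    qed auto
    then show ?thesis by simp
  qed
  have C: "C \<ge> 0" using lip_h[of 0 0 1 0] by simp
  define L where "L = L1 + L2 + 2 * pi + 2 * C"
  have L: "L > 0" using L12 C pi_gt_zero unfolding L_def by linarith
  have lipF: "\<bar>F x y - F x' y'\<bar> \<le> L * (\<bar>x - x'\<bar> + \<bar>y - y'\<bar>)"
    and lipH: "\<bar>H x y - H x' y'\<bar> \<le> L * (\<bar>x - x'\<bar> + \<bar>y - y'\<bar>)"
    if b: "\<bar>x\<bar> \<le> M" "\<bar>y\<bar> \<le> M" "\<bar>x'\<bar> \<le> M" "\<bar>y'\<bar> \<le> M" for x y x' y'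
  proof -
    let ?D = "\<bar>x - x'\<bar> + \<bar>y - y'\<bar>"
    have pos: "2 * pi * \<bar>x - x'\<bar> \<le> 2 * pi * ?D" "0 \<le> 2 * pi * ?D" "0 \<le> C * ?D" "0 \<le> L1 * ?D" "0 \<le> L2 * ?D"
      using L12 C by (auto intro!: mult_left_mono)
    have L_eq: "L * ?D = L1 * ?D + L2 * ?D + 2 * pi * ?D + 2 * (C * ?D)" by (simp add: L_def algebra_simps)
    have tri: "\<bar>b - a + c\<bar> \<le> \<bar>a\<bar> + \<bar>b\<bar> + \<bar>c\<bar>" for a b c :: real by linarith
    have "F x y - F x' y' = ((y * y) * \<alpha> (x, y) - (y' * y') * \<alpha> (x', y')) -
        (sin (2 * pi * x) - sin (2 * pi * x')) + (h x y - h x' y')"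
      by (simp add: F_def power2_eq_square)
    then have "\<bar>F x y - F x' y'\<bar> \<le> 2 * pi * \<bar>x - x'\<bar> + L1 * ?D + C * ?D"
      using order_trans[OF tri add_mono[OF add_mono[OF sin_lip L1[OF b]] lip_h]] by simp
    then show "\<bar>F x y - F x' y'\<bar> \<le> L * ?D" using pos L_eq by linarith
    have "H x y - H x' y' = (y * \<beta> (x, y) - y' * \<beta> (x', y')) - 0 + (k x y - k x' y')"
      by (simp add: H_def)
    then have "\<bar>H x y - H x' y'\<bar> \<le> 0 + L2 * ?D + C * ?D"
      using order_trans[OF tri add_mono[OF add_mono[OF _ L2[OF b]] lip_k], of 0 0] by simp
    then show "\<bar>H x y - H x' y'\<bar> \<le> L * ?D" using pos L_eq by linarith
  qed
  have abs_d: "\<bar>d * r\<bar> = \<bar>r\<bar>" for r using d by auto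
  have pull: "d * ((p + d * X) - p) = X" for X using d by auto
  have sets: "(X, Y) \<in> climb_region n \<Longrightarrow> (p + d * X, Y) \<in> up_set p q"
    "(X, Y) \<in> descend_region n \<Longrightarrow> (p + d * X, Y) \<in> down_set p q"
    "(X, Y) \<in> forward_region n \<Longrightarrow> (p + d * X, Y) \<in> (if d = 1 then right_set p q else left_set p q)"
    "(X, Y) \<in> backward_region n \<Longrightarrow> (p + d * X, Y) \<in> (if d = 1 then left_set p q else right_set p q)" for X Y
    using dir pull[of X]
    unfolding up_set_def down_set_def right_set_def left_set_def d_def[symmetric] n_def[symmetric]
    by auto
  have region_box: "- 1 \<le> X \<and> X \<le> n + 1 \<and> 0 \<le> Y \<and> Y \<le> n + 1"
    if "(X, Y) \<in> climb_region n \<union> descend_region n \<union> (forward_region n \<union> backward_region n)" for X Y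
    using that n unfolding region_defs abs_le_iff by auto
  have climb: "G X Y \<ge> 1/4 * Y" if "(X, Y) \<in> climb_region n" for X Y
    using H_up[OF sets(1)[OF that]] region_box[of X Y] unclamped(2)[of X Y] that by auto
  have descend: "G X Y \<le> - (1/4) * Y" if "(X, Y) \<in> descend_region n" for X Y
    using H_down[OF sets(2)[OF that]] region_box[of X Y] unclamped(2)[of X Y] that by auto
  have \<sigma>\<sigma>: "\<sigma> * (\<sigma> * Y) = Y" for Y using dd(2) by (simp flip: mult.assoc)
  have forward: "A X Y \<ge> 1/4" if "(X, Y) \<in> forward_region n" for X Y
    using sets(3)[OF that] F_right[of "p + d * X" "\<sigma> * Y"] F_left[of "p + d * X" "\<sigma> * Y"]
      region_box[of X Y] unclamped(1)[of X Y] that d by (auto simp: \<sigma>\<sigma>)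
  have backward: "A X Y \<le> - (1/4)" if "(X, Y) \<in> backward_region n" for X Y
    using sets(4)[OF that] F_right[of "p + d * X" "\<sigma> * Y"] F_left[of "p + d * X" "\<sigma> * Y"]
      region_box[of X Y] unclamped(1)[of X Y] that d by (auto simp: \<sigma>\<sigma>)
  \<comment> \<open>The contraction rate 1 on the diagonal is weakened to 1/4, the common rate of
    the channel.\<close>
  have contract: "A X 0 * (X - d * (r - p)) \<le> - (1/4) * (X - d * (r - p))\<^sup>2"
    if "F (p + d * X) 0 * (p + d * X - r) \<le> - (p + d * X - r)\<^sup>2" "- 1 \<le> X" "X \<le> n + 1" for X r :: real
  proof -
    have eq: "X - d * (r - p) = d * (p + d * X - r)" using d by auto
    have A: "A X 0 = d * F (p + d * X) 0" using unclamped(1)[of X 0] that n by simp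
    have "A X 0 * (X - d * (r - p)) = F (p + d * X) 0 * (p + d * X - r)"
      unfolding eq A using d by auto
    moreover have "(X - d * (r - p))\<^sup>2 = (p + d * X - r)\<^sup>2"
      unfolding eq using d by (auto simp: power_mult_distrib)
    moreover have "(p + d * X - r)\<^sup>2 \<ge> 0" by simp
    ultimately show ?thesis using that(1) by linarith
  qed
  interpret channel A G n L "1/4" "d * (\<xi> - p)" "d * (\<eta> - p)"
  proof
    fix x y x' y' :: real
    let ?x = "p + d * clamp x" and ?y = "\<sigma> * clamp y" and ?x' = "p + d * clamp x'" and ?y' = "\<sigma> * clamp y'"
    have mono: "L * (\<bar>?x - ?x'\<bar> + \<bar>?y - ?y'\<bar>) \<le> L * (\<bar>x - x'\<bar> + \<bar>y - y'\<bar>)"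
      using L by (intro mult_left_mono add_mono box_diff) auto
    have "\<bar>A x y - A x' y'\<bar> = \<bar>F ?x ?y - F ?x' ?y'\<bar>" using d by (auto simp: A_def abs_minus_commute)
    then show "\<bar>A x y - A x' y'\<bar> \<le> L * (\<bar>x - x'\<bar> + \<bar>y - y'\<bar>)"
      using lipF[of ?x ?y ?x' ?y'] in_box mono by force
    have "\<bar>G x y - G x' y'\<bar> = \<bar>H ?x ?y - H ?x' ?y'\<bar>" using \<sigma> by (auto simp: G_def abs_minus_commute)
    then show "\<bar>G x y - G x' y'\<bar> \<le> L * (\<bar>x - x'\<bar> + \<bar>y - y'\<bar>)"
      using lipH[of ?x ?y ?x' ?y'] in_box mono by force
    show "G x 0 = 0" using k[of "p + d * clamp x" 0] n by (simp add: G_def H_def clamp)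
    show "1/4 * y \<le> G x y" if "\<bar>x\<bar> \<le> 1/8" "0 \<le> y" "y \<le> n - 1/2"
      using that by (intro climb) (auto simp: climb_region_def)
    show "1/4 * y \<le> G x y" if "- 1/8 \<le> x" "x \<le> n - 1/4" "n - 1/2 \<le> y" "y \<le> n - 1/4"
      using that by (intro climb) (auto simp: climb_region_def)
    show "G x y \<le> - (1/4) * y" if "\<bar>x - n\<bar> \<le> 1/8" "0 \<le> y" "y \<le> n + 1/4"
      using that by (intro descend) (auto simp: descend_region_def)
    show "G x (n + 1/4) < 0" if "- 1/8 \<le> x" "x \<le> n + 1/8"
    proof -
      have "(x, n + 1/4) \<in> descend_region n" using that by (simp add: descend_region_def)
      have "- (1/4) * (n + 1/4) < 0" using n by simp
      with descend[OF \<open>(x, n + 1/4) \<in> descend_region n\<close>] show ?thesis by (rule le_less_trans)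
    qed
    show "0 < A (- 1/8) y" if "0 \<le> y" "y \<le> n + 1/4"
      using forward[of "- 1/8" y] that by (auto simp: forward_region_def)
    show "1/4 \<le> A x y" if "- 1/8 \<le> x" "x \<le> n - 1/4" "n - 1/4 \<le> y" "y \<le> n + 1/4"
      using that by (intro forward) (auto simp: forward_region_def)
    show "1/4 \<le> A x y" if "n - 1/4 \<le> x" "x \<le> n - 1/8" "0 \<le> y" "y \<le> n + 1/4"
      using that by (intro forward) (auto simp: forward_region_def)
    show "A (1/8) y < 0" if "0 \<le> y" "y \<le> n - 1/2"
      using backward[of "1/8" y] that by (auto simp: backward_region_def)
    show "A (n + 1/8) y < 0" if "0 \<le> y" "y \<le> n + 1/4"
      using backward[of "n + 1/8" y] that by (auto simp: backward_region_def)
    show "\<bar>d * (\<xi> - p)\<bar> \<le> 1/8" unfolding abs_d by (rule \<xi>(1))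
    have "d * (\<eta> - p) - n = d * (\<eta> - q)" using dn d by auto
    then show "\<bar>d * (\<eta> - p) - n\<bar> \<le> 1/8" using \<eta>(1) by (simp only: abs_d)
    show "A x 0 * (x - d * (\<xi> - p)) \<le> - (1/4) * (x - d * (\<xi> - p))\<^sup>2" if "\<bar>x\<bar> \<le> 1/8"
      using that n abs_d by (intro contract \<xi>(2)) auto
    show "A x 0 * (x - d * (\<eta> - p)) \<le> - (1/4) * (x - d * (\<eta> - p))\<^sup>2" if "\<bar>x - n\<bar> \<le> 1/8"
    proof (intro contract \<eta>(2))
      have "p + d * x - q = d * (x - n)" using dn by (simp add: algebra_simps)
      then show "\<bar>p + d * x - q\<bar> \<le> 1/8" using that by (simp only: abs_d)
    qed (use that[unfolded abs_le_iff] n in auto)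
  qed (use L n in auto)
  obtain X Y where s: "sol X Y"
    and box: "\<And>t. - 1/8 \<le> X t \<and> X t \<le> n + 1/8 \<and> 0 < Y t \<and> Y t \<le> n + 1/4"
    and low: "\<And>t. Y t < 1/2 \<Longrightarrow> \<bar>X t\<bar> \<le> 1/8 \<or> n - 1/4 \<le> X t"
    and lim: "(X \<longlongrightarrow> d * (\<xi> - p)) at_bot" "(Y \<longlongrightarrow> 0) at_bot" "(X \<longlongrightarrow> d * (\<eta> - p)) at_top" "(Y \<longlongrightarrow> 0) at_top"
    by (rule connection) (rule that)
  have inside: "- 1 \<le> X t" "X t \<le> n + 1" "- 1 \<le> Y t" "Y t \<le> n + 1" for t using box[of t] by auto
  define x y where "x t = p + d * X t" and "y t = \<sigma> * Y t" for t
  have "A (X t) (Y t) * d = F (x t) (y t)" "G (X t) (Y t) * \<sigma> = H (x t) (y t)" for t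
    using unclamped[OF inside[of t]] d \<sigma> by (auto simp: x_def y_def)
  then have der: "(x has_real_derivative F (x t) (y t)) (at t)" "(y has_real_derivative H (x t) (y t)) (at t)" for t
    using solD[OF s, of t] unfolding x_def[abs_def] y_def[abs_def]
    by (auto intro!: derivative_eq_intros)
  have side: "\<sigma> * y t > 0" for t using box[of t] by (simp add: y_def \<sigma>\<sigma>)
  have near: "\<bar>x t - p\<bar> \<le> 1/4 \<or> \<bar>x t - q\<bar> \<le> 1/4" if "\<bar>y t\<bar> < 1/2" for t
  proof -
    have "Y t < 1/2" using that box[of t] \<sigma> by (auto simp: y_def)
    from low[OF this] have "\<bar>X t\<bar> \<le> 1/4 \<or> \<bar>X t - n\<bar> \<le> 1/4" using box[of t] by linarith
    moreover have "\<bar>x t - p\<bar> = \<bar>X t\<bar>" using abs_d by (simp add: x_def)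
    moreover have "x t - q = d * (X t - n)" using dn by (simp add: x_def algebra_simps)
    ultimately show ?thesis by (simp only: abs_d)
  qed
  have "p + d * (d * (\<xi> - p)) = \<xi>" "p + d * (d * (\<eta> - p)) = \<eta>" using d by auto
  moreover have "(x \<longlongrightarrow> p + d * (d * (\<xi> - p))) at_bot" "(x \<longlongrightarrow> p + d * (d * (\<eta> - p))) at_top"
    "(y \<longlongrightarrow> \<sigma> * 0) at_bot" "(y \<longlongrightarrow> \<sigma> * 0) at_top"
    unfolding x_def[abs_def] y_def[abs_def] by (intro tendsto_intros lim)+
  ultimately have lims: "(x \<longlongrightarrow> \<xi>) at_bot" "(y \<longlongrightarrow> 0) at_bot" "(x \<longlongrightarrow> \<eta>) at_top" "(y \<longlongrightarrow> 0) at_top"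
    by simp_all
  show ?thesis
    by (rule that[of x y]) (fact der side near lims)+
qed

section \<open>The coupled cell network\<close>

text \<open>At distance 1/8 from v the sine has absolute value at least 1/2, more than h, so D
  changes sign and has a zero. There D falls with slope at most -3 + 1/8, hence at rate at least 1,
  which gives the contraction towards that zero.\<close>

lemma perturbed_equilibrium:
  fixes h :: "real \<Rightarrow> real" and v :: int
  assumes h: "\<And>x. \<bar>h x\<bar> \<le> 1/8" and lip: "\<And>x x'. \<bar>h x - h x'\<bar> \<le> \<bar>x - x'\<bar> / 8"
  defines "D \<equiv> \<lambda>x. - sin (2 * pi * x) + h x"
  shows "\<exists>r::real. \<bar>r - v\<bar> \<le> 1/8 \<and> D r = 0 \<and> (\<forall>x::real. \<bar>x - v\<bar> \<le> 1/8 \<longrightarrow> D x * (x - r) \<le> - (x - r)\<^sup>2)"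
proof -
  have "(1/8)-lipschitz_on UNIV h"
    by (rule lipschitz_onI) (use lip in \<open>auto simp: dist_real_def\<close>)
  then have "continuous_on UNIV h" by (rule lipschitz_on_continuous_on)
  then have cont: "continuous_on {v - 1/8..v + 1/8} D"
    unfolding D_def by (intro continuous_intros) (auto intro: continuous_on_subset)
  have s: "1/2 \<le> sin (2 * pi * (1/8))" by (rule half_le_sin) auto
  have "sin (2 * pi * (v - 1/8)) = - sin (2 * pi * (1/8))"
    using sin_shift_int[of v "- (1/8)"] by simp
  then have "D (v - 1/8) \<ge> 0" using s h[of "v - 1/8"] unfolding D_def by linarith
  moreover have "sin (2 * pi * (v + 1/8)) = sin (2 * pi * (1/8))" by (rule sin_shift_int)
  then have "D (v + 1/8) \<le> 0" using s h[of "v + 1/8"] unfolding D_def by linarith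
  ultimately obtain r where r: "v - 1/8 \<le> r" "r \<le> v + 1/8" "D r = 0"
    using IVT2'[of D "v + 1/8" 0 "v - 1/8"] cont by auto
  have decrease: "D b - D a \<le> - (b - a)" if "v - 1/8 \<le> a" "a \<le> b" "b \<le> v + 1/8" for a b
  proof -
    have "3 * ((b - v) - (a - v)) \<le> sin (2 * pi * (b - v)) - sin (2 * pi * (a - v))"
      using that by (intro sin_increase) auto
    moreover have "sin (2 * pi * (x - v)) = sin (2 * pi * x)" for x :: real
      using sin_shift_int[of v "x - v"] by simp
    ultimately have "3 * (b - a) \<le> sin (2 * pi * b) - sin (2 * pi * a)" by simp
    moreover have "h b - h a \<le> (b - a) / 8" using lip[of b a] that by linarith
    moreover have "- sb + hb - (- sa + ha) \<le> - (b - a)"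
      if "3 * (b - a) \<le> sb - sa" "hb - ha \<le> (b - a) / 8" for sa sb ha hb
      using that \<open>a \<le> b\<close> by argo
    ultimately show ?thesis unfolding D_def by blast
  qed
  have "D x * (x - r) \<le> - (x - r)\<^sup>2" if x: "\<bar>x - v\<bar> \<le> 1/8" for x :: real
  proof (cases "r \<le> x")
    case True
    then have "D x \<le> - (x - r)" using decrease[of r x] r x by linarith
    then have "D x * (x - r) \<le> - (x - r) * (x - r)" using True by (intro mult_right_mono) auto
    then show ?thesis by (simp add: power2_eq_square algebra_simps)
  next
    case False
    then have "D x \<ge> r - x" using decrease[of x r] r x by linarith
    then have "D x * (r - x) \<ge> (r - x) * (r - x)" using False by (intro mult_right_mono) auto
    then show ?thesis by (simp add: power2_eq_square algebra_simps)
  qed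
  moreover have "\<bar>r - v\<bar> \<le> 1/8" using r by linarith
  ultimately show ?thesis using r(3) by blast
qed

text \<open>
  Cells \<open>cell 0, \<dots>, cell k\<close>.  Type \<open>j + 1\<close> couples \<open>cell j\<close> to every cell; type \<open>k + 2 + j\<close> couples
  \<open>cell j\<close> to itself and \<open>cell 0\<close> to the other cells.  All planes on which the cells other than
  \<open>cell (i + 1)\<close> are synchronous are then invariant, and they intersect in the diagonal: these are the
  pages of a book.
\<close>

locale book_cells =
  fixes cell :: "nat \<Rightarrow> 'c::finite" and k :: nat
  assumes bij: "bij_betw cell {0..<Suc k} UNIV"
begin

definition N :: "'c cell_network" where
  "N = \<lparr>coupling_types = 2 * Suc k,
        couplings = (\<lambda>j. if j \<le> Suc k then {(cell (j - 1), c) | c. True}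
           else {(if c = cell (j - 1 - Suc k) then c else cell 0, c) | c. True})\<rparr>"

lemma types: "coupling_types N = 2 * Suc k" by (simp add: N_def)

lemma network: "coupled_cell_network N"
  by (auto simp: coupled_cell_network_def N_def)

lemma source:
  "coupling_source N j c =
     (if j \<le> Suc k then cell (j - 1) else if c = cell (j - 1 - Suc k) then c else cell 0)"
  unfolding coupling_source_def N_def by (auto intro!: the_equality)

lemma cell_eq_iff: "a \<le> k \<Longrightarrow> b \<le> k \<Longrightarrow> cell a = cell b \<longleftrightarrow> a = b"
  using bij by (auto simp: bij_betw_def inj_on_def)

section \<open>Page coordinates and the response function\<close>

definition state :: "nat \<Rightarrow> real \<Rightarrow> real \<Rightarrow> real ^ 'c" where
  "state i x y = x *\<^sub>R (\<chi> c. 1) + y *\<^sub>R axis (cell (Suc i)) 1"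

lemma state_nth: "state i x y $ c = (if c = cell (Suc i) then x + y else x)"
  by (simp add: state_def axis_def)

text \<open>The arguments received by a synchronous cell at \<open>state i x y\<close>. Argument
  \<open>j + 1\<close> reports \<open>cell j\<close>, so the deviation of
  \<open>cell (i + 1)\<close> appears in argument \<open>i + 2\<close> alone.\<close>

definition base_input :: "nat \<Rightarrow> real \<Rightarrow> real \<Rightarrow> nat \<Rightarrow> real" where
  "base_input i x y j = (if 2 * Suc k < j then 0 else if j = i + 2 then x + y else x)"

text \<open>The arguments received by the deviating cell: it also sees itself in argument 0 and
  through its self-coupling of type \<open>k + 2 + (i + 1)\<close>. This difference lets y' be
  prescribed separately from x'.\<close>

definition tip_input :: "nat \<Rightarrow> real \<Rightarrow> real \<Rightarrow> nat \<Rightarrow> real" where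
  "tip_input i x y j =
     (if 2 * Suc k < j then 0 else if j = 0 \<or> j = i + 2 \<or> j = i + 3 + k then x + y else x)"

lemma inputs_in_space:
  "base_input i x y \<in> topspace (Euclidean_space (2 * Suc k + 1))"
  "tip_input i x y \<in> topspace (Euclidean_space (2 * Suc k + 1))"
  by (auto simp: topspace_Euclidean_space base_input_def tip_input_def)

text \<open>All cells but one receive the same arguments, so the plane is invariant for every g,
  with \<open>x' = g (base_input i x y)\<close> and y' the difference of the two values of
  g.\<close>

lemma field_state:
  assumes "i < k"
  shows "admissible_field N g (state i x y) =
    g (base_input i x y) *\<^sub>R (\<chi> c. 1) + (g (tip_input i x y) - g (base_input i x y)) *\<^sub>R axis (cell (Suc i)) 1"
proof -
  have "(\<lambda>j. if j = 0 then state i x y $ c else if j \<le> coupling_types N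
       then state i x y $ coupling_source N j c else 0) =
      (if c = cell (Suc i) then tip_input i x y else base_input i x y)" (is "?args = _") for c
  proof
    fix j
    consider "j = 0" | "0 < j" "j \<le> Suc k" | "Suc k < j" "j \<le> 2 * Suc k" | "2 * Suc k < j" by linarith
    then show "?args j = (if c = cell (Suc i) then tip_input i x y else base_input i x y) j"
    proof cases
      case 1
      then show ?thesis by (simp add: state_nth tip_input_def base_input_def)
    next
      case 2
      then have "cell (j - 1) = cell (Suc i) \<longleftrightarrow> j = i + 2"
        using assms cell_eq_iff[of "j - 1" "Suc i"] by auto
      then show ?thesis
        using 2 assms by (auto simp: state_nth types source tip_input_def base_input_def)
    next
      case 3
      then have "cell (j - 1 - Suc k) = cell (Suc i) \<longleftrightarrow> j = i + 3 + k"
        using assms cell_eq_iff[of "j - 1 - Suc k" "Suc i"] by auto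
      moreover have "cell 0 \<noteq> cell (Suc i)" using assms cell_eq_iff[of 0 "Suc i"] by simp
      ultimately show ?thesis
        using 3 assms by (auto simp: state_nth types source tip_input_def base_input_def)
    next
      case 4
      then show ?thesis by (simp add: types tip_input_def base_input_def)
    qed
  qed
  then show ?thesis
    by (simp add: admissible_field_def vec_eq_iff axis_def)
qed

lemma field_diagonal:
  "admissible_field N g (\<chi> c. x) = (\<chi> c. g (\<lambda>j. if 2 * Suc k < j then 0 else x))"
proof -
  have "(\<lambda>j. if j = 0 then x else if j \<le> coupling_types N then x else 0) =
      (\<lambda>j. if 2 * Suc k < j then 0 else x)"
    by (auto simp: types)
  then show ?thesis unfolding admissible_field_def vec_lambda_beta by simp
qed

lemma base_input_diagonal: "base_input i x 0 = (\<lambda>j. if 2 * Suc k < j then 0 else x)"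
  by (auto simp: base_input_def)

text \<open>On every page \<open>z 1\<close> is x, the state of the synchronous
  \<open>cell 0\<close>, and \<open>z (i + 2) - z 1\<close> is y on page i and 0 on the others, so
  only the summand of the current page survives. The factor \<open>z (i + 3 + k) - z 1\<close>
  equals y for the deviating cell and 0 for the rest: \<beta> enters y' but not x'.\<close>

definition response ::
    "(nat \<Rightarrow> real \<times> real \<Rightarrow> real) \<Rightarrow> (nat \<Rightarrow> real \<times> real \<Rightarrow> real) \<Rightarrow> (nat \<Rightarrow> real) \<Rightarrow> real" where
  "response \<alpha> \<beta> z = - sin (2 * pi * z 1) +
     (\<Sum>i<k. (z (i + 2) - z 1)\<^sup>2 * \<alpha> i (z 1, z (i + 2) - z 1) +
             (z (i + 3 + k) - z 1) * \<beta> i (z 1, z (i + 2) - z 1))"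

lemma elementary_response:
  assumes "\<And>i. i < k \<Longrightarrow> real_polynomial_function (\<alpha> i)" "\<And>i. i < k \<Longrightarrow> real_polynomial_function (\<beta> i)"
  shows "elementary (response \<alpha> \<beta>)"
proof -
  have "elementary (\<lambda>z. (- 1) * sin ((2 * pi) * z 1) +
     (\<Sum>i<k. (z (i + 2) - z 1) * (z (i + 2) - z 1) * \<alpha> i (z 1, z (i + 2) - z 1) +
             (z (i + 3 + k) - z 1) * \<beta> i (z 1, z (i + 2) - z 1)))"
    by (intro elementary.add elementary_sum elementary.mult elementary.sin elementary.const elementary.proj
        elementary_polynomial elementary_diff assms) auto
  then show ?thesis unfolding response_def[abs_def] by (simp add: power2_eq_square)
qed

lemma response_inputs:
  assumes "i < k"
  shows "response \<alpha> \<beta> (base_input i x y) = - sin (2 * pi * x) + y\<^sup>2 * \<alpha> i (x, y)"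
    and "response \<alpha> \<beta> (tip_input i x y) = response \<alpha> \<beta> (base_input i x y) + y * \<beta> i (x, y)"
proof -
  have b: "base_input i x y 1 = x" "base_input i x y (i' + 2) = (if i' = i then x + y else x)"
    "base_input i x y (i' + 3 + k) = x"
    and t: "tip_input i x y 1 = x" "tip_input i x y (i' + 2) = (if i' = i then x + y else x)"
    "tip_input i x y (i' + 3 + k) = (if i' = i then x + y else x)"
    if "i' < k" for i'
    using that assms by (auto simp: base_input_def tip_input_def)
  note b1 = b(1)[OF assms] and t1 = t(1)[OF assms]
  have "(\<Sum>i'<k. (base_input i x y (i' + 2) - x)\<^sup>2 * \<alpha> i' (x, base_input i x y (i' + 2) - x) +
      (base_input i x y (i' + 3 + k) - x) * \<beta> i' (x, base_input i x y (i' + 2) - x)) =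
    (\<Sum>i'<k. if i' = i then y\<^sup>2 * \<alpha> i (x, y) else 0)"
    by (rule sum.cong) (auto simp: b(2,3)[simplified])
  then have base: "response \<alpha> \<beta> (base_input i x y) = - sin (2 * pi * x) + y\<^sup>2 * \<alpha> i (x, y)"
    unfolding response_def b1 using assms by simp
  have "(\<Sum>i'<k. (tip_input i x y (i' + 2) - x)\<^sup>2 * \<alpha> i' (x, tip_input i x y (i' + 2) - x) +
      (tip_input i x y (i' + 3 + k) - x) * \<beta> i' (x, tip_input i x y (i' + 2) - x)) =
    (\<Sum>i'<k. if i' = i then y\<^sup>2 * \<alpha> i (x, y) + y * \<beta> i (x, y) else 0)"
    by (rule sum.cong) (auto simp: t(2,3)[simplified])
  then have "response \<alpha> \<beta> (tip_input i x y) = - sin (2 * pi * x) + (y\<^sup>2 * \<alpha> i (x, y) + y * \<beta> i (x, y))"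
    unfolding response_def t1 using assms by simp
  then show "response \<alpha> \<beta> (base_input i x y) = - sin (2 * pi * x) + y\<^sup>2 * \<alpha> i (x, y)"
    and "response \<alpha> \<beta> (tip_input i x y) = response \<alpha> \<beta> (base_input i x y) + y * \<beta> i (x, y)"
    using base by simp_all
qed

text \<open>Converts a Lipschitz bound for \<open>g - f\<close> into bounds in page coordinates. The
  third estimate bounds the perturbation of y' by a multiple of
  \<open>\<bar>y\<bar>\<close>.\<close>

lemma input_differences:
  fixes x y x' y' :: real
  shows
  "(\<Sum>j<2 * Suc k + 1. \<bar>base_input i x y j - base_input i x' y' j\<bar>) \<le> (2 * Suc k + 1) * (\<bar>x - x'\<bar> + \<bar>y - y'\<bar>)"
  "(\<Sum>j<2 * Suc k + 1. \<bar>tip_input i x y j - tip_input i x' y' j\<bar>) \<le> (2 * Suc k + 1) * (\<bar>x - x'\<bar> + \<bar>y - y'\<bar>)"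
  "(\<Sum>j<2 * Suc k + 1. \<bar>tip_input i x y j - base_input i x y j\<bar>) \<le> (2 * Suc k + 1) * \<bar>y\<bar>"
proof -
  have bound: "(\<Sum>j<2 * Suc k + 1. u j) \<le> (2 * Suc k + 1) * r" if "\<And>j. u j \<le> r" for u :: "nat \<Rightarrow> real" and r :: real
    using sum_bounded_above[of "{..<2 * Suc k + 1}" u r] that by (simp add: algebra_simps)
  show "(\<Sum>j<2 * Suc k + 1. \<bar>base_input i x y j - base_input i x' y' j\<bar>) \<le> (2 * Suc k + 1) * (\<bar>x - x'\<bar> + \<bar>y - y'\<bar>)"
    by (rule bound) (auto simp: base_input_def)
  show "(\<Sum>j<2 * Suc k + 1. \<bar>tip_input i x y j - tip_input i x' y' j\<bar>) \<le> (2 * Suc k + 1) * (\<bar>x - x'\<bar> + \<bar>y - y'\<bar>)"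
    by (rule bound) (auto simp: tip_input_def)
  show "(\<Sum>j<2 * Suc k + 1. \<bar>tip_input i x y j - base_input i x y j\<bar>) \<le> (2 * Suc k + 1) * \<bar>y\<bar>"
    by (rule bound) (auto simp: tip_input_def base_input_def)
qed

lemma state_trajectory:
  assumes "i < k"
    and "\<And>t. (x has_real_derivative g (base_input i (x t) (y t))) (at t)"
    and "\<And>t. (y has_real_derivative g (tip_input i (x t) (y t)) - g (base_input i (x t) (y t))) (at t)"
  shows "trajectory (admissible_field N g) (\<lambda>t. state i (x t) (y t))"
  unfolding trajectory_def field_state[OF assms(1)] unfolding state_def
  using assms(2,3)
  by (auto intro!: has_vector_derivative_add has_vector_derivative_scaleR[THEN has_vector_derivative_eq_rhs]
      derivative_eq_intros)

lemma state_tendsto: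
  assumes "(x \<longlongrightarrow> r) F" "(y \<longlongrightarrow> 0) F"
  shows "((\<lambda>t. state i (x t) (y t)) \<longlongrightarrow> (\<chi> c. r)) F"
proof -
  have "((\<lambda>t. state i (x t) (y t)) \<longlongrightarrow> state i r 0) F"
    unfolding state_def by (intro tendsto_intros assms)
  moreover have "state i r 0 = (\<chi> c. r)" by (simp add: vec_eq_iff state_nth)
  ultimately show ?thesis by simp
qed

end

lemma compatible_edges:
  assumes "p \<noteq> q" "p' \<noteq> q'" "p \<noteq> q'" "p' \<noteq> q" "s \<Longrightarrow> p = p' \<Longrightarrow> q = q'"
    and "s \<Longrightarrow> min p q < min p' q' \<Longrightarrow> min p' q' < max p q \<Longrightarrow> max p q < max p' q' \<Longrightarrow> False"
    and "s \<Longrightarrow> min p' q' < min p q \<Longrightarrow> min p q < max p' q' \<Longrightarrow> max p' q' < max p q \<Longrightarrow> False"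
  shows "compatible s p q p' q'"
  unfolding compatible_def using assms
  by (metis linorder_cases linorder_not_less order_less_imp_le order_refl)

context book_cells
begin

lemma realization:
  fixes G :: "('v, 'e) pre_digraph" and B :: "('v, 'e) book"
  assumes fin: "fin_digraph G" and loopfree: "loopfree_digraph G" and embedding: "book_embedding G k B"
  shows "\<exists>f. smooth_fun (coupling_types N + 1) f \<and> robustly_realizes N f G"
proof -
  interpret book_setting G k B by (rule book_setting.intro[OF fin embedding])
  obtain pos :: "'v \<Rightarrow> int" and pg :: "'e \<Rightarrow> nat" and side :: "'e \<Rightarrow> real"
    where pos: "inj_on pos (verts G)"
    and pg: "\<And>e. e \<in> arcs G \<Longrightarrow> pg e < k \<and> (side e = 1 \<or> side e = -1)"
    and no_through: "\<And>e e'. e \<in> arcs G \<Longrightarrow> e' \<in> arcs G \<Longrightarrow> pg e = pg e' \<Longrightarrow> tail G e \<noteq> head G e'"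
    and out: "\<And>e e'. e \<in> arcs G \<Longrightarrow> e' \<in> arcs G \<Longrightarrow> pg e = pg e' \<Longrightarrow> side e = side e' \<Longrightarrow>
       tail G e = tail G e' \<Longrightarrow> e = e'"
    and noncrossing: "\<And>e e'. e \<in> arcs G \<Longrightarrow> e' \<in> arcs G \<Longrightarrow> pg e = pg e' \<Longrightarrow> side e = side e' \<Longrightarrow>
       min (pos (tail G e)) (pos (head G e)) < min (pos (tail G e')) (pos (head G e')) \<Longrightarrow>
       min (pos (tail G e')) (pos (head G e')) < max (pos (tail G e)) (pos (head G e)) \<Longrightarrow>
       max (pos (tail G e)) (pos (head G e)) < max (pos (tail G e')) (pos (head G e')) \<Longrightarrow> False"
    by (rule combinatorial_book) (rule that)
  define P Q where "P e = pos (tail G e)" and "Q e = pos (head G e)" for e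
  have pos_eq: "pos v = pos v' \<longleftrightarrow> v = v'" if "v \<in> verts G" "v' \<in> verts G" for v v'
    using pos that by (auto dest: inj_onD)
  have PQ: "P e \<noteq> Q e" if "e \<in> arcs G" for e
    using loopfree that ends_in_verts[OF that]
    by (auto simp: P_def Q_def pos_eq loopfree_digraph_def loopfree_digraph_axioms_def)
  have PQ': "P e \<noteq> Q e'" if "e \<in> arcs G" "e' \<in> arcs G" "pg e = pg e'" for e e'
    using no_through[OF that] ends_in_verts[OF that(1)] ends_in_verts[OF that(2)] by (simp add: P_def Q_def pos_eq)
  have PP: "e = e'" if "e \<in> arcs G" "e' \<in> arcs G" "pg e = pg e'" "side e = side e'" "P e = P e'" for e e'
    using out[OF that(1-4)] that(5) ends_in_verts[OF that(1)] ends_in_verts[OF that(2)] by (simp add: P_def pos_eq)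
  have compat: "compatible (side e = side e') (P e) (Q e) (P e') (Q e')"
    if e: "e \<in> arcs G" "e' \<in> arcs G" "pg e = pg e'" for e e'
  proof (rule compatible_edges)
    show "Q e = Q e'" if "side e = side e'" "P e = P e'" using PP[OF e that] by simp
  qed (use PQ PQ' e noncrossing[OF e] noncrossing[OF e(2,1) e(3)[symmetric]] in \<open>auto simp: P_def Q_def\<close>)
  have "\<exists>\<alpha> \<beta>. real_polynomial_function \<alpha> \<and> real_polynomial_function \<beta> \<and>
      (\<forall>e x y. e \<in> arcs G \<longrightarrow> pg e = i \<longrightarrow>
        ((x, side e * y) \<in> up_set (P e) (Q e) \<longrightarrow> \<beta> (x, y) \<ge> 1/2) \<and>
        ((x, side e * y) \<in> down_set (P e) (Q e) \<longrightarrow> \<beta> (x, y) \<le> - 1/2) \<and>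
        ((x, side e * y) \<in> right_set (P e) (Q e) \<longrightarrow> \<alpha> (x, y) \<ge> 3) \<and>
        ((x, side e * y) \<in> left_set (P e) (Q e) \<longrightarrow> \<alpha> (x, y) \<le> - 3))" for i
  proof -
    have "finite {e \<in> arcs G. pg e = i}" using fin by (simp add: fin_digraph_def fin_digraph_axioms_def)
    from page_fields_exist[OF this, of side P Q] compat pg show ?thesis
      by (smt (verit, del_insts) mem_Collect_eq)
  qed
  then obtain \<alpha> \<beta> where \<alpha>: "\<And>i. real_polynomial_function (\<alpha> i)" and \<beta>: "\<And>i. real_polynomial_function (\<beta> i)"
    and signs: "\<And>e x y. e \<in> arcs G \<Longrightarrow>
        ((x, side e * y) \<in> up_set (P e) (Q e) \<longrightarrow> \<beta> (pg e) (x, y) \<ge> 1/2) \<and>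
        ((x, side e * y) \<in> down_set (P e) (Q e) \<longrightarrow> \<beta> (pg e) (x, y) \<le> - 1/2) \<and>
        ((x, side e * y) \<in> right_set (P e) (Q e) \<longrightarrow> \<alpha> (pg e) (x, y) \<ge> 3) \<and>
        ((x, side e * y) \<in> left_set (P e) (Q e) \<longrightarrow> \<alpha> (pg e) (x, y) \<le> - 3)"
    by metis
  define f where "f = response \<alpha> \<beta>"
  define m where "m = 2 * Suc k + 1"
  have m: "coupling_types N + 1 = m" by (simp add: types m_def)
  have f: "elementary f" unfolding f_def by (rule elementary_response[OF \<alpha> \<beta>])
  \<comment> \<open>There are m arguments. If each moves by at most r, the perturbation changes by
    at most \<open>\<epsilon> * m * r = r / 8\<close>.\<close>
  define \<epsilon> where "\<epsilon> = 1 / (8 * real m)"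
  have \<epsilon>: "\<epsilon> > 0" "\<epsilon> * m = 1/8" "\<epsilon> \<le> 1/8" by (auto simp: \<epsilon>_def m_def field_simps)
  have main: "realizes (admissible_field N g) G" if g: "Ck_fun m 1 g" and close: "C1_close m \<epsilon> f g" for g
  proof -
    define h where "h z = g z - f z" for z :: "nat \<Rightarrow> real"
    have h_le: "\<bar>h z\<bar> \<le> 1/8" if "z \<in> topspace (Euclidean_space m)" for z
      using close that \<epsilon>(3) unfolding C1_close_def h_def by fastforce
    have h_lip: "\<bar>h z - h z'\<bar> \<le> r / 8"
      if "z \<in> topspace (Euclidean_space m)" "z' \<in> topspace (Euclidean_space m)"
        "(\<Sum>j<m. \<bar>z j - z' j\<bar>) \<le> m * r" for z z' :: "nat \<Rightarrow> real" and r :: real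
    proof -
      have "\<bar>h z - h z'\<bar> \<le> \<epsilon> * (\<Sum>j<m. \<bar>z j - z' j\<bar>)"
        unfolding h_def by (rule C1_close_lipschitz[OF elementary_Ck_fun[OF f] g close that(1,2)])
      also have "\<dots> \<le> \<epsilon> * (m * r)" using that(3) \<epsilon>(1) by (intro mult_left_mono) auto
      also have "\<dots> = r / 8" using \<epsilon>(2) by (simp flip: mult.assoc)
      finally show ?thesis .
    qed
    note space = inputs_in_space[folded m_def] and diffs = input_differences[folded m_def]
    define diag where "diag x = (\<lambda>j. if 2 * Suc k < j then 0 else x)" for x :: real
    \<comment> \<open>The right side does not depend on i: all pages share the diagonal, so one
      choice of perturbed equilibria serves every page.\<close>
    have diag: "diag x = base_input i x 0" for x i by (simp add: base_input_diagonal diag_def)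
    have f_diag: "f (diag x) = - sin (2 * pi * x)" for x
    proof -
      have "(\<Sum>i<k. (diag x (i + 2) - diag x 1)\<^sup>2 * \<alpha> i (diag x 1, diag x (i + 2) - diag x 1) +
             (diag x (i + 3 + k) - diag x 1) * \<beta> i (diag x 1, diag x (i + 2) - diag x 1)) = 0"
        by (intro sum.neutral) (auto simp: diag_def)
      then show ?thesis unfolding f_def response_def by (simp add: diag_def)
    qed
    have "\<exists>r::real. \<bar>r - v\<bar> \<le> 1/8 \<and> - sin (2 * pi * r) + h (diag r) = 0 \<and>
        (\<forall>x::real. \<bar>x - v\<bar> \<le> 1/8 \<longrightarrow> (- sin (2 * pi * x) + h (diag x)) * (x - r) \<le> - (x - r)\<^sup>2)" for v :: int
    proof (rule perturbed_equilibrium)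
      show "\<bar>h (diag x)\<bar> \<le> 1/8" for x unfolding diag[of x 0] by (rule h_le[OF space(1)])
      show "\<bar>h (diag x) - h (diag x')\<bar> \<le> \<bar>x - x'\<bar> / 8" for x x'
        unfolding diag[of _ 0] using diffs(1)[of 0 x 0 x' 0] by (intro h_lip space) simp
    qed
    then obtain \<zeta> :: "int \<Rightarrow> real" where \<zeta>: "\<And>v. \<bar>\<zeta> v - v\<bar> \<le> 1/8"
      "\<And>v. - sin (2 * pi * \<zeta> v) + h (diag (\<zeta> v)) = 0"
      "\<And>v (x::real). \<bar>x - v\<bar> \<le> 1/8 \<Longrightarrow> (- sin (2 * pi * x) + h (diag x)) * (x - \<zeta> v) \<le> - (x - \<zeta> v)\<^sup>2"
      by metis
    define \<xi> :: "'v \<Rightarrow> real ^ 'c" where "\<xi> v = (\<chi> c. \<zeta> (pos v))" for v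
    have \<zeta>_inj: "v = v'" if "\<zeta> v = \<zeta> v'" for v v'
    proof -
      have "\<bar>real_of_int v - real_of_int v'\<bar> < 1" using \<zeta>(1)[of v] \<zeta>(1)[of v'] that by argo
      then show ?thesis by linarith
    qed
    have equilibrium: "admissible_field N g (\<xi> v) = 0" for v
    proof -
      have "g (diag (\<zeta> (pos v))) = 0"
        using \<zeta>(2)[of "pos v"] f_diag[of "\<zeta> (pos v)"] by (simp add: h_def)
      then show ?thesis unfolding \<xi>_def field_diagonal diag_def by (simp add: vec_eq_iff)
    qed
    define base where "base e x y = - sin (2 * pi * x) + y\<^sup>2 * \<alpha> (pg e) (x, y) + h (base_input (pg e) x y)" for e x y
    define tip where "tip e x y = y * \<beta> (pg e) (x, y) + (h (tip_input (pg e) x y) - h (base_input (pg e) x y))" for e x y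
    have g_base: "g (base_input (pg e) x y) = base e x y"
      and g_tip: "g (tip_input (pg e) x y) - g (base_input (pg e) x y) = tip e x y" if "e \<in> arcs G" for e x y
      using response_inputs[of "pg e" \<alpha> \<beta> x y] pg[OF that]
      by (simp_all add: base_def tip_def h_def f_def)
    define connects where "connects e x y \<longleftrightarrow> (\<forall>t. (x has_real_derivative base e (x t) (y t)) (at t) \<and>
          (y has_real_derivative tip e (x t) (y t)) (at t) \<and> side e * y t > 0 \<and>
          (\<bar>y t\<bar> < 1/2 \<longrightarrow> \<bar>x t - P e\<bar> \<le> 1/4 \<or> \<bar>x t - Q e\<bar> \<le> 1/4)) \<and>
        (x \<longlongrightarrow> \<zeta> (P e)) at_bot \<and> (y \<longlongrightarrow> 0) at_bot \<and> (x \<longlongrightarrow> \<zeta> (Q e)) at_top \<and> (y \<longlongrightarrow> 0) at_top" for e x y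
    have "\<exists>x y. connects e x y" if e: "e \<in> arcs G" for e
    proof -
      let ?h = "\<lambda>x y. h (base_input (pg e) x y)" and ?k = "\<lambda>x y. h (tip_input (pg e) x y) - h (base_input (pg e) x y)"
      have lip_h: "\<bar>?h x y - ?h x' y'\<bar> \<le> (\<bar>x - x'\<bar> + \<bar>y - y'\<bar>) / 8"
        and lip_t: "\<bar>h (tip_input (pg e) x y) - h (tip_input (pg e) x' y')\<bar> \<le> (\<bar>x - x'\<bar> + \<bar>y - y'\<bar>) / 8" for x y x' y'
        by (intro h_lip space diffs)+
      show ?thesis
      proof (rule page_connection[of "P e" "Q e" "side e" "\<alpha> (pg e)" "\<beta> (pg e)" ?h ?k "1/4" "\<zeta> (P e)" "\<zeta> (Q e)"])
        show "P e \<noteq> Q e" by (rule PQ[OF e])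
        show "side e = 1 \<or> side e = - 1" using pg[OF e] by simp
        show "\<bar>?h x y\<bar> \<le> 1/8" for x y by (rule h_le[OF space(1)])
        show "\<bar>?k x y\<bar> \<le> \<bar>y\<bar> / 4" for x y
          using h_lip[OF space(2) space(1) diffs(3)[of "pg e" x y]] by simp
        show "\<bar>?h x y - ?h x' y'\<bar> \<le> 1/4 * (\<bar>x - x'\<bar> + \<bar>y - y'\<bar>)" for x y x' y'
          using lip_h[of x y x' y'] by argo
        show "\<bar>?k x y - ?k x' y'\<bar> \<le> 1/4 * (\<bar>x - x'\<bar> + \<bar>y - y'\<bar>)" for x y x' y'
          using lip_h[of x y x' y'] lip_t[of x y x' y'] by argo
      next
        fix x y :: "real \<Rightarrow> real"
        assume *: "\<And>t. (x has_real_derivative - sin (2 * pi * x t) + (y t)\<^sup>2 * \<alpha> (pg e) (x t, y t) + ?h (x t) (y t)) (at t)"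
          "\<And>t. (y has_real_derivative y t * \<beta> (pg e) (x t, y t) + ?k (x t) (y t)) (at t)" "\<And>t. side e * y t > 0"
          "\<And>t. \<bar>y t\<bar> < 1/2 \<Longrightarrow> \<bar>x t - P e\<bar> \<le> 1/4 \<or> \<bar>x t - Q e\<bar> \<le> 1/4"
          "(x \<longlongrightarrow> \<zeta> (P e)) at_bot" "(y \<longlongrightarrow> 0) at_bot" "(x \<longlongrightarrow> \<zeta> (Q e)) at_top" "(y \<longlongrightarrow> 0) at_top"
        then show ?thesis unfolding connects_def base_def tip_def by (intro exI[of _ x] exI[of _ y]) blast
      qed (use signs[OF e] \<alpha> \<beta> \<zeta>(1,3) in \<open>auto simp: base_def tip_def diag[of _ "pg e", symmetric]\<close>)
    qed
    then obtain x y where connects: "\<And>e. e \<in> arcs G \<Longrightarrow> connects e (x e) (y e)" by metis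
    then have xy: "\<And>e t. e \<in> arcs G \<Longrightarrow> (x e has_real_derivative base e (x e t) (y e t)) (at t)"
      "\<And>e t. e \<in> arcs G \<Longrightarrow> (y e has_real_derivative tip e (x e t) (y e t)) (at t)"
      "\<And>e t. e \<in> arcs G \<Longrightarrow> side e * y e t > 0"
      "\<And>e t. e \<in> arcs G \<Longrightarrow> \<bar>y e t\<bar> < 1/2 \<Longrightarrow> \<bar>x e t - P e\<bar> \<le> 1/4 \<or> \<bar>x e t - Q e\<bar> \<le> 1/4"
      "\<And>e. e \<in> arcs G \<Longrightarrow> (x e \<longlongrightarrow> \<zeta> (P e)) at_bot" "\<And>e. e \<in> arcs G \<Longrightarrow> (y e \<longlongrightarrow> 0) at_bot"
      "\<And>e. e \<in> arcs G \<Longrightarrow> (x e \<longlongrightarrow> \<zeta> (Q e)) at_top" "\<And>e. e \<in> arcs G \<Longrightarrow> (y e \<longlongrightarrow> 0) at_top"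
      unfolding connects_def by blast+
    define orbit where "orbit e t = state (pg e) (x e t) (y e t)" for e t
    have "heteroclinic_connection (admissible_field N g) (\<xi> (tail G e)) (\<xi> (head G e)) (range (orbit e))"
      if e: "e \<in> arcs G" for e
      unfolding heteroclinic_connection_def
    proof (intro exI conjI)
      show "trajectory (admissible_field N g) (orbit e)"
        unfolding orbit_def[abs_def]
        by (rule state_trajectory) (use pg[OF e] xy(1,2)[OF e] g_base[OF e] g_tip[OF e] in auto)
      show "(orbit e \<longlongrightarrow> \<xi> (tail G e)) at_bot"
        unfolding orbit_def[abs_def] \<xi>_def P_def[symmetric] by (intro state_tendsto xy(5,6) e)
      show "(orbit e \<longlongrightarrow> \<xi> (head G e)) at_top"
        unfolding orbit_def[abs_def] \<xi>_def Q_def[symmetric] by (intro state_tendsto xy(7,8) e)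
    qed simp
    \<comment> \<open>A point of the orbit of e near its source reveals the edge: the deviating cell
      gives the page, the sign of the deviation the half-plane, and the nearby integer the source.
      These three determine e by \<open>PP\<close>.\<close>
    moreover have "inj_on (\<lambda>e. range (orbit e)) (arcs G)"
    proof (rule inj_onI)
      fix e e' assume e: "e \<in> arcs G" "e' \<in> arcs G" and eq: "range (orbit e) = range (orbit e')"
      have "\<forall>\<^sub>F t in at_bot. \<bar>x e t - \<zeta> (P e)\<bar> < 1/8" "\<forall>\<^sub>F t in at_bot. \<bar>y e t\<bar> < 1/2"
        using tendstoD[OF xy(5)[OF e(1)], of "1/8"] tendstoD[OF xy(6)[OF e(1)], of "1/2"]
        by (simp_all add: dist_real_def)
      then have "\<forall>\<^sub>F t in at_bot. \<bar>x e t - \<zeta> (P e)\<bar> < 1/8 \<and> \<bar>y e t\<bar> < 1/2" by (rule eventually_conj)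
      then obtain t where t: "\<bar>x e t - \<zeta> (P e)\<bar> < 1/8" "\<bar>y e t\<bar> < 1/2"
        using eventually_happens'[OF trivial_limit_at_bot_linorder] by blast
      obtain t' where t': "orbit e t = orbit e' t'" using eq by blast
      have k: "pg e < k" "pg e' < k" using pg e by blast+
      have cells: "(if c = cell (Suc (pg e)) then x e t + y e t else x e t) =
          (if c = cell (Suc (pg e')) then x e' t' + y e' t' else x e' t')" for c
        using arg_cong[OF t', of "\<lambda>z. z $ c"] unfolding orbit_def state_nth .
      have ne: "cell 0 \<noteq> cell (Suc (pg e))" "cell 0 \<noteq> cell (Suc (pg e'))"
        using k cell_eq_iff[of 0] by auto
      have x_eq: "x e t = x e' t'" using cells[of "cell 0"] ne by simp
      have y_ne: "y e t \<noteq> 0" using xy(3)[OF e(1), of t] by auto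
      have page_eq: "pg e = pg e'"
      proof (rule ccontr)
        assume "pg e \<noteq> pg e'"
        then have "cell (Suc (pg e)) \<noteq> cell (Suc (pg e'))" using k cell_eq_iff[of "Suc (pg e)" "Suc (pg e')"] by simp
        then show False using cells[of "cell (Suc (pg e))"] x_eq y_ne by simp
      qed
      then have y_eq: "y e t = y e' t'" using cells[of "cell (Suc (pg e))"] x_eq by simp
      have "side e = side e'"
        using xy(3)[OF e(1), of t] xy(3)[OF e(2), of t'] y_eq pg[OF e(1)] pg[OF e(2)] by auto
      \<comment> \<open>At this low height the orbit of e' must be near one of its own ends, and two
        integers within 1/2 + 1/4 of each other are equal. The end is not the head of e', since a
        source of the page is never a sink of it.\<close>
      moreover have "P e = P e'"
      proof -
        have "\<bar>x e' t' - P e'\<bar> \<le> 1/4 \<or> \<bar>x e' t' - Q e'\<bar> \<le> 1/4" using xy(4)[OF e(2), of t'] t y_eq by simp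
        moreover have "\<bar>x e' t' - P e\<bar> < 1/2" using t(1) \<zeta>(1)[of "P e"] x_eq by argo
        moreover have "a = b" if "\<bar>r - real_of_int a\<bar> < 1/2" "\<bar>r - real_of_int b\<bar> \<le> 1/4" for r a b
          using that by linarith
        ultimately have "P e = P e' \<or> P e = Q e'" by blast
        then show ?thesis using PQ'[OF e page_eq] by blast
      qed
      ultimately show "e = e'" using PP[OF e page_eq] by blast
    qed
    moreover have "inj_on \<xi> (verts G)"
      by (rule inj_onI) (auto simp: \<xi>_def vec_eq_iff pos_eq dest!: \<zeta>_inj)
    ultimately show ?thesis
      unfolding realizes_def using equilibrium by blast
  qed
  have "C1_close m \<epsilon> f f" using \<epsilon>(1) by (simp add: C1_close_def)
  then have "realizes (admissible_field N f) G" by (rule main[OF elementary_Ck_fun[OF f]])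
  then have "robustly_realizes N f G"
    unfolding robustly_realizes_def m using main \<epsilon>(1) by blast
  then show ?thesis using smooth_fun_elementary[OF f] by blast
qed

end

theorem theorem1:
  fixes G :: "('v, 'e) pre_digraph"
  assumes "heteroclinic_network G"
    and "loopfree_digraph G"
  shows "(\<forall>k B. book_embedding G k B \<and> CARD('c::finite) = k + 1 \<longrightarrow>
            (\<exists>(N :: 'c cell_network) f.
               coupled_cell_network N \<and> smooth_fun (coupling_types N + 1) f \<and>
               robustly_realizes N f G)) \<and>
         (\<forall>b. book_thickness G = enat b \<and> CARD('c) = b + 1 \<longrightarrow>
            (\<exists>(N :: 'c cell_network) f.
               coupled_cell_network N \<and> smooth_fun (coupling_types N + 1) f \<and>
               robustly_realizes N f G))"
proof -
  have main: "\<exists>(N :: 'c cell_network) f. coupled_cell_network N \<and> smooth_fun (coupling_types N + 1) f \<and>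
      robustly_realizes N f G"
    if B: "book_embedding G k B" and card: "CARD('c) = k + 1" for k and B :: "('v, 'e) book"
  proof -
    obtain cell :: "nat \<Rightarrow> 'c" where "bij_betw cell {0..<CARD('c)} UNIV"
      using ex_bij_betw_nat_finite[of "UNIV :: 'c set"] by auto
    then interpret book_cells cell k by unfold_locales (simp add: card)
    have "fin_digraph G" using assms(1) by (simp add: heteroclinic_network_def)
    then show ?thesis using realization[OF _ assms(2) B] network by blast
  qed
  \<comment> \<open>A finite thickness is attained: the set of page numbers is then nonempty, and
    extended naturals are well-ordered.\<close>
  moreover have "\<exists>B. book_embedding G b B" if "book_thickness G = enat b" for b
  proof -
    let ?K = "{enat k | k. \<exists>B. book_embedding G k B}"
    have "?K \<noteq> {}"
    proof
      assume "?K = {}"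
      then have "book_thickness G = \<infinity>" unfolding book_thickness_def Inf_enat_def by simp
      then show False using that by simp
    qed
    then have "Inf ?K \<in> ?K" by (metis (mono_tags, lifting) Inf_enat_def LeastI ex_in_conv)
    then show ?thesis using that by (auto simp: book_thickness_def)
  qed
  ultimately show ?thesis by metis
qed

end
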